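(* Let $a<b$, $\tau>0$, $\tau<b-a$, let $\alpha_1,\dots,\alpha_n,\beta_1,\dots,\beta_m$ be real orders, put $\alpha_{\max}=\max\{\alpha_i,\beta_j: 1\le i\le n,\ 1\le j\le m\}$, and let $k$ be the integer with $k-1\le \alpha_{\max}<k$. Let $c_0,\dots,c_{k-1}$ be constants and $\phi$ a smooth function on $[a-\tau,a]$. Let $L:[a-\tau,b]\times\mathbb{R}^{m+n+2k+2}\to\mathbb{R}$, with arguments $L[t,v_1,\dots,v_n,w_1,\dots,w_m,x_0,\dots,x_k,h_0,\dots,h_k]$, have continuous first and second partial derivatives with respect to all of its arguments. Consider the functional $$J(y)=\int_a^b L\big[t,{}_a^CD^{\alpha_1}y(t),\dots,{}_a^CD^{\alpha_n}y(t),{}^CD_b^{\beta_1}y(t),\dots,{}^CD_b^{\beta_m}y(t),y(t),y'(t),\dots,y^{(k)}(t),y(t-\tau),y'(t-\tau),\dots,y^{(k)}(t-\tau)\big]\,dt$$ defined on the set of continuous functions $y$ which have continuous left Caputo fractional derivatives of orders $\alpha_i$ ($1\le i\le n$) and continuous right Caputo fractional derivatives of orders $\beta_j$ ($1\le j\le m$) in $[a,b]$ and satisfy $$y^{(l)}(b)=c_l,\quad l=0,1,\dots,k-1,\qquad y(t)=\phi(t),\quad t\in[a-\tau,a].$$ If $J$ possesses a minimum at $y$, then the following conditions hold (where all partial derivatives of $L$ are evaluated along $y$): (1) for $a\le t\le b-\tau$, $$\sum_{i=1}^nD_{b-\tau}^{\alpha_i}\Big(\frac{\partial L}{\partial v_i}\Big)(t)+\sum_{j=1}^m{}_aD^{\beta_j}\Big(\frac{\partial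 L}{\partial w_j}\Big)(t)+\sum_{p=0}^k(-1)^p\frac{d^p}{dt^p}\Big(\frac{\partial L}{\partial x_p}\Big)(t)+\sum_{p=0}^k(-1)^p\frac{d^p}{dt^p}\Big(\frac{\partial L}{\partial h_p}\Big)(t+\tau)$$ $$-\sum_{i=1}^n\frac{1}{\Gamma(\alpha_i)}D_{b-\tau}^{\alpha_i}\Big(\int_{b-\tau}^b\Big(D_b^{\alpha_i}\frac{\partial L}{\partial v_i}\Big)(s)\,(s-t)^{\alpha_i-1}ds\Big)=0;$$ (2) for $b-\tau\le t\le b$, $$\sum_{i=1}^nD_b^{\alpha_i}\Big(\frac{\partial L}{\partial v_i}\Big)(t)+\sum_{j=1}^m{}_{b-\tau}D^{\beta_j}\Big(\frac{\partial L}{\partial w_j}\Big)(t)+\sum_{p=0}^k(-1)^p\frac{d^p}{dt^p}\Big(\frac{\partial L}{\partial x_p}\Big)(t)$$ $$-\sum_{j=1}^m\frac{1}{\Gamma(\beta_j)}\,{}_{b-\tau}D^{\beta_j}\Big(\int_a^{b-\tau}\Big({}_aD^{\beta_j}\frac{\partial L}{\partial w_j}\Big)(s)\,(t-s)^{\beta_j-1}ds\Big)=0;$$ (3) the transversality conditions $$\sum_{p=1}^k\sum_{q=0}^{p-1}(-1)^q\frac{d^q}{dt^q}\Big(\frac{\partial L}{\partial x_p}\Big)(t)\,\eta^{(p-q-1)}(t)\Big|_a^{b-\tau}+\sum_{p=1}^k\sum_{q=0}^{p-1}(-1)^q\frac{d^q}{dt^q}\Big(\frac{\partial L}{\partial h_p}\Big)(t+\tau)\,\eta^{(p-q-1)}(t)\Big|_a^{b-\tau}$$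 $$+\sum_{p=1}^k\sum_{q=0}^{p-1}(-1)^q\frac{d^q}{dt^q}\Big(\frac{\partial L}{\partial x_p}\Big)(t)\,\eta^{(p-q-1)}(t)\Big|_{b-\tau}^{b}=0$$ for any admissible function $\eta$ satisfying $\eta(t)\equiv0$ for $t\in[a-\tau,a]$ and $\eta^{(l)}(b)=0$, $l=0,1,\dots,k-1$.
   Context: For an order $\alpha>0$ with $N-1<\alpha<N$ ($N$ a positive integer) and a base point $c$: - left Riemann-Liouville derivative: ${}_cD^\alpha f(t)=\frac{1}{\Gamma(N-\alpha)}\left(\frac{d}{dt}\right)^N\int_c^t(t-s)^{N-\alpha-1}f(s)\,ds$; - right Riemann-Liouville derivative: $D_c^\alpha f(t)=\frac{1}{\Gamma(N-\alpha)}\left(-\frac{d}{dt}\right)^N\int_t^c(s-t)^{N-\alpha-1}f(s)\,ds$; - left Caputo derivative: ${}_c^CD^\alpha f(t)=\frac{1}{\Gamma(N-\alpha)}\int_c^t(t-s)^{N-\alpha-1}f^{(N)}(s)\,ds$; - right Caputo derivative: ${}^CD_c^\alpha f(t)=\frac{1}{\Gamma(N-\alpha)}\int_t^c(s-t)^{N-\alpha-1}(-1)^Nf^{(N)}(s)\,ds$. The variables $v_i,w_j,x_p,h_p$ are the slots of $L$ occupied by ${}_a^CD^{\alpha_i}y(t)$, ${}^CD_b^{\beta_j}y(t)$, $y^{(p)}(t)$, $y^{(p)}(t-\tau)$ respectively. For a slot $\sigma$, $\left(\frac{\partial L}{\partial\sigma}\right)(t)$ denotes the function of $t$ obtained by evaluating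 the partial derivative of $L$ in the slot $\sigma$ at the arguments at time $t$ determined by $y$; $\left(\frac{\partial L}{\partial\sigma}\right)(t+\tau)$ is that function at $t+\tau$. In the terms with integrals, the outer fractional derivative is applied to the integral as a function of $t$. $F(t)\big|_{c}^{d}$ means $F(d)-F(c)$. An admissible function $\eta$ is a real-valued variation, i.e. such that $y+\epsilon\eta$ belongs to the domain of $J$ for $\epsilon\in\mathbb{R}$.
   Formalization: Added: y is C^k on [a-τ,b]; ∂L/∂v_i, ∂L/∂w_j are right/left fractional integrals (orders α_i, β_j) of L^1 functions; ∂L/∂x_p, ∂L/∂h_p(·+τ) are p-1 times differentiable on the pieces; (1),(2) hold where all their derivatives exist (the claim is otherwise ill-defined, or false for orders >1). *)

theory Defs
  imports "HOL-Analysis.Analysis"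
begin

subsection \<open>Derivatives relative to a set\<close>

text \<open>All functions live on compact intervals, so every derivative is taken relative to an interval
  \<open>S\<close>: it is the two-sided derivative inside \<open>S\<close> and the one-sided derivative at an endpoint of \<open>S\<close>.
  Values of a function outside its interval are therefore irrelevant.\<close>

primrec iter_deriv :: "real set \<Rightarrow> nat \<Rightarrow> (real \<Rightarrow> real) \<Rightarrow> real \<Rightarrow> real" where
  "iter_deriv S 0 f = f"
| "iter_deriv S (Suc n) f = (\<lambda>t. vector_derivative (iter_deriv S n f) (at t within S))"

text \<open>Existence of the \<open>n\<close>-th derivative at the point \<open>t\<close>: the derivative of order \<open>n - 1\<close> exists on
  a neighbourhood of \<open>t\<close> in \<open>S\<close> and is differentiable at \<open>t\<close>.\<close>

primrec iter_deriv_exists :: "real set \<Rightarrow> nat \<Rightarrow> (real \<Rightarrow> real) \<Rightarrow> real \<Rightarrow> bool" where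
  "iter_deriv_exists S 0 f t \<longleftrightarrow> True"
| "iter_deriv_exists S (Suc n) f t \<longleftrightarrow>
     (\<forall>\<^sub>F s in nhds t. s \<in> S \<longrightarrow> iter_deriv_exists S n f s) \<and>
     iter_deriv S n f differentiable (at t within S)"

definition times_cont_differentiable_on :: "nat \<Rightarrow> real set \<Rightarrow> (real \<Rightarrow> real) \<Rightarrow> bool" where
  "times_cont_differentiable_on n S f \<longleftrightarrow>
     (\<forall>t\<in>S. iter_deriv_exists S n f t) \<and> continuous_on S (iter_deriv S n f)"

definition smooth_on_interval :: "real set \<Rightarrow> (real \<Rightarrow> real) \<Rightarrow> bool" where
  "smooth_on_interval S f \<longleftrightarrow> (\<forall>n. times_cont_differentiable_on n S f)"

definition increment :: "(real \<Rightarrow> real) \<Rightarrow> real \<Rightarrow> real \<Rightarrow> real" where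
  "increment F c d = F d - F c"


subsection \<open>Fractional operators\<close>

text \<open>For a non-integer order \<open>\<alpha> > 0\<close> this is the integer \<open>N\<close> with \<open>N - 1 < \<alpha> < N\<close>.\<close>

definition order_N :: "real \<Rightarrow> nat" where
  "order_N \<alpha> = nat \<lfloor>\<alpha>\<rfloor> + 1"

text \<open>The arguments \<open>S\<close> and \<open>c\<close> are the interval of the independent variable and the base point.\<close>

definition RL_left :: "real set \<Rightarrow> real \<Rightarrow> real \<Rightarrow> (real \<Rightarrow> real) \<Rightarrow> real \<Rightarrow> real" where
  "RL_left S c \<alpha> f t =
     1 / Gamma (real (order_N \<alpha>) - \<alpha>) *
     iter_deriv S (order_N \<alpha>)
       (\<lambda>r. integral {c..r} (\<lambda>s. (r - s) powr (real (order_N \<alpha>) - \<alpha> - 1) * f s)) t"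

definition RL_right :: "real set \<Rightarrow> real \<Rightarrow> real \<Rightarrow> (real \<Rightarrow> real) \<Rightarrow> real \<Rightarrow> real" where
  "RL_right S c \<alpha> f t =
     1 / Gamma (real (order_N \<alpha>) - \<alpha>) * ((- 1) ^ order_N \<alpha> *
     iter_deriv S (order_N \<alpha>)
       (\<lambda>r. integral {r..c} (\<lambda>s. (s - r) powr (real (order_N \<alpha>) - \<alpha> - 1) * f s)) t)"

definition RL_left_exists :: "real set \<Rightarrow> real \<Rightarrow> real \<Rightarrow> (real \<Rightarrow> real) \<Rightarrow> real \<Rightarrow> bool" where
  "RL_left_exists S c \<alpha> f t \<longleftrightarrow>
     iter_deriv_exists S (order_N \<alpha>)
       (\<lambda>r. integral {c..r} (\<lambda>s. (r - s) powr (real (order_N \<alpha>) - \<alpha> - 1) * f s)) t"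

definition RL_right_exists :: "real set \<Rightarrow> real \<Rightarrow> real \<Rightarrow> (real \<Rightarrow> real) \<Rightarrow> real \<Rightarrow> bool" where
  "RL_right_exists S c \<alpha> f t \<longleftrightarrow>
     iter_deriv_exists S (order_N \<alpha>)
       (\<lambda>r. integral {r..c} (\<lambda>s. (s - r) powr (real (order_N \<alpha>) - \<alpha> - 1) * f s)) t"

definition caputo_left :: "real set \<Rightarrow> real \<Rightarrow> real \<Rightarrow> (real \<Rightarrow> real) \<Rightarrow> real \<Rightarrow> real" where
  "caputo_left S c \<alpha> f t =
     1 / Gamma (real (order_N \<alpha>) - \<alpha>) *
     integral {c..t} (\<lambda>s. (t - s) powr (real (order_N \<alpha>) - \<alpha> - 1) * iter_deriv S (order_N \<alpha>) f s)"

definition caputo_right :: "real set \<Rightarrow> real \<Rightarrow> real \<Rightarrow> (real \<Rightarrow> real) \<Rightarrow> real \<Rightarrow> real" where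
  "caputo_right S c \<alpha> f t =
     1 / Gamma (real (order_N \<alpha>) - \<alpha>) *
     integral {t..c} (\<lambda>s. (s - t) powr (real (order_N \<alpha>) - \<alpha> - 1) *
                          ((- 1) ^ order_N \<alpha> * iter_deriv S (order_N \<alpha>) f s))"

text \<open>The ranges of the left and right Riemann-Liouville integrals of order \<open>\<alpha>\<close> on the Lebesgue space
  of integrable functions on \<open>[a, b]\<close>: the spaces in which \<open>f\<close> is recovered by
  fractional integration from its Riemann-Liouville derivative.\<close>

definition RL_integral_range_left :: "real \<Rightarrow> real \<Rightarrow> real \<Rightarrow> (real \<Rightarrow> real) set" where
  "RL_integral_range_left a b \<alpha> =
     {f. \<exists>g. g absolutely_integrable_on {a..b} \<and>
        (AE t in lborel. t \<in> {a..b} \<longrightarrow>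
           f t = 1 / Gamma \<alpha> * integral {a..t} (\<lambda>s. (t - s) powr (\<alpha> - 1) * g s))}"

definition RL_integral_range_right :: "real \<Rightarrow> real \<Rightarrow> real \<Rightarrow> (real \<Rightarrow> real) set" where
  "RL_integral_range_right a b \<alpha> =
     {f. \<exists>g. g absolutely_integrable_on {a..b} \<and>
        (AE t in lborel. t \<in> {a..b} \<longrightarrow>
           f t = 1 / Gamma \<alpha> * integral {t..b} (\<lambda>s. (s - t) powr (\<alpha> - 1) * g s))}"


subsection \<open>The Lagrangian\<close>

text \<open>The slots \<open>t\<close>, \<open>v\<^sub>i\<close>, \<open>w\<^sub>j\<close>, \<open>x\<^sub>p\<close>, \<open>h\<^sub>p\<close> of \<open>L\<close>. An argument list of \<open>L\<close> is an
  extensional function on the finite set of slots in use.\<close>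

datatype slot = SlotT | SlotV nat | SlotW nat | SlotX nat | SlotH nat

definition slots :: "nat \<Rightarrow> nat \<Rightarrow> nat \<Rightarrow> slot set" where
  "slots n m k = {SlotT} \<union> SlotV ` {1..n} \<union> SlotW ` {1..m} \<union> SlotX ` {0..k} \<union> SlotH ` {0..k}"

definition slot_range :: "real set \<Rightarrow> slot \<Rightarrow> real set" where
  "slot_range I \<sigma> = (if \<sigma> = SlotT then I else UNIV)"

definition lagrangian_domain :: "real set \<Rightarrow> slot set \<Rightarrow> (slot \<Rightarrow> real) set" where
  "lagrangian_domain I A = PiE A (slot_range I)"

definition partial :: "real set \<Rightarrow> slot \<Rightarrow> ((slot \<Rightarrow> real) \<Rightarrow> real) \<Rightarrow> (slot \<Rightarrow> real) \<Rightarrow> real" where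
  "partial I \<sigma> L z = vector_derivative (\<lambda>u. L (z(\<sigma> := u))) (at (z \<sigma>) within slot_range I \<sigma>)"

definition has_continuous_partials ::
  "real set \<Rightarrow> slot set \<Rightarrow> ((slot \<Rightarrow> real) \<Rightarrow> real) \<Rightarrow> bool" where
  "has_continuous_partials I A L \<longleftrightarrow>
     (\<forall>\<sigma>\<in>A.
        (\<forall>z\<in>lagrangian_domain I A.
           (\<lambda>u. L (z(\<sigma> := u))) differentiable (at (z \<sigma>) within slot_range I \<sigma>)) \<and>
        continuous_on (lagrangian_domain I A) (partial I \<sigma> L))"

definition has_continuous_first_second_partials ::
  "real set \<Rightarrow> slot set \<Rightarrow> ((slot \<Rightarrow> real) \<Rightarrow> real) \<Rightarrow> bool" where
  "has_continuous_first_second_partials I A L \<longleftrightarrow>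
     has_continuous_partials I A L \<and> (\<forall>\<sigma>\<in>A. has_continuous_partials I A (partial I \<sigma> L))"


subsection \<open>The functional and its domain\<close>

text \<open>The arguments of \<open>L\<close> at time \<open>t\<close> determined by \<open>y\<close>, a function on \<open>[a - \<tau>, b]\<close>.\<close>

definition arguments ::
  "real \<Rightarrow> real \<Rightarrow> real \<Rightarrow> nat \<Rightarrow> nat \<Rightarrow> nat \<Rightarrow> (nat \<Rightarrow> real) \<Rightarrow> (nat \<Rightarrow> real) \<Rightarrow>
   (real \<Rightarrow> real) \<Rightarrow> real \<Rightarrow> slot \<Rightarrow> real" where
  "arguments a b \<tau> n m k \<alpha> \<beta> y t =
     restrict
       (\<lambda>\<sigma>. case \<sigma> of
           SlotT \<Rightarrow> t
         | SlotV i \<Rightarrow> caputo_left {a - \<tau>..b} a (\<alpha> i) y t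
         | SlotW j \<Rightarrow> caputo_right {a - \<tau>..b} b (\<beta> j) y t
         | SlotX p \<Rightarrow> iter_deriv {a - \<tau>..b} p y t
         | SlotH p \<Rightarrow> iter_deriv {a - \<tau>..b} p y (t - \<tau>))
       (slots n m k)"

definition functional_J ::
  "real \<Rightarrow> real \<Rightarrow> real \<Rightarrow> nat \<Rightarrow> nat \<Rightarrow> nat \<Rightarrow> (nat \<Rightarrow> real) \<Rightarrow> (nat \<Rightarrow> real) \<Rightarrow>
   ((slot \<Rightarrow> real) \<Rightarrow> real) \<Rightarrow> (real \<Rightarrow> real) \<Rightarrow> real" where
  "functional_J a b \<tau> n m k \<alpha> \<beta> L y =
     integral {a..b} (\<lambda>t. L (arguments a b \<tau> n m k \<alpha> \<beta> y t))"

text \<open>The derivatives of \<open>y\<close> up to order \<open>k\<close> on all of \<open>[a - \<tau>, b]\<close> enter the functional, hence the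
  first condition.\<close>

definition domain_J ::
  "real \<Rightarrow> real \<Rightarrow> real \<Rightarrow> nat \<Rightarrow> nat \<Rightarrow> nat \<Rightarrow> (nat \<Rightarrow> real) \<Rightarrow> (nat \<Rightarrow> real) \<Rightarrow>
   (nat \<Rightarrow> real) \<Rightarrow> (real \<Rightarrow> real) \<Rightarrow> (real \<Rightarrow> real) set" where
  "domain_J a b \<tau> n m k \<alpha> \<beta> c \<phi> =
     {y. times_cont_differentiable_on k {a - \<tau>..b} y \<and>
         (\<forall>i\<in>{1..n}. continuous_on {a..b} (caputo_left {a - \<tau>..b} a (\<alpha> i) y)) \<and>
         (\<forall>j\<in>{1..m}. continuous_on {a..b} (caputo_right {a - \<tau>..b} b (\<beta> j) y)) \<and>
         (\<forall>l<k. iter_deriv {a - \<tau>..b} l y b = c l) \<and>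
         (\<forall>t\<in>{a - \<tau>..a}. y t = \<phi> t)}"

end

theory Submission
  imports Defs "HOL-Computational_Algebra.Polynomial"
begin

text \<open>Let \<open>\<eta>\<close> be an admissible variation. Since \<open>J (y + \<epsilon> \<eta>)\<close> is minimal at \<open>\<epsilon> = 0\<close>, its derivative there
vanishes: the integral of the partial derivatives of \<open>L\<close> along \<open>y\<close>, multiplied by the corresponding
Caputo derivatives, derivatives and delayed derivatives of \<open>\<eta>\<close>, is zero (\<open>first_variation_eq_0\<close>).

The hypothesis on the ranges says that \<open>\<partial>L/\<partial>v\<^sub>i\<close> is a right fractional integral of an integrable
function \<open>gV i\<close>, and \<open>\<partial>L/\<partial>w\<^sub>j\<close> a left fractional integral of some \<open>gW j\<close>. Left and right fractional
integrals are adjoint, and integrating a Caputo derivative of \<open>\<eta>\<close> fractionally gives back \<open>\<eta>\<close>. Hence the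
nonlocal terms of the first variation are just the integrals of \<open>gV i * \<eta>\<close> and \<open>gW j * \<eta>\<close>
(\<open>fractional_integration_by_parts\<close>). After the delayed terms have been shifted by \<open>\<tau>\<close>, what is left
is a classical weak equation on \<open>[a, b]\<close> (\<open>weak_form\<close>), whose coefficients can only jump at \<open>b - \<tau>\<close>.

On each of the two pieces the weak equation is solved by the argument of du Bois-Reymond
(\<open>euler_poisson\<close>). Write it as \<open>\<integral> F \<eta> + \<Sum>p<k. R (p + 1) \<eta>^(p + 1) = 0\<close>. For a suitable
antiderivative \<open>\<Phi>\<close> of \<open>F\<close>, integration by parts gives an equation of the same kind, of order one
less, for \<open>\<eta>'\<close>, with \<open>R 1 - \<Phi>\<close> in the place of \<open>F\<close>. Iterating this \<open>k\<close> times gives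
\<open>\<Phi> = \<Sum>p<k. (-1)^p R (p + 1)^(p)\<close> at every point of the closed piece, and expresses the left-hand side
for an arbitrary function \<open>\<eta>\<close> of class \<open>C^k\<close> as a sum of boundary terms. These boundary terms
add up to zero over the two pieces, which is the transversality condition.

The Euler-Lagrange equations at a point \<open>t\<close> come from differentiating the formula for \<open>\<Phi>\<close> at \<open>t\<close>. By
the semigroup law, the fractional integral of order \<open>N - \<alpha>\<close> of the one of order \<open>\<alpha>\<close> of \<open>g\<close> is the
\<open>N\<close>-fold integral of \<open>g\<close>. So the Riemann-Liouville derivative of a fractional integral of \<open>g\<close> exists
exactly where the indefinite integral of \<open>g\<close> is differentiable, and is the derivative of the latter
(\<open>RL_left_imp_integral_derivative\<close>). The correction terms appear because on one piece
the base point of the derivative moves to \<open>b - \<tau>\<close>: they remove the contribution of \<open>g\<close> on the other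
piece (\<open>RL_left_shifted_imp_integral_derivative\<close>). As they are written with the Riemann-Liouville derivative
on \<open>[a, b]\<close> in the place of \<open>g\<close>, one needs that the two agree almost everywhere, which is Lebesgue's
differentiation theorem (\<open>lebesgue_differentiation_real\<close>, from Vitali's covering theorem). Right-sided
operators are always reduced to left-sided ones by the reflection of the real line.\<close>

section \<open>Iterated derivatives on an interval\<close>

text \<open>A function of class \<open>C^k\<close> is handled as the sequence of its derivatives. This makes restriction to
a smaller interval, extension by zero and passing to the derivative (a shift of the sequence)
immediate; entries beyond index \<open>k\<close> are arbitrary.\<close>

definition jet_on :: "nat \<Rightarrow> real set \<Rightarrow> (nat \<Rightarrow> real \<Rightarrow> real) \<Rightarrow> bool" where
  "jet_on k S e \<longleftrightarrow> (\<forall>p<k. \<forall>t\<in>S. (e p has_vector_derivative e (Suc p) t) (at t within S)) \<and>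
     continuous_on S (e k)"

text \<open>Also at points where derivatives fail to exist: the derivative relative to \<open>S\<close> is defined from
the same predicate for both functions, and that predicate only looks at values in \<open>S\<close>.\<close>

lemma iter_deriv_cong:
  assumes "\<And>x. x \<in> S \<Longrightarrow> f x = g x" "t \<in> S"
  shows "iter_deriv S n f t = iter_deriv S n g t"
  using assms(2)
proof (induction n arbitrary: t)
  case 0
  then show ?case using assms(1) by simp
next
  case (Suc n)
  have "(iter_deriv S n f has_vector_derivative D) (at t within S) \<longleftrightarrow>
        (iter_deriv S n g has_vector_derivative D) (at t within S)" for D
    using has_vector_derivative_transform[OF Suc.prems, of "iter_deriv S n f" "iter_deriv S n g" D]
      has_vector_derivative_transform[OF Suc.prems, of "iter_deriv S n g" "iter_deriv S n f" D] Suc.IH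
    by auto
  then show ?case by (simp add: vector_derivative_def)
qed

lemma iter_deriv_exists_cong:
  assumes "\<And>x. x \<in> S \<Longrightarrow> f x = g x" "t \<in> S"
  shows "iter_deriv_exists S n f t \<longleftrightarrow> iter_deriv_exists S n g t"
  using assms(2)
proof (induction n arbitrary: t)
  case (Suc n)
  have "iter_deriv S n f differentiable at t within S \<longleftrightarrow> iter_deriv S n g differentiable at t within S"
    using has_derivative_transform[OF Suc.prems, of "iter_deriv S n f" "iter_deriv S n g"]
      has_derivative_transform[OF Suc.prems, of "iter_deriv S n g" "iter_deriv S n f"]
      iter_deriv_cong[of S f g, OF assms(1)]
    unfolding differentiable_def by metis
  moreover have "(\<lambda>s. s \<in> S \<longrightarrow> iter_deriv_exists S n f s) = (\<lambda>s. s \<in> S \<longrightarrow> iter_deriv_exists S n g s)"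
    using Suc.IH by auto
  ultimately show ?case by simp
qed simp

lemma iter_deriv_exists_antimono:
  assumes "iter_deriv_exists S n f t" "t \<in> S" "m \<le> n"
  shows "iter_deriv_exists S m f t"
  using assms(3)
proof (induction rule: inc_induct)
  case (step n)
  then show ?case using assms(2) by (auto dest: eventually_nhds_x_imp_x)
qed (use assms in auto)

lemma iter_deriv_has_vector_derivative:
  assumes "iter_deriv_exists S n f t" "t \<in> S" "q < n"
  shows "(iter_deriv S q f has_vector_derivative iter_deriv S (Suc q) f t) (at t within S)"
proof -
  have "iter_deriv_exists S (Suc q) f t"
    using iter_deriv_exists_antimono[OF assms(1,2), of "Suc q"] assms(3) by (simp only: Suc_le_eq)
  then show ?thesis by (simp add: vector_derivative_works)
qed

lemma jet_on_iter_deriv: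
  assumes "times_cont_differentiable_on k S f"
  shows "jet_on k S (\<lambda>p. iter_deriv S p f)"
  using assms iter_deriv_has_vector_derivative
  unfolding jet_on_def times_cont_differentiable_on_def by blast

text \<open>An interval has no isolated points, so a derivative relative to it is unique and
a given chain of derivatives must be the chain of iterated derivatives.\<close>

lemma iter_deriv_of_derivs:
  assumes "c < d" and "\<And>p t. p < k \<Longrightarrow> t \<in> {c..d} \<Longrightarrow> (e p has_vector_derivative e (Suc p) t) (at t within {c..d})"
    and "\<And>t. t \<in> {c..d} \<Longrightarrow> f t = e 0 t" and "p \<le> k" "t \<in> {c..d}"
  shows "iter_deriv {c..d} p f t = e p t \<and> iter_deriv_exists {c..d} p f t"
  using assms(4,5)
proof (induction p arbitrary: t)
  case 0
  then show ?case using assms by simp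
next
  case (Suc p)
  have "(iter_deriv {c..d} p f has_vector_derivative e (Suc p) t) (at t within {c..d})"
    using Suc assms(2)[of p t] by (auto intro: has_vector_derivative_transform)
  moreover from this have "vector_derivative (iter_deriv {c..d} p f) (at t within {c..d}) = e (Suc p) t"
    by (rule vector_derivative_within_closed_interval[OF assms(1) Suc.prems(2)])
  moreover have "iter_deriv_exists {c..d} p f s" if "s \<in> {c..d}" for s
    using Suc that by auto
  ultimately show ?case by (auto simp: differentiableI_vector)
qed

lemma iter_deriv_jet:
  assumes "c < d" "jet_on k {c..d} e" "\<And>t. t \<in> {c..d} \<Longrightarrow> f t = e 0 t" "p \<le> k" "t \<in> {c..d}"
  shows "iter_deriv {c..d} p f t = e p t" "iter_deriv_exists {c..d} p f t"
  using iter_deriv_of_derivs[of c d k e f p t] assms by (auto simp: jet_on_def)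

lemma jet_on_times_cont_differentiable:
  assumes "c < d" "jet_on k {c..d} e" "\<And>t. t \<in> {c..d} \<Longrightarrow> f t = e 0 t"
  shows "times_cont_differentiable_on k {c..d} f"
proof -
  have "continuous_on {c..d} (iter_deriv {c..d} k f)"
    using assms(2) iter_deriv_jet(1)[OF assms, of k] unfolding jet_on_def
    by (subst continuous_on_cong[OF refl, of _ _ "e k"]) auto
  then show ?thesis using iter_deriv_jet(2)[OF assms, of k]
    by (auto simp: times_cont_differentiable_on_def)
qed

text \<open>The derivatives need only exist at the single point \<open>t\<close>, since then all derivatives of lower order
exist at the nearby points of the interval. This pointwise form is what the hypotheses of the
Euler-Lagrange equations supply.\<close>

lemma iter_deriv_linear:
  assumes "c < d" "iter_deriv_exists {c..d} n f t" "iter_deriv_exists {c..d} n g t" "t \<in> {c..d}"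
  shows "iter_deriv_exists {c..d} n (\<lambda>x. u * f x + v * g x) t \<and>
    iter_deriv {c..d} n (\<lambda>x. u * f x + v * g x) t = u * iter_deriv {c..d} n f t + v * iter_deriv {c..d} n g t"
  using assms(2-)
proof (induction n arbitrary: t)
  case (Suc n)
  let ?S = "{c..d}" and ?h = "\<lambda>x. u * f x + v * g x"
  (* Existence of order n + 1 at t includes existence of order n nearby, where the induction hypothesis applies. *)
  have ev: "\<forall>\<^sub>F s in nhds t. s \<in> ?S \<longrightarrow> iter_deriv_exists ?S n ?h s \<and>
     iter_deriv ?S n ?h s = u * iter_deriv ?S n f s + v * iter_deriv ?S n g s"
  proof -
    have "\<forall>\<^sub>F s in nhds t. s \<in> ?S \<longrightarrow> iter_deriv_exists ?S n f s"
         "\<forall>\<^sub>F s in nhds t. s \<in> ?S \<longrightarrow> iter_deriv_exists ?S n g s"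
      using Suc.prems(1,2) by simp_all
    then show ?thesis by eventually_elim (use Suc.IH in blast)
  qed
  have "(iter_deriv ?S n f has_vector_derivative iter_deriv ?S (Suc n) f t) (at t within ?S)"
       "(iter_deriv ?S n g has_vector_derivative iter_deriv ?S (Suc n) g t) (at t within ?S)"
    using Suc.prems by (auto intro!: iter_deriv_has_vector_derivative simp del: iter_deriv.simps iter_deriv_exists.simps)
  then have "((\<lambda>s. u * iter_deriv ?S n f s + v * iter_deriv ?S n g s) has_vector_derivative
     u * iter_deriv ?S (Suc n) f t + v * iter_deriv ?S (Suc n) g t) (at t within ?S)"
    by (intro has_vector_derivative_add has_vector_derivative_mult_right)
  moreover have "\<forall>\<^sub>F s in at t within ?S. u * iter_deriv ?S n f s + v * iter_deriv ?S n g s = iter_deriv ?S n ?h s"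
    using ev by (auto simp: eventually_at_filter elim: eventually_mono)
  moreover have "u * iter_deriv ?S n f t + v * iter_deriv ?S n g t = iter_deriv ?S n ?h t"
    using eventually_nhds_x_imp_x[OF ev] Suc.prems by auto
  ultimately have "(iter_deriv ?S n ?h has_vector_derivative
     u * iter_deriv ?S (Suc n) f t + v * iter_deriv ?S (Suc n) g t) (at t within ?S)"
    unfolding has_vector_derivative_def using Suc.prems
    by (auto intro: has_derivative_transform_eventually)
  moreover from this have "iter_deriv ?S (Suc n) ?h t = u * iter_deriv ?S (Suc n) f t + v * iter_deriv ?S (Suc n) g t"
    using vector_derivative_within_closed_interval[OF assms(1) Suc.prems(3)] by simp
  ultimately show ?case using ev by (auto simp: differentiableI_vector elim: eventually_mono)
qed simp

text \<open>Reflection turns right-sided fractional derivatives into left-sided ones; this is the integer order part.\<close>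

lemma iter_deriv_reflect:
  assumes "c < d" "iter_deriv_exists {c..d} n f t" "t \<in> {c..d}"
  shows "iter_deriv_exists {-d..-c} n (\<lambda>x. f (- x)) (- t) \<and>
    iter_deriv {-d..-c} n (\<lambda>x. f (- x)) (- t) = (- 1) ^ n * iter_deriv {c..d} n f t"
  using assms(2,3)
proof (induction n arbitrary: t)
  case (Suc n)
  let ?S = "{c..d}" and ?R = "{-d..-c}" and ?h = "\<lambda>x. f (- x)"
  have "\<forall>\<^sub>F s in nhds t. s \<in> ?S \<longrightarrow> iter_deriv_exists ?S n f s" using Suc.prems by simp
  then have "\<forall>\<^sub>F s in nhds (- (- t)). s \<in> ?S \<longrightarrow> iter_deriv_exists ?S n f s" by simp
  moreover have "filterlim uminus (nhds (- (- t))) (nhds (- t))"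
    by (rule filterlim_compose[OF tendsto_uminus_nhds filterlim_ident])
  ultimately have "\<forall>\<^sub>F s in nhds (- t). - s \<in> ?S \<longrightarrow> iter_deriv_exists ?S n f (- s)"
    by (rule eventually_compose_filterlim)
  then have ev: "\<forall>\<^sub>F s in nhds (- t). s \<in> ?R \<longrightarrow> iter_deriv_exists ?R n ?h s \<and>
     iter_deriv ?R n ?h s = (- 1) ^ n * iter_deriv ?S n f (- s)"
  proof (rule eventually_mono)
    fix s assume "- s \<in> ?S \<longrightarrow> iter_deriv_exists ?S n f (- s)"
    then show "s \<in> ?R \<longrightarrow> iter_deriv_exists ?R n ?h s \<and> iter_deriv ?R n ?h s = (- 1) ^ n * iter_deriv ?S n f (- s)"
      using Suc.IH[of "- s"] by auto
  qed
  have "(iter_deriv ?S n f has_vector_derivative iter_deriv ?S (Suc n) f t) (at t within ?S)"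
    using Suc.prems by (intro iter_deriv_has_vector_derivative) auto
  moreover have "uminus ` ?R = ?S" by (simp add: image_uminus_atLeastAtMost)
  ultimately have "(iter_deriv ?S n f has_vector_derivative iter_deriv ?S (Suc n) f t) (at (- (- t)) within uminus ` ?R)"
    by simp
  moreover have "(uminus has_vector_derivative (- 1 :: real)) (at (- t) within ?R)"
    by (auto intro!: derivative_eq_intros)
  ultimately have "(iter_deriv ?S n f \<circ> uminus has_vector_derivative (- 1) *\<^sub>R iter_deriv ?S (Suc n) f t) (at (- t) within ?R)"
    by (intro vector_diff_chain_within)
  then have "((\<lambda>s. iter_deriv ?S n f (- s)) has_vector_derivative - iter_deriv ?S (Suc n) f t) (at (- t) within ?R)"
    by (simp add: o_def)
  then have "((\<lambda>s. (- 1) ^ n * iter_deriv ?S n f (- s)) has_vector_derivative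
     (- 1) ^ n * (- iter_deriv ?S (Suc n) f t)) (at (- t) within ?R)"
    by (intro has_vector_derivative_mult_right)
  moreover have "\<forall>\<^sub>F s in at (- t) within ?R. (- 1) ^ n * iter_deriv ?S n f (- s) = iter_deriv ?R n ?h s"
    using ev by (auto simp: eventually_at_filter elim: eventually_mono)
  moreover have "(- 1) ^ n * iter_deriv ?S n f (- (- t)) = iter_deriv ?R n ?h (- t)"
    using eventually_nhds_x_imp_x[OF ev] Suc.prems by auto
  ultimately have D: "(iter_deriv ?R n ?h has_vector_derivative
     (- 1) ^ n * (- iter_deriv ?S (Suc n) f t)) (at (- t) within ?R)"
    unfolding has_vector_derivative_def using Suc.prems
    by (auto intro: has_derivative_transform_eventually)
  moreover have "iter_deriv ?R (Suc n) ?h (- t) = (- 1) ^ n * (- iter_deriv ?S (Suc n) f t)"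
    using vector_derivative_within_closed_interval[OF _ _ D] assms(1) Suc.prems by simp
  ultimately show ?case using ev by (auto simp: differentiableI_vector elim: eventually_mono)
qed simp

section \<open>Fractional integrals as convolutions\<close>

text \<open>Convolution with this kernel is the left Riemann-Liouville integral of order \<open>\<alpha>\<close>. Extending the kernel by
zero to the negative half line turns all integrals into integrals over the whole line, to which Fubini's
theorem applies without care for the region of integration.\<close>

definition rl_kernel :: "real \<Rightarrow> real \<Rightarrow> real" where
  "rl_kernel \<alpha> x = (if 0 < x then x powr (\<alpha> - 1) / Gamma \<alpha> else 0)"

text \<open>For a function that vanishes to the left of \<open>a\<close> this is the fractional integral with base point
\<open>a\<close>. At points where the integrand is not integrable the value is the default \<open>0\<close>, so that for orders
less than one identities between such integrals hold almost everywhere only.\<close>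

definition rl_int :: "real \<Rightarrow> (real \<Rightarrow> real) \<Rightarrow> real \<Rightarrow> real" where
  "rl_int \<alpha> g t = (LBINT s. rl_kernel \<alpha> (t - s) * g s)"

definition rl_int_right :: "real \<Rightarrow> (real \<Rightarrow> real) \<Rightarrow> real \<Rightarrow> real" where
  "rl_int_right \<alpha> g t = (LBINT s. rl_kernel \<alpha> (s - t) * g s)"

lemma rl_kernel_measurable [measurable]: "rl_kernel \<alpha> \<in> borel_measurable borel"
  unfolding rl_kernel_def by measurable

lemma rl_int_measurable [measurable]:
  assumes [measurable]: "g \<in> borel_measurable borel"
  shows "rl_int \<alpha> g \<in> borel_measurable borel"
  unfolding rl_int_def by measurable

lemma rl_int_right_measurable [measurable]:
  assumes [measurable]: "g \<in> borel_measurable borel"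
  shows "rl_int_right \<alpha> g \<in> borel_measurable borel"
  unfolding rl_int_right_def by measurable

lemma rl_kernel_nonneg: "0 < \<alpha> \<Longrightarrow> 0 \<le> rl_kernel \<alpha> x"
  by (simp add: rl_kernel_def Gamma_real_pos less_imp_le)

lemma rl_int_right_reflect: "rl_int_right \<alpha> g t = rl_int \<alpha> (\<lambda>s. g (- s)) (- t)"
proof -
  have "(LBINT s. rl_kernel \<alpha> (s - t) * g s) = (LBINT s. rl_kernel \<alpha> (0 + (-1) * s - t) * g (0 + (-1) * s))"
    using lborel_integral_real_affine[of "-1" "\<lambda>s. rl_kernel \<alpha> (s - t) * g s" 0] by simp
  moreover have "0 + (-1) * s - t = - t - s" for s by simp
  ultimately show ?thesis unfolding rl_int_def rl_int_right_def by (simp only:) simp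
qed

lemma has_bochner_integral_of_has_integral_nonneg:
  fixes f :: "real \<Rightarrow> real"
  assumes "f \<in> borel_measurable borel" and "\<And>x. 0 \<le> f x" and "(f has_integral I) UNIV"
  shows "has_bochner_integral lborel f I"
proof -
  have "integral\<^sup>N lborel f = I" by (rule nn_integral_has_integral_lborel) fact+
  moreover have "0 \<le> I" using assms has_integral_nonneg by blast
  ultimately show ?thesis using assms by (intro has_bochner_integral_nn_integral) auto
qed

lemma has_bochner_integral_rl_kernel:
  assumes "0 < \<alpha>" "a \<le> s"
  shows "has_bochner_integral lborel (\<lambda>t. indicator {a..} t * rl_kernel \<alpha> (s - t))
    ((s - a) powr \<alpha> / Gamma (\<alpha> + 1))"
proof -
  have G: "Gamma (\<alpha> + 1) = \<alpha> * Gamma \<alpha>"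
    using assms by (intro Gamma_plus1) (auto simp: nonpos_Ints_def)
  have "((\<lambda>x. x powr (\<alpha> - 1)) has_integral (s - a) powr \<alpha> / \<alpha>) {0..s - a}"
    using has_integral_powr_from_0[of "\<alpha> - 1" "s - a"] assms by simp
  then have "((\<lambda>x. x powr (\<alpha> - 1) / Gamma \<alpha>) has_integral (s - a) powr \<alpha> / \<alpha> / Gamma \<alpha>) {0..s - a}"
    by (rule has_integral_divide)
  then have "((\<lambda>x. if x \<in> {0..s - a} then x powr (\<alpha> - 1) / Gamma \<alpha> else 0) has_integral
     (s - a) powr \<alpha> / \<alpha> / Gamma \<alpha>) UNIV"
    by (simp only: has_integral_restrict_UNIV)
  also have "(\<lambda>x. if x \<in> {0..s - a} then x powr (\<alpha> - 1) / Gamma \<alpha> else 0) =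
     (\<lambda>x. indicator {..s - a} x * rl_kernel \<alpha> x)"
    by (auto simp: fun_eq_iff rl_kernel_def indicator_def)
  finally have "has_bochner_integral lborel (\<lambda>x. indicator {..s - a} x * rl_kernel \<alpha> x)
     ((s - a) powr \<alpha> / \<alpha> / Gamma \<alpha>)"
    by (intro has_bochner_integral_of_has_integral_nonneg) (auto simp: rl_kernel_nonneg assms)
  from lborel_has_bochner_integral_real_affine_iff[of "-1" _ _ s, THEN iffD1, OF _ this]
  have "has_bochner_integral lborel (\<lambda>x. indicator {..s - a} (s - x) * rl_kernel \<alpha> (s - x))
     ((s - a) powr \<alpha> / \<alpha> / Gamma \<alpha>)" by simp
  moreover have "(\<lambda>x. indicator {..s - a} (s - x) * rl_kernel \<alpha> (s - x)) = (\<lambda>t. indicator {a..} t * rl_kernel \<alpha> (s - t))"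
    by (auto simp: fun_eq_iff indicator_def)
  ultimately show ?thesis using G by (simp add: field_simps)
qed

text \<open>Up to the affine substitution \<open>s = u + (t - u) x\<close> this is Euler's beta integral.\<close>

lemma has_bochner_integral_rl_kernel_convolution:
  assumes "0 < \<alpha>" "0 < \<beta>"
  shows "has_bochner_integral lborel (\<lambda>s. rl_kernel \<alpha> (t - s) * rl_kernel \<beta> (s - u)) (rl_kernel (\<alpha> + \<beta>) (t - u))"
proof (cases "u < t")
  case False
  then have "(\<lambda>s. rl_kernel \<alpha> (t - s) * rl_kernel \<beta> (s - u)) = (\<lambda>s. 0)" "rl_kernel (\<alpha> + \<beta>) (t - u) = 0"
    by (auto simp: rl_kernel_def fun_eq_iff)
  then show ?thesis by (simp only: has_bochner_integral_zero)
next
  case True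
  define d where "d = t - u"
  have d: "0 < d" using True by (simp add: d_def)
  define q where "q = d powr (\<alpha> + \<beta> - 2) / (Gamma \<alpha> * Gamma \<beta>)"
  have "((\<lambda>x. x powr (\<beta> - 1) * (1 - x) powr (\<alpha> - 1)) has_integral Beta \<beta> \<alpha>) {0..1}"
    using has_integral_Beta_real[of \<beta> \<alpha>] assms by simp
  then have "((\<lambda>x. q * (x powr (\<beta> - 1) * (1 - x) powr (\<alpha> - 1))) has_integral q * Beta \<beta> \<alpha>) {0..1}"
    by (rule has_integral_mult_right)
  then have "((\<lambda>x. if x \<in> {0..1} then q * (x powr (\<beta> - 1) * (1 - x) powr (\<alpha> - 1)) else 0) has_integral q * Beta \<beta> \<alpha>) UNIV"
    by (simp only: has_integral_restrict_UNIV)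
  also have "(\<lambda>x. if x \<in> {0..1} then q * (x powr (\<beta> - 1) * (1 - x) powr (\<alpha> - 1)) else 0) =
     (\<lambda>x. rl_kernel \<alpha> (t - (u + d * x)) * rl_kernel \<beta> (u + d * x - u))"
  proof
    fix x :: real
    have e: "t - (u + d * x) = d * (1 - x)" "u + d * x - u = d * x" by (simp_all add: d_def algebra_simps)
    show "(if x \<in> {0..1} then q * (x powr (\<beta> - 1) * (1 - x) powr (\<alpha> - 1)) else 0) =
      rl_kernel \<alpha> (t - (u + d * x)) * rl_kernel \<beta> (u + d * x - u)"
    proof (cases "0 < x \<and> x < 1")
      case True
      have p: "d powr (\<alpha> + \<beta> - 2) = d powr (\<alpha> - 1) * d powr (\<beta> - 1)"
        by (simp add: powr_add[symmetric])
      have "rl_kernel \<alpha> (d * (1 - x)) * rl_kernel \<beta> (d * x) =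
         (d powr (\<alpha> - 1) * (1 - x) powr (\<alpha> - 1) / Gamma \<alpha>) * (d powr (\<beta> - 1) * x powr (\<beta> - 1) / Gamma \<beta>)"
        using True d by (simp add: rl_kernel_def powr_mult)
      also have "\<dots> = q * (x powr (\<beta> - 1) * (1 - x) powr (\<alpha> - 1))"
        unfolding q_def p by (simp add: field_simps)
      finally show ?thesis using True unfolding e by simp
    next
      case False
      then show ?thesis using d unfolding e
        by (auto simp: rl_kernel_def zero_less_mult_iff)
    qed
  qed
  finally have "((\<lambda>x. rl_kernel \<alpha> (t - (u + d * x)) * rl_kernel \<beta> (u + d * x - u)) has_integral q * Beta \<beta> \<alpha>) UNIV" .
  then have "has_bochner_integral lborel (\<lambda>x. rl_kernel \<alpha> (t - (u + d * x)) * rl_kernel \<beta> (u + d * x - u)) (q * Beta \<beta> \<alpha>)"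
    by (intro has_bochner_integral_of_has_integral_nonneg) (auto simp: rl_kernel_nonneg assms)
  moreover have "q * Beta \<beta> \<alpha> = rl_kernel (\<alpha> + \<beta>) (t - u) /\<^sub>R \<bar>d\<bar>"
  proof -
    have "d powr (\<alpha> + \<beta> - 1) = d powr (\<alpha> + \<beta> - 2) * d"
      using d powr_add[of d "\<alpha> + \<beta> - 2" 1] by simp
    moreover have "Gamma \<alpha> > 0" "Gamma \<beta> > 0" using assms by auto
    moreover have "Beta \<beta> \<alpha> = Gamma \<beta> * Gamma \<alpha> / Gamma (\<alpha> + \<beta>)"
      by (simp add: Beta_def add.commute)
    ultimately show ?thesis using True d
      by (simp add: rl_kernel_def q_def d_def[symmetric] field_simps)
  qed
  ultimately have "has_bochner_integral lborel (\<lambda>x. rl_kernel \<alpha> (t - (u + d * x)) * rl_kernel \<beta> (u + d * x - u))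
     (rl_kernel (\<alpha> + \<beta>) (t - u) /\<^sub>R \<bar>d\<bar>)" by simp
  from lborel_has_bochner_integral_real_affine_iff[of d "\<lambda>s. rl_kernel \<alpha> (t - s) * rl_kernel \<beta> (s - u)" _ u, THEN iffD2, OF _ this]
  show ?thesis using d by simp
qed

text \<open>For orders at least one the kernel is bounded on bounded sets, so that there is no exceptional set.\<close>

lemma integrable_rl_kernel_mult:
  assumes "1 \<le> \<gamma>" "integrable lborel g" "\<forall>s<a. g s = 0"
  shows "integrable lborel (\<lambda>u. rl_kernel \<gamma> (t - u) * g u)"
proof (rule Bochner_Integration.integrable_bound)
  show "integrable lborel (\<lambda>u. rl_kernel \<gamma> (t - a) * g u)" using assms by simp
  show "(\<lambda>u. rl_kernel \<gamma> (t - u) * g u) \<in> borel_measurable lborel"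
    using assms(2)[THEN borel_measurable_integrable] by simp
  have "norm (rl_kernel \<gamma> (t - u) * g u) \<le> norm (rl_kernel \<gamma> (t - a) * g u)" for u
  proof (cases "a \<le> u \<and> u < t")
    case True
    then have "rl_kernel \<gamma> (t - u) \<le> rl_kernel \<gamma> (t - a)"
      using assms(1) by (auto simp: rl_kernel_def intro!: divide_right_mono powr_mono2)
    then show ?thesis using rl_kernel_nonneg[of \<gamma>] assms(1) by (simp add: abs_mult mult_right_mono)
  next
    case False
    then show ?thesis using assms(3) by (cases "u < a") (auto simp: rl_kernel_def)
  qed
  then show "AE u in lborel. norm (rl_kernel \<gamma> (t - u) * g u) \<le> norm (rl_kernel \<gamma> (t - a) * g u)" by simp
qed

text \<open>Fubini's theorem and the convolution formula for the kernels. The condition \<open>1 \<le> \<alpha> + \<beta>\<close> is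
what makes the identity hold at every point \<open>t\<close>: the kernel of the sum of the orders is then
locally bounded. The third part says that the inner integral converges at almost every point.\<close>

lemma rl_int_semigroup:
  assumes "0 < \<alpha>" "0 < \<beta>" "1 \<le> \<alpha> + \<beta>" and g: "integrable lborel g" "\<forall>s<a. g s = 0"
  shows "integrable lborel (\<lambda>s. rl_kernel \<alpha> (t - s) * rl_int \<beta> g s)"
    and "rl_int \<alpha> (rl_int \<beta> g) t = rl_int (\<alpha> + \<beta>) g t"
    and "AE s in lborel. integrable lborel (\<lambda>u. rl_kernel \<alpha> (t - s) * rl_kernel \<beta> (s - u) * g u)"
proof -
  have [measurable]: "g \<in> borel_measurable borel" using g(1) by auto
  define F where "F = (\<lambda>u s. rl_kernel \<alpha> (t - s) * rl_kernel \<beta> (s - u) * g u)"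
  have conv: "has_bochner_integral lborel (F u) (rl_kernel (\<alpha> + \<beta>) (t - u) * g u)" for u
    unfolding F_def using has_bochner_integral_rl_kernel_convolution[OF assms(1,2)]
    by (intro has_bochner_integral_mult_left) auto
  have "has_bochner_integral lborel (\<lambda>s. norm (F u s)) (rl_kernel (\<alpha> + \<beta>) (t - u) * \<bar>g u\<bar>)" for u
  proof -
    have "(\<lambda>s. norm (F u s)) = (\<lambda>s. rl_kernel \<alpha> (t - s) * rl_kernel \<beta> (s - u) * \<bar>g u\<bar>)"
      using rl_kernel_nonneg[OF assms(1)] rl_kernel_nonneg[OF assms(2)]
      by (simp add: F_def abs_mult fun_eq_iff)
    then show ?thesis using has_bochner_integral_rl_kernel_convolution[OF assms(1,2), of t u]
      by (auto intro: has_bochner_integral_mult_left)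
  qed
  then have n: "(LBINT s. norm (F u s)) = rl_kernel (\<alpha> + \<beta>) (t - u) * \<bar>g u\<bar>" for u
    by (simp add: has_bochner_integral_integral_eq)
  have int: "integrable (lborel \<Otimes>\<^sub>M lborel) (\<lambda>(u, s). F u s)"
  proof (rule lborel_pair.Fubini_integrable)
    show "(\<lambda>(u, s). F u s) \<in> borel_measurable (lborel \<Otimes>\<^sub>M lborel)" unfolding F_def by measurable
    show "integrable lborel (\<lambda>u. LBINT s. norm (case (u, s) of (u, s) \<Rightarrow> F u s))"
      using integrable_rl_kernel_mult[of "\<alpha> + \<beta>" "\<lambda>u. \<bar>g u\<bar>" a t] assms
      unfolding prod.case n by simp
    show "AE u in lborel. integrable lborel (\<lambda>s. case (u, s) of (u, s) \<Rightarrow> F u s)"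
      using conv by (auto simp: has_bochner_integral_iff)
  qed
  have inner: "(LBINT u. F u s) = rl_kernel \<alpha> (t - s) * rl_int \<beta> g s" for s
    unfolding F_def rl_int_def mult.assoc by simp
  from lborel_pair.AE_integrable_snd[OF int]
  show "AE s in lborel. integrable lborel (\<lambda>u. rl_kernel \<alpha> (t - s) * rl_kernel \<beta> (s - u) * g u)"
    by (simp add: F_def)
  from lborel_pair.integrable_snd[OF int]
  show "integrable lborel (\<lambda>s. rl_kernel \<alpha> (t - s) * rl_int \<beta> g s)" by (simp add: inner)
  have "(LBINT s. LBINT u. F u s) = (LBINT u. LBINT s. F u s)"
    by (rule lborel_pair.Fubini_integral[OF int])
  then show "rl_int \<alpha> (rl_int \<beta> g) t = rl_int (\<alpha> + \<beta>) g t"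
    unfolding inner using conv by (simp add: has_bochner_integral_iff rl_int_def[of \<alpha>] rl_int_def[of "\<alpha> + \<beta>"])
qed

lemma integrable_rl_kernel_bounded:
  assumes "0 < \<alpha>" and [measurable]: "\<phi> \<in> borel_measurable borel"
    and "\<And>t. \<bar>\<phi> t\<bar> \<le> C" "\<forall>t<a. \<phi> t = 0"
  shows "integrable lborel (\<lambda>t. rl_kernel \<alpha> (s - t) * \<phi> t)"
    and "a \<le> s \<Longrightarrow> (LBINT t. \<bar>rl_kernel \<alpha> (s - t) * \<phi> t\<bar>) \<le> C * ((s - a) powr \<alpha> / Gamma (\<alpha> + 1))"
proof -
  let ?a = "min a s"
  have *: "integrable lborel (\<lambda>t. C * (indicator {?a..} t * rl_kernel \<alpha> (s - t)))"
    using has_bochner_integral_rl_kernel[OF assms(1), of ?a s] by (auto simp: has_bochner_integral_iff)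
  have le: "\<bar>rl_kernel \<alpha> (s - t) * \<phi> t\<bar> \<le> C * (indicator {a..} t * rl_kernel \<alpha> (s - t))" for t
    using assms(3)[of t] assms(4) rl_kernel_nonneg[OF assms(1), of "s - t"]
    by (auto simp: abs_mult mult.commute[of C] indicator_def intro!: mult_left_mono)
  have C: "0 \<le> C" using assms(3)[of 0] by linarith
  have le': "\<bar>rl_kernel \<alpha> (s - t) * \<phi> t\<bar> \<le> C * (indicator {?a..} t * rl_kernel \<alpha> (s - t))" for t
    by (rule order_trans[OF le]) (use C rl_kernel_nonneg[OF assms(1), of "s - t"] in \<open>auto simp: indicator_def\<close>)
  show int: "integrable lborel (\<lambda>t. rl_kernel \<alpha> (s - t) * \<phi> t)"
    by (rule Bochner_Integration.integrable_bound[OF *]) (use le' order_trans[OF le'] in \<open>auto\<close>)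
  show "(LBINT t. \<bar>rl_kernel \<alpha> (s - t) * \<phi> t\<bar>) \<le> C * ((s - a) powr \<alpha> / Gamma (\<alpha> + 1))" if "a \<le> s"
  proof -
    have b: "has_bochner_integral lborel (\<lambda>t. C * (indicator {a..} t * rl_kernel \<alpha> (s - t))) (C * ((s - a) powr \<alpha> / Gamma (\<alpha> + 1)))"
      by (intro has_bochner_integral_mult_right has_bochner_integral_rl_kernel assms that) 
    have "(LBINT t. \<bar>rl_kernel \<alpha> (s - t) * \<phi> t\<bar>) \<le> (LBINT t. C * (indicator {a..} t * rl_kernel \<alpha> (s - t)))"
      using int b le by (intro integral_mono) (auto simp: has_bochner_integral_iff)
    then show ?thesis using b by (simp add: has_bochner_integral_iff)
  qed
qed

text \<open>Both sides are the two iterated integrals of \<open>g s * rl_kernel \<alpha> (s - t) * \<phi> t\<close>. Boundedness of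
\<open>\<phi>\<close> and integrability of \<open>g\<close> suffice, since the kernel is integrable on bounded sets.\<close>

lemma rl_int_adjoint:
  assumes "0 < \<alpha>" and g: "integrable lborel g" "\<forall>s>b. g s = 0"
    and [measurable]: "\<phi> \<in> borel_measurable borel" and \<phi>: "\<And>t. \<bar>\<phi> t\<bar> \<le> C" "\<forall>t<a. \<phi> t = 0"
  shows "integrable lborel (\<lambda>t. rl_int_right \<alpha> g t * \<phi> t)"
    and "integrable lborel (\<lambda>s. g s * rl_int \<alpha> \<phi> s)"
    and "(LBINT t. rl_int_right \<alpha> g t * \<phi> t) = (LBINT s. g s * rl_int \<alpha> \<phi> s)"
proof -
  have [measurable]: "g \<in> borel_measurable borel" using g(1) by auto
  define F where "F = (\<lambda>s t. g s * (rl_kernel \<alpha> (s - t) * \<phi> t))"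
  note ib = integrable_rl_kernel_bounded[OF assms(1,4) \<phi>]
  define M where "M = C * (\<bar>b - a\<bar> powr \<alpha> / Gamma (\<alpha> + 1))"
  have C: "0 \<le> C" using \<phi>(1)[of 0] by linarith
  have int: "integrable (lborel \<Otimes>\<^sub>M lborel) (\<lambda>(s, t). F s t)"
  proof (rule lborel_pair.Fubini_integrable)
    show "(\<lambda>(s, t). F s t) \<in> borel_measurable (lborel \<Otimes>\<^sub>M lborel)" unfolding F_def by measurable
    show "integrable lborel (\<lambda>s. LBINT t. norm (case (s, t) of (s, t) \<Rightarrow> F s t))"
    proof (rule Bochner_Integration.integrable_bound)
      show "integrable lborel (\<lambda>s. g s * M)" using g by simp
      show "(\<lambda>s. LBINT t. norm (case (s, t) of (s, t) \<Rightarrow> F s t)) \<in> borel_measurable lborel"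
        unfolding F_def by measurable
      have "\<bar>LBINT t. \<bar>F s t\<bar>\<bar> \<le> \<bar>g s * M\<bar>" for s
      proof (cases "a \<le> s \<and> s \<le> b")
        case True
        have M0: "0 \<le> M" using C assms(1) by (auto simp: M_def Gamma_real_pos less_imp_le)
        have "(LBINT t. \<bar>rl_kernel \<alpha> (s - t) * \<phi> t\<bar>) \<le> C * ((s - a) powr \<alpha> / Gamma (\<alpha> + 1))"
          using ib(2) True by blast
        also have "\<dots> \<le> M" unfolding M_def using True assms(1) C
          by (intro mult_left_mono divide_right_mono powr_mono2) (auto simp: Gamma_real_pos less_imp_le)
        finally have "\<bar>g s\<bar> * (LBINT t. \<bar>rl_kernel \<alpha> (s - t) * \<phi> t\<bar>) \<le> \<bar>g s\<bar> * M"
          by (rule mult_left_mono) simp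
        moreover have "(LBINT t. \<bar>F s t\<bar>) = \<bar>g s\<bar> * (LBINT t. \<bar>rl_kernel \<alpha> (s - t) * \<phi> t\<bar>)"
          unfolding F_def abs_mult[of "g s"] by simp
        ultimately show ?thesis using M0 by (simp add: abs_mult)
      next
        case False
        have "F s t = 0" for t using False g(2) \<phi>(2)
          by (cases "b < s"; cases "t < a") (auto simp: F_def rl_kernel_def)
        then show ?thesis by simp
      qed
      then show "AE s in lborel. norm (LBINT t. norm (case (s, t) of (s, t) \<Rightarrow> F s t)) \<le> norm (g s * M)" by simp
    qed
    show "AE s in lborel. integrable lborel (\<lambda>t. case (s, t) of (s, t) \<Rightarrow> F s t)"
      using ib(1) by (auto simp: F_def)
  qed
  have i1: "(LBINT t. F s t) = g s * rl_int \<alpha> \<phi> s" for s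
    unfolding F_def rl_int_def by simp
  have i2: "(LBINT s. F s t) = rl_int_right \<alpha> g t * \<phi> t" for t
  proof -
    have "(\<lambda>s. F s t) = (\<lambda>s. (rl_kernel \<alpha> (s - t) * g s) * \<phi> t)" by (auto simp: F_def)
    then show ?thesis by (simp add: rl_int_right_def)
  qed
  show "integrable lborel (\<lambda>t. rl_int_right \<alpha> g t * \<phi> t)"
    using lborel_pair.integrable_snd[OF int] by (simp add: i2)
  show "integrable lborel (\<lambda>s. g s * rl_int \<alpha> \<phi> s)"
    using lborel_pair.integrable_fst[OF int] by (simp add: i1)
  show "(LBINT t. rl_int_right \<alpha> g t * \<phi> t) = (LBINT s. g s * rl_int \<alpha> \<phi> s)"
    using lborel_pair.Fubini_integral[OF int] by (simp add: i1 i2)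
qed

lemma rl_int_cong:
  assumes "\<And>s. s < t \<Longrightarrow> f s = g s"
  shows "rl_int \<alpha> f t = rl_int \<alpha> g t"
proof -
  have "(\<lambda>s. rl_kernel \<alpha> (t - s) * f s) = (\<lambda>s. rl_kernel \<alpha> (t - s) * g s)"
    using assms by (auto simp: rl_kernel_def fun_eq_iff)
  then show ?thesis by (simp add: rl_int_def)
qed

lemma has_integral_rl_int:
  assumes "0 < \<alpha>" "integrable lborel (\<lambda>s. rl_kernel \<alpha> (t - s) * g s)" "\<forall>s<a. g s = 0"
  shows "((\<lambda>s. (t - s) powr (\<alpha> - 1) * g s) has_integral Gamma \<alpha> * rl_int \<alpha> g t) {a..t}"
proof -
  have G: "Gamma \<alpha> \<noteq> 0" using Gamma_real_pos[OF assms(1)] by simp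
  have "((\<lambda>s. rl_kernel \<alpha> (t - s) * g s) has_integral rl_int \<alpha> g t) UNIV"
    unfolding rl_int_def by (rule has_integral_integral_lborel[OF assms(2)])
  then have "((\<lambda>s. Gamma \<alpha> * (rl_kernel \<alpha> (t - s) * g s)) has_integral Gamma \<alpha> * rl_int \<alpha> g t) UNIV"
    by (rule has_integral_mult_right)
  also have "(\<lambda>s. Gamma \<alpha> * (rl_kernel \<alpha> (t - s) * g s)) =
     (\<lambda>s. if s \<in> {a..t} then (t - s) powr (\<alpha> - 1) * g s else 0)"
    using G assms(3) by (auto simp: fun_eq_iff rl_kernel_def)
  finally show ?thesis by (simp only: has_integral_restrict_UNIV)
qed

text \<open>In the form \<open>\<integral> rl_kernel \<alpha> s * \<phi> (x - s)\<close> only the continuous factor depends on \<open>x\<close>, and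
dominated convergence applies.\<close>

lemma continuous_on_rl_int:
  assumes "0 < \<alpha>" "continuous_on UNIV \<phi>" "\<And>t. \<bar>\<phi> t\<bar> \<le> C" "\<forall>t<a. \<phi> t = 0"
  shows "continuous_on S (rl_int \<alpha> \<phi>)"
proof (rule continuous_on_subset[OF _ subset_UNIV], rule continuous_at_imp_continuous_on, safe)
  fix t :: real
  have [measurable]: "\<phi> \<in> borel_measurable borel" by (rule borel_measurable_continuous_onI[OF assms(2)])
  have rew: "rl_int \<alpha> \<phi> x = (LBINT s. rl_kernel \<alpha> s * \<phi> (x - s))" for x
    using lborel_integral_real_affine[of "-1" "\<lambda>s. rl_kernel \<alpha> (x - s) * \<phi> s" x] by (simp add: rl_int_def)
  define B where "B = max (t + 1) a - a"
  have "has_bochner_integral lborel (\<lambda>s. indicator {-B..} s * rl_kernel \<alpha> (0 - s)) ((0 - - B) powr \<alpha> / Gamma (\<alpha> + 1))"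
    by (rule has_bochner_integral_rl_kernel) (use assms(1) in \<open>auto simp: B_def\<close>)
  from lborel_has_bochner_integral_real_affine_iff[of "-1" _ _ 0, THEN iffD1, OF _ this]
  have kint: "integrable lborel (\<lambda>s. indicator {..B} s * rl_kernel \<alpha> s)"
    by (auto simp: has_bochner_integral_iff indicator_def cong: if_cong)
  show "isCont (rl_int \<alpha> \<phi>) t"
  proof (rule continuous_at_sequentiallyI)
    fix u :: "nat \<Rightarrow> real" assume u: "u \<longlonglongrightarrow> t"
    then obtain N where N: "\<And>n. n \<ge> N \<Longrightarrow> u n < t + 1"
      using order_tendstoD(2)[OF u, of "t + 1"] by (auto simp: eventually_sequentially)
    have "(\<lambda>n. LBINT s. rl_kernel \<alpha> s * \<phi> (u (n + N) - s)) \<longlonglongrightarrow> (LBINT s. rl_kernel \<alpha> s * \<phi> (t - s))"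
    proof (rule integral_dominated_convergence)
      show "(\<lambda>s. rl_kernel \<alpha> s * \<phi> (t - s)) \<in> borel_measurable lborel" by measurable
      show "(\<lambda>s. rl_kernel \<alpha> s * \<phi> (u (n + N) - s)) \<in> borel_measurable lborel" for n by measurable
      show "integrable lborel (\<lambda>s. C * (indicator {..B} s * rl_kernel \<alpha> s))" using kint by simp
      have un: "(\<lambda>n. u (n + N)) \<longlonglongrightarrow> t" using u by (rule LIMSEQ_ignore_initial_segment)
      show "AE s in lborel. (\<lambda>n. rl_kernel \<alpha> s * \<phi> (u (n + N) - s)) \<longlonglongrightarrow> rl_kernel \<alpha> s * \<phi> (t - s)"
      proof (rule AE_I2)
        fix s :: real
        have "isCont \<phi> (t - s)" using assms(2) by (simp add: continuous_on_eq_continuous_at)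
        then show "(\<lambda>n. rl_kernel \<alpha> s * \<phi> (u (n + N) - s)) \<longlonglongrightarrow> rl_kernel \<alpha> s * \<phi> (t - s)"
          by (intro tendsto_mult tendsto_const isCont_tendsto_compose[of _ \<phi>] tendsto_diff un)
      qed
      show "AE s in lborel. norm (rl_kernel \<alpha> s * \<phi> (u (n + N) - s)) \<le> C * (indicator {..B} s * rl_kernel \<alpha> s)" for n
      proof (rule AE_I2)
        fix s :: real
        have "u (n + N) < t + 1" using N by simp
        then have "B < s \<Longrightarrow> \<phi> (u (n + N) - s) = 0" by (intro assms(4)[rule_format]) (auto simp: B_def)
        then show "norm (rl_kernel \<alpha> s * \<phi> (u (n + N) - s)) \<le> C * (indicator {..B} s * rl_kernel \<alpha> s)"
          using assms(3)[of "u (n + N) - s"] rl_kernel_nonneg[OF assms(1), of s]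
          by (cases "B < s") (auto simp: abs_mult mult.commute[of C] indicator_def intro!: mult_left_mono)
      qed
    qed
    then have "(\<lambda>n. rl_int \<alpha> \<phi> (u (n + N))) \<longlonglongrightarrow> rl_int \<alpha> \<phi> t" by (simp add: rew)
    then show "(\<lambda>n. rl_int \<alpha> \<phi> (u n)) \<longlonglongrightarrow> rl_int \<alpha> \<phi> t" by (rule LIMSEQ_offset)
  qed
qed

section \<open>Lebesgue's differentiation theorem on the real line\<close>

text \<open>Outer regularity of Lebesgue measure combined with absolute continuity of the integral. The latter is
obtained by cutting off the large values of \<open>g\<close>.\<close>

lemma integral_small_near_sublevel:
  fixes g :: "real \<Rightarrow> real"
  assumes g: "integrable lborel g" and e: "0 < e"
  obtains U where "open U" "{x. g x \<le> p} \<subseteq> U"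
    "integrable lborel (\<lambda>x. indicator (U - {x. g x \<le> p}) x * \<bar>g x - p\<bar>)"
    "(LBINT x. indicator (U - {x. g x \<le> p}) x * \<bar>g x - p\<bar>) \<le> e"
proof -
  have [measurable]: "g \<in> borel_measurable borel" using g by auto
  have lim: "(\<lambda>M. LBINT x. indicator {x. real M < \<bar>g x\<bar>} x * \<bar>g x\<bar>) \<longlonglongrightarrow> (LBINT x::real. 0)"
  proof (rule integral_dominated_convergence)
    show "integrable lborel (\<lambda>x. \<bar>g x\<bar>)" using g by simp
    show "AE x in lborel. (\<lambda>M. indicator {x. real M < \<bar>g x\<bar>} x * \<bar>g x\<bar>) \<longlonglongrightarrow> 0"
    proof (rule AE_I2)
      fix x
      obtain N where N: "\<bar>g x\<bar> \<le> real N" using real_arch_simple by blast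
      have "\<forall>\<^sub>F M in sequentially. indicator {x. real M < \<bar>g x\<bar>} x * \<bar>g x\<bar> = 0"
        using eventually_ge_at_top[of N] by eventually_elim (use N in \<open>auto simp: indicator_def\<close>)
      then show "(\<lambda>M. indicator {x. real M < \<bar>g x\<bar>} x * \<bar>g x\<bar>) \<longlonglongrightarrow> 0" by (rule tendsto_eventually)
    qed
  qed (auto simp: indicator_def)
  then obtain M where M: "(LBINT x. indicator {x. real M < \<bar>g x\<bar>} x * \<bar>g x\<bar>) < e / 2"
    using order_tendstoD(2)[OF lim, of "e / 2"] e by (auto simp: eventually_sequentially)
  (* The cutoff takes one half of e; the set where g is at most M in modulus takes the other half. *)
  define \<delta> where "\<delta> = e / (2 * (real M + \<bar>p\<bar> + 1))"
  have \<delta>: "0 < \<delta>" using e by (simp add: \<delta>_def)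
  define A where "A = {x. g x \<le> p}"
  have [measurable]: "A \<in> sets borel" unfolding A_def by measurable
  obtain U where U: "open U" "A \<subseteq> U" "U - A \<in> lmeasurable" "emeasure lebesgue (U - A) < ennreal \<delta>"
    using sets_lebesgue_outer_open[of A \<delta>] \<delta> by auto
  have [measurable]: "U \<in> sets borel" using U(1) by simp
  define W where "W = U - A"
  have Ws [measurable]: "W \<in> sets borel" unfolding W_def by measurable
  have emW: "emeasure lborel W < ennreal \<delta>" using U(4) Ws by (simp add: W_def[symmetric])
  then have fin: "emeasure lborel W < \<infinity>" by (auto intro: less_trans[OF _ ennreal_less_top])
  have mW: "measure lborel W \<le> \<delta>"
    using emW \<delta> by (simp add: measure_def enn2real_leI less_imp_le)
  have i1: "integrable lborel (\<lambda>x. indicator W x * (real M + \<bar>p\<bar>))"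
    using fin by (intro integrable_mult_left) auto
  have i2: "integrable lborel (\<lambda>x. indicator {x. real M < \<bar>g x\<bar>} x * \<bar>g x\<bar>)"
    by (rule Bochner_Integration.integrable_bound[OF g]) (auto simp: indicator_def)
  have le: "indicator W x * \<bar>g x - p\<bar> \<le> indicator W x * (real M + \<bar>p\<bar>) + indicator {x. real M < \<bar>g x\<bar>} x * \<bar>g x\<bar>" for x
    by (auto simp: indicator_def)
  have int: "integrable lborel (\<lambda>x. indicator W x * \<bar>g x - p\<bar>)"
    by (rule Bochner_Integration.integrable_bound[OF Bochner_Integration.integrable_add[OF i1 i2]])
      (auto intro: order_trans[OF le])
  have "(LBINT x. indicator W x * \<bar>g x - p\<bar>) \<le>
     (LBINT x. indicator W x * (real M + \<bar>p\<bar>) + indicator {x. real M < \<bar>g x\<bar>} x * \<bar>g x\<bar>)"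
    using int i1 i2 le by (intro integral_mono) auto
  also have "\<dots> = measure lborel W * (real M + \<bar>p\<bar>) + (LBINT x. indicator {x. real M < \<bar>g x\<bar>} x * \<bar>g x\<bar>)"
    using i1 i2 by simp
  also have "\<dots> \<le> \<delta> * (real M + \<bar>p\<bar>) + e / 2"
    using M mW by (intro add_mono mult_right_mono) auto
  also have "\<delta> * (real M + \<bar>p\<bar>) \<le> \<delta> * (real M + \<bar>p\<bar> + 1)" using \<delta> by (intro mult_left_mono) auto
  also have "\<delta> * (real M + \<bar>p\<bar> + 1) = e / 2"
  proof -
    have "real M + \<bar>p\<bar> + 1 > 0" by simp
    then show ?thesis unfolding \<delta>_def by (simp add: field_simps)
  qed
  finally have "(LBINT x. indicator W x * \<bar>g x - p\<bar>) \<le> e" by simp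
  with U int show ?thesis by (intro that[of U]) (auto simp: W_def A_def)
qed

text \<open>The core of the differentiation theorem. Points of the exceptional set are covered, in the sense of
Vitali, by small intervals on which the average of \<open>g\<close> exceeds \<open>q\<close>, inside an open set \<open>U\<close> that is
hardly larger than \<open>{x. g x \<le> p}\<close>. A disjoint family of such intervals has total length at most
\<open>1 / (q - p)\<close> times the integral of \<open>g - p\<close> over its union, and only the small part of \<open>U\<close> where
\<open>g > p\<close> contributes positively to that integral.\<close>

lemma negligible_large_averages:
  fixes g :: "real \<Rightarrow> real"
  assumes g: "integrable lborel g" and pq: "p < q"
  shows "negligible {x. g x \<le> p \<and> (\<forall>d>0. \<exists>y z. y \<le> x \<and> x \<le> z \<and> y < z \<and> z - y < d \<and>
           q * (z - y) < (LBINT s. indicator {y..z} s * g s))}" (is "negligible ?E")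
  unfolding negligible_outer_le
proof (intro allI impI)
  fix e :: real assume e: "0 < e"
  obtain U where U: "open U" "{x. g x \<le> p} \<subseteq> U"
    and int: "integrable lborel (\<lambda>x. indicator (U - {x. g x \<le> p}) x * \<bar>g x - p\<bar>)"
    and le: "(LBINT x. indicator (U - {x. g x \<le> p}) x * \<bar>g x - p\<bar>) \<le> e * (q - p)"
    using integral_small_near_sublevel[OF g, of "e * (q - p)" p] e pq by auto
  define K where "K = {(y, z). y < z \<and> {y..z} \<subseteq> U \<and> q * (z - y) < (LBINT s. indicator {y..z} s * g s)}"
  define m where "m = (\<lambda>(y, z). (y + z) / 2 :: real)"
  define r where "r = (\<lambda>(y, z). (z - y) / 2 :: real)"
  have cb: "cball (m i) (r i) = {fst i..snd i}" for i
    by (auto simp: m_def r_def split_beta cball_eq_atLeastAtMost field_simps)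
  obtain C where C: "countable C" "C \<subseteq> K"
     "pairwise (\<lambda>i j. disjnt (cball (m i) (r i)) (cball (m j) (r j))) C"
     "negligible (?E - (\<Union>i \<in> C. cball (m i) (r i)))"
  proof (rule Vitali_covering_theorem_cballs[of K r ?E m])
    show "0 < r i" if "i \<in> K" for i using that by (auto simp: K_def r_def)
    fix x d :: real assume x: "x \<in> ?E" and d: "0 < d"
    then have "x \<in> U" using U by auto
    then obtain \<rho> where \<rho>: "0 < \<rho>" "ball x \<rho> \<subseteq> U" using U(1) openE by blast
    obtain y z where yz: "y \<le> x" "x \<le> z" "y < z" "z - y < min d \<rho>"
        "q * (z - y) < (LBINT s. indicator {y..z} s * g s)"
      using x d \<rho>(1) by (auto dest: spec[of _ "min d \<rho>"])
    have "{y..z} \<subseteq> ball x \<rho>" using yz by (auto simp: dist_real_def)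
    then have "(y, z) \<in> K" using yz \<rho> by (auto simp: K_def)
    moreover have "x \<in> cball (m (y, z)) (r (y, z))" using yz unfolding cb by auto
    moreover have "r (y, z) < d" using yz by (auto simp: r_def)
    ultimately show "\<exists>i. i \<in> K \<and> x \<in> cball (m i) (r i) \<and> r i < d" by blast
  qed (use that in blast)
  let ?I = "\<lambda>i. {fst i..snd i} :: real set"
  have bound: "measure lebesgue (\<Union>i\<in>C'. ?I i) \<le> e" if C': "C' \<subseteq> C" "finite C'" for C'
  proof -
    have disj: "?I i \<inter> ?I j = {}" if "i \<in> C'" "j \<in> C'" "i \<noteq> j" for i j
      using C(3) C' that unfolding cb pairwise_def disjnt_def by blast
    have K: "fst i < snd i" "?I i \<subseteq> U" "q * (snd i - fst i) < (LBINT s. indicator (?I i) s * g s)" if "i \<in> C'" for i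
    proof -
      have "i \<in> K" using that C'(1) C(2) by blast
      then show "fst i < snd i" "?I i \<subseteq> U" "q * (snd i - fst i) < (LBINT s. indicator (?I i) s * g s)"
        by (simp_all add: K_def split_beta)
    qed
    have ii: "integrable lborel (\<lambda>s. indicator (?I i) s * (g s - p))"
         "(LBINT s. indicator (?I i) s * (g s - p)) = (LBINT s. indicator (?I i) s * g s) - p * (snd i - fst i)" if "i \<in> C'" for i
    proof -
      have 1: "integrable lborel (\<lambda>s. indicator (?I i) s * g s)"
        using g integrable_mult_indicator[of "?I i" lborel g] by simp
      have 2: "integrable lborel (\<lambda>s. indicator (?I i) s * p)"
        using K(1)[OF that] by (intro integrable_mult_left integrable_real_indicator) auto
      show "integrable lborel (\<lambda>s. indicator (?I i) s * (g s - p))"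
        using 1 2 by (simp add: right_diff_distrib)
      show "(LBINT s. indicator (?I i) s * (g s - p)) = (LBINT s. indicator (?I i) s * g s) - p * (snd i - fst i)"
        using 1 2 K(1)[OF that] by (simp add: right_diff_distrib) (simp add: algebra_simps)
    qed
    have "(q - p) * measure lebesgue (\<Union>i\<in>C'. ?I i) \<le> (q - p) * (\<Sum>i\<in>C'. measure lebesgue (?I i))"
      using pq C'(2) by (intro mult_left_mono measure_UNION_le) auto
    also have "\<dots> = (\<Sum>i\<in>C'. q * (snd i - fst i) - p * (snd i - fst i))"
      unfolding sum_distrib_left
    proof (intro sum.cong refl)
      fix i assume "i \<in> C'"
      then show "(q - p) * measure lebesgue (?I i) = q * (snd i - fst i) - p * (snd i - fst i)"
        using K(1)[of i] by (simp add: left_diff_distrib)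
    qed
    also have "\<dots> \<le> (\<Sum>i\<in>C'. LBINT s. indicator (?I i) s * (g s - p))"
      by (intro sum_mono) (use K(3) ii(2) in \<open>auto simp: less_imp_le\<close>)
    also have "\<dots> = (LBINT s. \<Sum>i\<in>C'. indicator (?I i) s * (g s - p))"
      by (rule Bochner_Integration.integral_sum[symmetric]) (use ii(1) in auto)
    also have "\<dots> \<le> (LBINT x. indicator (U - {x. g x \<le> p}) x * \<bar>g x - p\<bar>)"
    proof (rule integral_mono)
      show "integrable lborel (\<lambda>s. \<Sum>i\<in>C'. indicator (?I i) s * (g s - p))" using ii(1) by auto
      fix x
      show "(\<Sum>i\<in>C'. indicator (?I i) x * (g x - p)) \<le> indicator (U - {x. g x \<le> p}) x * \<bar>g x - p\<bar>"
      proof (cases "\<exists>i\<in>C'. x \<in> ?I i")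
        case True
        then obtain i where i: "i \<in> C'" "x \<in> ?I i" by blast
        have "(\<Sum>j\<in>C'. indicator (?I j) x * (g x - p)) = (\<Sum>j\<in>{i}. indicator (?I j) x * (g x - p))"
        proof (rule sum.mono_neutral_right)
          show "\<forall>j\<in>C' - {i}. indicator (?I j) x * (g x - p) = 0"
          proof
            fix j assume "j \<in> C' - {i}"
            then have "x \<notin> ?I j" using disj[OF i(1), of j] i(2) by blast
            then show "indicator (?I j) x * (g x - p) = 0" by simp
          qed
        qed (use i C' in auto)
        moreover have "x \<in> U" using K(2)[OF i(1)] i(2) by blast
        ultimately show ?thesis using i by (auto simp: indicator_def)
      next
        case False
        then have "(\<Sum>i\<in>C'. indicator (?I i) x * (g x - p)) = 0" by (intro sum.neutral) (auto simp: indicator_def)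
        then show ?thesis by simp
      qed
    qed (rule int)
    also have "\<dots> \<le> e * (q - p)" by (rule le)
    finally show ?thesis using pq by (simp add: mult.commute)
  qed
  have T: "(\<Union>i\<in>C. ?I i) \<in> lmeasurable" "measure lebesgue (\<Union>i\<in>C. ?I i) \<le> e"
    using fmeasurable_UN_bound[of C ?I lebesgue e] measure_UN_bound[of C ?I lebesgue e] C(1) bound by auto
  let ?N = "?E - (\<Union>i \<in> C. ?I i)"
  have N: "negligible ?N" using C(4) by (simp add: cb)
  show "\<exists>T. ?E \<subseteq> T \<and> T \<in> lmeasurable \<and> measure lebesgue T \<le> e"
  proof (intro exI conjI)
    show "?E \<subseteq> (\<Union>i\<in>C. ?I i) \<union> ?N" by blast
    show "(\<Union>i\<in>C. ?I i) \<union> ?N \<in> lmeasurable" using T(1) N negligible_imp_measurable by blast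
    show "measure lebesgue ((\<Union>i\<in>C. ?I i) \<union> ?N) \<le> e"
      using T N measure_Un_null_set[of "\<Union>i\<in>C. ?I i" lebesgue ?N] by (simp add: negligible_iff_null_sets fmeasurableD)
  qed
qed

text \<open>Rational levels \<open>p < q\<close> between \<open>g x\<close> and \<open>g x + e\<close> reduce this to countably many negligible sets.\<close>

lemma AE_upper_average_le:
  fixes g :: "real \<Rightarrow> real"
  assumes g: "integrable lborel g"
  shows "AE x in lebesgue. \<forall>e>0. \<exists>d>0. \<forall>y z. y \<le> x \<longrightarrow> x \<le> z \<longrightarrow> y < z \<longrightarrow> z - y < d \<longrightarrow>
           (LBINT s. indicator {y..z} s * g s) \<le> (g x + e) * (z - y)"
proof -
  define E where "E = (\<lambda>p q. {x. g x \<le> p \<and> (\<forall>d>0. \<exists>y z. y \<le> x \<and> x \<le> z \<and> y < z \<and> z - y < d \<and>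
           q * (z - y) < (LBINT s. indicator {y..z} s * g s))})"
  define I where "I = {(p, q). p \<in> \<rat> \<and> q \<in> \<rat> \<and> p < (q :: real)}"
  have "countable I" by (rule countable_subset[of _ "\<rat> \<times> \<rat>"]) (auto simp: I_def countable_rat)
  then have "negligible (\<Union>i\<in>I. E (fst i) (snd i))"
    using negligible_large_averages[OF g] by (intro negligible_countable_Union) (auto simp: I_def E_def)
  then have null: "(\<Union>i\<in>I. E (fst i) (snd i)) \<in> null_sets lebesgue" by (simp add: negligible_iff_null_sets)
  show ?thesis
  proof (rule AE_I'[OF null], rule subsetI)
    fix x :: real
    assume "x \<in> {x \<in> space lebesgue. \<not> (\<forall>e>0. \<exists>d>0. \<forall>y z. y \<le> x \<longrightarrow> x \<le> z \<longrightarrow> y < z \<longrightarrow> z - y < d \<longrightarrow>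
           (LBINT s. indicator {y..z} s * g s) \<le> (g x + e) * (z - y))}"
    then obtain e where *: "0 < e" and "\<not> (\<exists>d>0. \<forall>y z. y \<le> x \<longrightarrow> x \<le> z \<longrightarrow> y < z \<longrightarrow> z - y < d \<longrightarrow>
           (LBINT s. indicator {y..z} s * g s) \<le> (g x + e) * (z - y))" by blast
    then have n: "\<exists>y z. y \<le> x \<and> x \<le> z \<and> y < z \<and> z - y < d \<and> (g x + e) * (z - y) < (LBINT s. indicator {y..z} s * g s)"
      if "0 < d" for d using that by (meson not_le)
    obtain p where p: "p \<in> \<rat>" "g x < p" "p < g x + e" using Rats_dense_in_real[of "g x" "g x + e"] * by auto
    obtain q where q: "q \<in> \<rat>" "p < q" "q < g x + e" using Rats_dense_in_real[OF p(3)] by auto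
    have "x \<in> E p q" unfolding E_def
    proof (intro CollectI conjI allI impI)
      fix d :: real assume "0 < d"
      from n[OF this] obtain y z where yz: "y \<le> x" "x \<le> z" "y < z" "z - y < d"
         "(g x + e) * (z - y) < (LBINT s. indicator {y..z} s * g s)" by blast
      have "q * (z - y) \<le> (g x + e) * (z - y)" using q yz by (intro mult_right_mono) auto
      then have "q * (z - y) < (LBINT s. indicator {y..z} s * g s)" using yz(5) by (rule le_less_trans)
      then show "\<exists>y z. y \<le> x \<and> x \<le> z \<and> y < z \<and> z - y < d \<and> q * (z - y) < (LBINT s. indicator {y..z} s * g s)"
        using yz by blast
    qed (use p in auto)
    then show "x \<in> (\<Union>i\<in>I. E (fst i) (snd i))" using p q by (auto simp: I_def)
  qed
qed

text \<open>The bound for upper averages is applied to \<open>g\<close> and to \<open>- g\<close>.\<close>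

lemma lebesgue_differentiation_real:
  fixes g :: "real \<Rightarrow> real"
  assumes g: "integrable lborel g"
  shows "AE x in lebesgue. ((\<lambda>x. LBINT s. indicator {..x} s * g s) has_real_derivative g x) (at x)"
proof -
  define F where "F = (\<lambda>x. LBINT s. indicator {..x} s * g s)"
  have ig: "integrable lborel (\<lambda>s. indicator A s * g s)" if "A \<in> sets borel" for A
    using g integrable_mult_indicator[of A lborel g] that by simp
  have F: "F z - F y = (LBINT s. indicator {y..z} s * g s)" if "y < z" for y z
  proof -
    have "F z - F y = (LBINT s. indicator {..z} s * g s - indicator {..y} s * g s)"
      unfolding F_def by (intro Bochner_Integration.integral_diff[symmetric] ig) auto
    also have "\<dots> = (LBINT s. indicator {y..z} s * g s)"
    proof (rule integral_cong_AE)
      show "AE s in lborel. indicator {..z} s * g s - indicator {..y} s * g s = indicator {y..z} s * g s"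
        using AE_lborel_singleton[of y] by eventually_elim (use that in \<open>auto simp: indicator_def\<close>)
    qed (use g in auto)
    finally show ?thesis .
  qed
  have "AE x in lebesgue. (\<forall>e>0. \<exists>d>0. \<forall>y z. y \<le> x \<longrightarrow> x \<le> z \<longrightarrow> y < z \<longrightarrow> z - y < d \<longrightarrow>
           (LBINT s. indicator {y..z} s * - g s) \<le> (- g x + e) * (z - y))"
    using AE_upper_average_le[of "\<lambda>x. - g x"] g by simp
  with AE_upper_average_le[OF g] show ?thesis
  proof eventually_elim
    case (elim x)
    have "\<exists>d>0. \<forall>y. norm (y - x) < d \<longrightarrow> norm (F y - F x - g x * (y - x)) \<le> e * norm (y - x)" if e: "0 < e" for e
    proof -
      obtain d1 where d1: "d1 > 0" "\<And>y z. y \<le> x \<Longrightarrow> x \<le> z \<Longrightarrow> y < z \<Longrightarrow> z - y < d1 \<Longrightarrow>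
           (LBINT s. indicator {y..z} s * g s) \<le> (g x + e) * (z - y)" using elim(1) e by blast
      obtain d2 where d2: "d2 > 0" "\<And>y z. y \<le> x \<Longrightarrow> x \<le> z \<Longrightarrow> y < z \<Longrightarrow> z - y < d2 \<Longrightarrow>
           (LBINT s. indicator {y..z} s * - g s) \<le> (- g x + e) * (z - y)" using elim(2) e by blast
      have le: "\<bar>F z - F y - g x * (z - y)\<bar> \<le> e * (z - y)"
        if "y \<le> x" "x \<le> z" "y < z" "z - y < min d1 d2" for y z
        using d1(2)[of y z] d2(2)[of y z] F[OF that(3)] that by (simp add: algebra_simps abs_le_iff)
      show ?thesis
      proof (intro exI[of _ "min d1 d2"] conjI allI impI)
        fix y assume y: "norm (y - x) < min d1 d2"
        consider "y < x" | "y = x" | "x < y" by linarith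
        then show "norm (F y - F x - g x * (y - x)) \<le> e * norm (y - x)"
        proof cases
          case 1
          then have "\<bar>F x - F y - g x * (x - y)\<bar> \<le> e * (x - y)" using le[of y x] y by simp
          moreover have "F y - F x - g x * (y - x) = - (F x - F y - g x * (x - y))" by (simp add: algebra_simps)
          ultimately show ?thesis using 1 by (simp only: norm_minus_cancel real_norm_def abs_minus_commute[of y x])
        next
          case 3
          then show ?thesis using le[of x y] y by simp
        qed simp
      next
        show "0 < min d1 d2" using d1(1) d2(1) by simp
      qed
    qed
    then show ?case unfolding F_def[symmetric] has_field_derivative_def has_derivative_at_alt
      using bounded_linear_mult_right by blast
  qed
qed

section \<open>Riemann-Liouville derivatives of fractional integrals\<close>

lemma order_N_bounds:
  assumes "0 < \<alpha>" "\<alpha> \<notin> \<int>"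
  shows "\<alpha> < real (order_N \<alpha>)" "real (order_N \<alpha>) - 1 < \<alpha>" "1 \<le> order_N \<alpha>"
proof -
  have "of_int \<lfloor>\<alpha>\<rfloor> \<noteq> \<alpha>" using assms(2) by (metis Ints_of_int)
  then have "of_int \<lfloor>\<alpha>\<rfloor> < \<alpha>" using of_int_floor_le[of \<alpha>] by linarith
  moreover have "real (nat \<lfloor>\<alpha>\<rfloor>) = of_int \<lfloor>\<alpha>\<rfloor>" using assms(1) by simp
  ultimately show "\<alpha> < real (order_N \<alpha>)" "real (order_N \<alpha>) - 1 < \<alpha>" "1 \<le> order_N \<alpha>"
    unfolding order_N_def by linarith+
qed

lemma rl_kernel_1: "rl_kernel 1 x = indicator {0<..} x"
  by (auto simp: rl_kernel_def indicator_def)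

lemma rl_int_1:
  assumes [measurable]: "g \<in> borel_measurable borel"
  shows "rl_int 1 g t = (LBINT s. indicator {..t} s * g s)"
  unfolding rl_int_def
proof (rule integral_cong_AE)
  show "AE s in lborel. rl_kernel 1 (t - s) * g s = indicator {..t} s * g s"
    using AE_lborel_singleton[of t] by eventually_elim (auto simp: rl_kernel_1 indicator_def)
qed auto

lemma rl_int_eq_0: "(\<And>s. s < t \<Longrightarrow> g s = 0) \<Longrightarrow> rl_int \<alpha> g t = 0"
  using rl_int_cong[of t g "\<lambda>_. 0" \<alpha>] by (simp add: rl_int_def)

lemma has_integral_rl_int_1:
  assumes "integrable lborel (\<lambda>s. rl_kernel 1 (t - s) * g s)" "\<forall>s<a. g s = 0"
  shows "(g has_integral rl_int 1 g t) {a..t}"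
  using has_integral_spike_finite[OF _ _ has_integral_rl_int[OF _ assms], of "{t}" g] by simp

text \<open>By the third part of \<open>rl_int_semigroup\<close> with outer order one, whose kernel is constant to the left of
its base point; letting the base point run through the natural numbers covers the line.\<close>

lemma rl_int_AE_integrable:
  assumes "0 < \<beta>" and g: "integrable lborel g" "\<forall>s<a. g s = 0"
  shows "AE t in lborel. integrable lborel (\<lambda>u. rl_kernel \<beta> (t - u) * g u)"
proof -
  have "AE t in lborel. t < real m \<longrightarrow> integrable lborel (\<lambda>u. rl_kernel \<beta> (t - u) * g u)" for m :: nat
    using rl_int_semigroup(3)[of 1 \<beta> g a "real m"] assms
    by (auto simp: rl_kernel_1 elim!: eventually_mono)
  then have "AE t in lborel. \<forall>m. t < real m \<longrightarrow> integrable lborel (\<lambda>u. rl_kernel \<beta> (t - u) * g u)"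
    by (subst AE_all_countable) blast
  then show ?thesis by eventually_elim (meson reals_Archimedean2)
qed

lemma rl_int_derivative_step:
  assumes g: "integrable lborel g" "\<forall>s<a. g s = 0" and "1 \<le> n"
    and cont: "continuous_on UNIV (rl_int (real n) g)"
  shows "(rl_int (real (Suc n)) g has_vector_derivative rl_int (real n) g t) (at t)"
proof -
  (* Any base point strictly to the left of both a and t will do. *)
  define a' where "a' = min a t - 1"
  let ?h = "rl_int (real n) g"
  have n: "real (Suc n) = 1 + real n" by simp
  have eq: "rl_int (real (Suc n)) g x = integral {a'..x} ?h" for x
  proof -
    have "(?h has_integral rl_int 1 ?h x) {a'..x}"
    proof (rule has_integral_rl_int_1)
      show "integrable lborel (\<lambda>s. rl_kernel 1 (x - s) * ?h s)"
        by (rule rl_int_semigroup(1)[of 1 "real n", OF _ _ _ g]) (use assms(3) in auto)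
      show "\<forall>s<a'. ?h s = 0"
        using g(2) by (auto intro!: rl_int_eq_0 simp: a'_def)
    qed
    then have "integral {a'..x} ?h = rl_int 1 ?h x" by (rule integral_unique)
    also have "\<dots> = rl_int (1 + real n) g x"
      by (rule rl_int_semigroup(2)[of 1 "real n", OF _ _ _ g]) (use assms(3) in auto)
    finally show ?thesis unfolding n by simp
  qed
  have "((\<lambda>x. integral {a'..x} ?h) has_vector_derivative ?h t) (at t within {a'..t + 1})"
    by (rule integral_has_vector_derivative[OF continuous_on_subset[OF cont]]) (auto simp: a'_def)
  then have "(rl_int (real (Suc n)) g has_vector_derivative ?h t) (at t within {a'..t + 1})"
    using eq by presburger
  moreover have "at t within {a'..t + 1} = at t"
    by (rule at_within_interior) (auto simp: a'_def)
  ultimately show ?thesis by simp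
qed

text \<open>Fractional integrals of natural order are iterated integrals.\<close>

lemma continuous_and_derivative_rl_int_nat:
  assumes g: "integrable lborel g" "\<forall>s<a. g s = 0" and "1 \<le> n"
  shows "continuous_on UNIV (rl_int (real n) g) \<and>
    (\<forall>t. (rl_int (real (Suc n)) g has_vector_derivative rl_int (real n) g t) (at t))"
  using assms(3)
proof (induction n rule: dec_induct)
  case base
  show ?case
  proof (rule conjI)
    show cont: "continuous_on UNIV (rl_int (real 1) g)"
    proof (rule continuous_at_imp_continuous_on, safe)
      fix t :: real
      have "(\<lambda>x. integral {min a t - 1..x} g) x = rl_int 1 g x" for x
        by (rule integral_unique, rule has_integral_rl_int_1)
          (use integrable_rl_kernel_mult[of 1, OF _ g] g(2) in auto)
      moreover have "continuous_on {min a t - 1..t + 1} (\<lambda>x. integral {min a t - 1..x} g)"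
        by (rule indefinite_integral_continuous_1)
          (rule integrable_on_subinterval[OF has_integral_integrable[OF has_integral_integral_lborel[OF g(1)]]], simp)
      ultimately have "continuous_on {min a t - 1..t + 1} (rl_int 1 g)" by simp
      then have "continuous_on {min a t - 1..t + 1} (rl_int (real 1) g)" by simp
      then show "isCont (rl_int (real 1) g) t"
        by (rule continuous_on_interior) (auto simp: min_def)
    qed
    show "\<forall>t. (rl_int (real (Suc 1)) g has_vector_derivative rl_int (real 1) g t) (at t)"
      using rl_int_derivative_step[OF g order_refl cont] by blast
  qed
next
  case (step n)
  have cont: "continuous_on UNIV (rl_int (real (Suc n)) g)"
    using step.IH has_vector_derivative_continuous by (blast intro: continuous_at_imp_continuous_on)
  then show ?case using rl_int_derivative_step[OF g _ cont] by auto
qed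


text \<open>The semigroup law for the integral that occurs in the definition of the Riemann-Liouville derivative
of a fractional integral. It holds at every \<open>r\<close> although \<open>f\<close> is only known almost everywhere.\<close>

lemma has_integral_RL_kernel:
  assumes "0 < \<beta>" "\<beta> < real N" and g: "integrable lborel g" "\<forall>s<c. g s = 0"
    and f: "AE t in lborel. t \<in> {c..d} \<longrightarrow> f t = rl_int \<beta> g t" and "r \<in> {c..d}"
  shows "((\<lambda>s. (r - s) powr (real N - \<beta> - 1) * f s) has_integral
           Gamma (real N - \<beta>) * rl_int (real N) g r) {c..r}"
proof -
  have N: "1 \<le> real N" using assms(1,2) by (cases N) auto
  have "((\<lambda>s. (r - s) powr (real N - \<beta> - 1) * rl_int \<beta> g s) has_integral
      Gamma (real N - \<beta>) * rl_int (real N - \<beta>) (rl_int \<beta> g) r) {c..r}"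
  proof (rule has_integral_rl_int)
    show "integrable lborel (\<lambda>s. rl_kernel (real N - \<beta>) (r - s) * rl_int \<beta> g s)"
      by (rule rl_int_semigroup(1)[OF _ _ _ g]) (use assms(1,2) N in auto)
    show "\<forall>s<c. rl_int \<beta> g s = 0" using g(2) by (auto intro!: rl_int_eq_0)
  qed (use assms(2) in simp)
  also have "rl_int (real N - \<beta>) (rl_int \<beta> g) r = rl_int (real N - \<beta> + \<beta>) g r"
    by (rule rl_int_semigroup(2)[OF _ _ _ g]) (use assms(1,2) N in auto)
  finally have "((\<lambda>s. (r - s) powr (real N - \<beta> - 1) * rl_int \<beta> g s) has_integral
      Gamma (real N - \<beta>) * rl_int (real N) g r) {c..r}" by simp
  then show ?thesis
    by (rule has_integral_AE[THEN iffD1, rotated]) (use f assms(6) in \<open>auto elim!: eventually_mono\<close>)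
qed

text \<open>All but the last derivative of the \<open>N\<close>-fold integral exist everywhere; only the last one, the
derivative of the indefinite integral of \<open>g\<close>, is in question.\<close>

lemma iter_deriv_RL_potential:
  assumes "c < d" "1 \<le> N" and g: "integrable lborel g" "\<forall>s<c. g s = 0"
    and \<Phi>: "\<And>r. r \<in> {c..d} \<Longrightarrow> \<Phi> r = K * rl_int (real N) g r" and "t \<in> {c..d}"
  shows "iter_deriv {c..d} (N - 1) \<Phi> t = K * rl_int 1 g t"
    and "iter_deriv_exists {c..d} (N - 1) \<Phi> t"
proof -
  define e where "e = (\<lambda>p t. K * rl_int (real (N - p)) g t)"
  have "iter_deriv {c..d} (N - 1) \<Phi> t = e (N - 1) t \<and> iter_deriv_exists {c..d} (N - 1) \<Phi> t"
  proof (rule iter_deriv_of_derivs[OF assms(1), of "N - 1" e])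
    fix p x assume "p < N - 1" "x \<in> {c..d}"
    then have N: "N - p = Suc (N - Suc p)" "1 \<le> N - Suc p" by auto
    have "(rl_int (real (Suc (N - Suc p))) g has_vector_derivative rl_int (real (N - Suc p)) g x) (at x)"
      using continuous_and_derivative_rl_int_nat[OF g N(2)] by blast
    then show "(e p has_vector_derivative e (Suc p) x) (at x within {c..d})"
      unfolding e_def N(1)[symmetric] by (rule has_vector_derivative_mult_right[OF has_vector_derivative_at_within])
  qed (use \<Phi> assms(6) in \<open>auto simp: e_def\<close>)
  then show "iter_deriv {c..d} (N - 1) \<Phi> t = K * rl_int 1 g t" "iter_deriv_exists {c..d} (N - 1) \<Phi> t"
    using assms(2) by (auto simp: e_def)
qed

text \<open>The function that is differentiated \<open>N\<close> times in the Riemann-Liouville derivative is a multiple of the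
\<open>N\<close>-fold integral of \<open>g\<close>, and \<open>N - 1\<close> of the derivatives can be carried out.\<close>

lemma RL_left_imp_integral_derivative:
  assumes "c < d" "0 < \<beta>" "\<beta> \<notin> \<int>" and g: "integrable lborel g" "\<forall>s<c. g s = 0"
    and f: "AE t in lborel. t \<in> {c..d} \<longrightarrow> f t = rl_int \<beta> g t" and t: "t \<in> {c..d}"
    and ex: "RL_left_exists {c..d} c \<beta> f t"
  shows "((\<lambda>x. integral {c..x} g) has_vector_derivative RL_left {c..d} c \<beta> f t) (at t within {c..d})"
proof -
  define N where "N = order_N \<beta>"
  define \<Phi> where "\<Phi> = (\<lambda>r. integral {c..r} (\<lambda>s. (r - s) powr (real N - \<beta> - 1) * f s))"
  define K where "K = Gamma (real N - \<beta>)"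
  note N = order_N_bounds[OF assms(2,3), folded N_def]
  have K: "K \<noteq> 0" using Gamma_real_pos[of "real N - \<beta>"] N(1) unfolding K_def by linarith
  have \<Phi>: "\<Phi> r = K * rl_int (real N) g r" if "r \<in> {c..d}" for r
    unfolding \<Phi>_def K_def by (rule integral_unique, rule has_integral_RL_kernel[OF assms(2) N(1) g f that])
  have exN: "iter_deriv_exists {c..d} N \<Phi> t" using ex by (simp add: RL_left_exists_def \<Phi>_def N_def)
  have "(iter_deriv {c..d} (N - 1) \<Phi> has_vector_derivative iter_deriv {c..d} (Suc (N - 1)) \<Phi> t) (at t within {c..d})"
    by (rule iter_deriv_has_vector_derivative[OF exN t]) (use N in auto)
  then have D: "((\<lambda>x. 1 / K * iter_deriv {c..d} (N - 1) \<Phi> x) has_vector_derivative 1 / K * iter_deriv {c..d} (Suc (N - 1)) \<Phi> t) (at t within {c..d})"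
    by (rule has_vector_derivative_mult_right)
  have val: "1 / K * iter_deriv {c..d} (Suc (N - 1)) \<Phi> t = RL_left {c..d} c \<beta> f t"
    using N(3) unfolding RL_left_def K_def \<Phi>_def N_def by simp
  have eq: "integral {c..x} g = 1 / K * iter_deriv {c..d} (N - 1) \<Phi> x" if "x \<in> {c..d}" for x
  proof -
    have "integral {c..x} g = rl_int 1 g x"
      by (rule integral_unique, rule has_integral_rl_int_1) (use integrable_rl_kernel_mult[of 1, OF _ g] g(2) in auto)
    then show ?thesis
      using iter_deriv_RL_potential(1)[OF assms(1) N(3) g, where \<Phi>=\<Phi> and K=K and t=x] \<Phi> that K by simp
  qed
  show ?thesis using has_vector_derivative_transform[OF t eq D] unfolding val by simp
qed

text \<open>By the differentiation theorem the one derivative that is left exists almost everywhere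
and is \<open>g\<close>.\<close>

lemma RL_left_ae_eq:
  assumes "c < d" "0 < \<beta>" "\<beta> \<notin> \<int>" and g: "integrable lborel g" "\<forall>s<c. g s = 0"
    and f: "AE t in lborel. t \<in> {c..d} \<longrightarrow> f t = rl_int \<beta> g t"
  shows "AE t in lborel. t \<in> {c..d} \<longrightarrow> RL_left_exists {c..d} c \<beta> f t \<and> RL_left {c..d} c \<beta> f t = g t"
proof -
  define N where "N = order_N \<beta>"
  define \<Phi> where "\<Phi> = (\<lambda>r. integral {c..r} (\<lambda>s. (r - s) powr (real N - \<beta> - 1) * f s))"
  define K where "K = Gamma (real N - \<beta>)"
  note N = order_N_bounds[OF assms(2,3), folded N_def]
  have K: "K \<noteq> 0" using Gamma_real_pos[of "real N - \<beta>"] N(1) unfolding K_def by linarith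
  have \<Phi>: "\<Phi> r = K * rl_int (real N) g r" if "r \<in> {c..d}" for r
    unfolding \<Phi>_def K_def by (rule integral_unique, rule has_integral_RL_kernel[OF assms(2) N(1) g f that])
  have [measurable]: "g \<in> borel_measurable borel" using g by auto
  have "AE x in lborel. (rl_int 1 g has_real_derivative g x) (at x)"
  proof -
    have "rl_int 1 g = (\<lambda>x. LBINT s. indicator {..x} s * g s)" by (rule ext, rule rl_int_1) simp
    then show ?thesis using lebesgue_differentiation_real[OF g(1)] by (simp add: AE_completion_iff)
  qed
  then show ?thesis
  proof eventually_elim
    case (elim t)
    show ?case
    proof
      assume t: "t \<in> {c..d}"
      have "(rl_int 1 g has_vector_derivative g t) (at t within {c..d})"
        using elim unfolding has_real_derivative_iff_has_vector_derivative by (rule has_vector_derivative_at_within)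
      then have "((\<lambda>x. K * rl_int 1 g x) has_vector_derivative K * g t) (at t within {c..d})"
        by (rule has_vector_derivative_mult_right)
      then have D: "(iter_deriv {c..d} (N - 1) \<Phi> has_vector_derivative K * g t) (at t within {c..d})"
        by (rule has_vector_derivative_transform[OF t, rotated])
          (use iter_deriv_RL_potential(1)[OF assms(1) N(3) g, where \<Phi>=\<Phi> and K=K] \<Phi> in auto)
      then have "iter_deriv {c..d} (Suc (N - 1)) \<Phi> t = K * g t"
        using vector_derivative_within_closed_interval[OF assms(1) t] by simp
      moreover have "iter_deriv_exists {c..d} (Suc (N - 1)) \<Phi> t"
        using D iter_deriv_RL_potential(2)[OF assms(1) N(3) g, where \<Phi>=\<Phi> and K=K] \<Phi>
        by (auto simp: differentiableI_vector)
      moreover have "Suc (N - 1) = N" using N(3) by simp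
      ultimately show "RL_left_exists {c..d} c \<beta> f t \<and> RL_left {c..d} c \<beta> f t = g t"
        using K unfolding RL_left_exists_def RL_left_def by (simp add: N_def[symmetric] \<Phi>_def[symmetric] K_def[symmetric])
    qed
  qed
qed

lemma RL_left_linear:
  assumes "c < d" "t \<in> {c..d}"
    and int: "\<And>r. r \<in> {c..d} \<Longrightarrow> (\<lambda>s. (r - s) powr (real (order_N \<beta>) - \<beta> - 1) * f s) integrable_on {c..r}"
      "\<And>r. r \<in> {c..d} \<Longrightarrow> (\<lambda>s. (r - s) powr (real (order_N \<beta>) - \<beta> - 1) * h s) integrable_on {c..r}"
    and ex: "RL_left_exists {c..d} c \<beta> f t" "RL_left_exists {c..d} c \<beta> h t"
  shows "RL_left_exists {c..d} c \<beta> (\<lambda>s. f s - v * h s) t"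
    and "RL_left {c..d} c \<beta> (\<lambda>s. f s - v * h s) t = RL_left {c..d} c \<beta> f t - v * RL_left {c..d} c \<beta> h t"
proof -
  define I where "I = (\<lambda>f r. integral {c..r} (\<lambda>s. (r - s) powr (real (order_N \<beta>) - \<beta> - 1) * f s))"
  have I: "I (\<lambda>s. f s - v * h s) r = 1 * I f r + (- v) * I h r" if "r \<in> {c..d}" for r
  proof -
    let ?k = "\<lambda>s. (r - s) powr (real (order_N \<beta>) - \<beta> - 1)"
    have "integral {c..r} (\<lambda>s. ?k s * f s - v * (?k s * h s)) = integral {c..r} (\<lambda>s. ?k s * f s) - v * integral {c..r} (\<lambda>s. ?k s * h s)"
      using Henstock_Kurzweil_Integration.integral_diff[OF int(1)[OF that] integrable_on_mult_right[OF int(2)[OF that]], of v]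
      by simp
    then show ?thesis by (simp add: I_def algebra_simps)
  qed
  have "iter_deriv_exists {c..d} (order_N \<beta>) (I f) t" "iter_deriv_exists {c..d} (order_N \<beta>) (I h) t"
    using ex by (simp_all add: RL_left_exists_def I_def)
  note lin = iter_deriv_linear[OF assms(1) this assms(2), of 1 "- v"]
  show "RL_left_exists {c..d} c \<beta> (\<lambda>s. f s - v * h s) t"
  proof -
    have "iter_deriv_exists {c..d} (order_N \<beta>) (I (\<lambda>s. f s - v * h s)) t"
      using lin iter_deriv_exists_cong[where f = "I (\<lambda>s. f s - v * h s)", OF I assms(2)] by blast
    then show ?thesis unfolding RL_left_exists_def I_def .
  qed
  have "iter_deriv {c..d} (order_N \<beta>) (I (\<lambda>s. f s - v * h s)) t =
    iter_deriv {c..d} (order_N \<beta>) (I f) t - v * iter_deriv {c..d} (order_N \<beta>) (I h) t"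
    using lin iter_deriv_cong[where f = "I (\<lambda>s. f s - v * h s)" and n = "order_N \<beta>", OF I assms(2)] by simp
  then show "RL_left {c..d} c \<beta> (\<lambda>s. f s - v * h s) t = RL_left {c..d} c \<beta> f t - v * RL_left {c..d} c \<beta> h t"
  proof -
    assume eq: "iter_deriv {c..d} (order_N \<beta>) (I (\<lambda>s. f s - v * h s)) t =
      iter_deriv {c..d} (order_N \<beta>) (I f) t - v * iter_deriv {c..d} (order_N \<beta>) (I h) t"
    have R: "RL_left {c..d} c \<beta> F t = 1 / Gamma (real (order_N \<beta>) - \<beta>) * iter_deriv {c..d} (order_N \<beta>) (I F) t" for F
      by (simp only: RL_left_def I_def)
    show ?thesis unfolding R eq by (simp add: algebra_simps)
  qed
qed

lemma has_integral_RL_kernel_continuous: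
  assumes "0 < \<mu>" "continuous_on {c..d} f" "r \<in> {c..d}"
  shows "((\<lambda>s. (r - s) powr (\<mu> - 1) * f s) has_integral
      Gamma \<mu> * rl_int \<mu> (\<lambda>s. if s \<in> {c..d} then f s else 0) r) {c..r}"
proof -
  define f' where "f' = (\<lambda>s. if s \<in> {c..d} then f s else 0)"
  have mf: "f' \<in> borel_measurable borel"
    unfolding f'_def by (rule borel_measurable_continuous_on_if) (use assms in auto)
  have "bounded (f ` {c..d})" by (intro compact_imp_bounded compact_continuous_image assms(2)) simp
  then obtain C where "\<forall>x\<in>f ` {c..d}. norm x \<le> C" unfolding bounded_iff by blast
  then have C: "\<bar>f s\<bar> \<le> C" if "s \<in> {c..d}" for s using that by simp
  have C': "\<bar>f' s\<bar> \<le> \<bar>C\<bar>" for s using C[of s] by (auto simp: f'_def)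
  have "((\<lambda>s. (r - s) powr (\<mu> - 1) * f' s) has_integral Gamma \<mu> * rl_int \<mu> f' r) {c..r}"
    by (rule has_integral_rl_int[OF assms(1) integrable_rl_kernel_bounded(1)[OF assms(1) mf C', where a = c]])
      (auto simp: f'_def)
  then show ?thesis unfolding f'_def[symmetric]
    by (rule has_integral_eq[rotated]) (use assms(3) in \<open>auto simp: f'_def\<close>)
qed

text \<open>To the right of \<open>c\<close>, the function \<open>h\<close> is \<open>Gamma \<beta>\<close> times the fractional integral of the part of
\<open>g\<close> to the left of \<open>c\<close>. Subtracting it from \<open>f\<close> leaves the fractional integral with base point \<open>c\<close>
of the remaining part of \<open>g\<close>. The function \<open>\<rho>\<close> stands for any representative of \<open>g\<close>, such as
the Riemann-Liouville derivative on the whole interval.\<close>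

lemma RL_left_shifted_imp_integral_derivative:
  assumes "a < c" "c < b" "0 < \<beta>" "\<beta> \<notin> \<int>" and g: "integrable lborel g" "\<forall>s<a. g s = 0"
    and f: "AE t in lborel. t \<in> {a..b} \<longrightarrow> f t = rl_int \<beta> g t" and cont: "continuous_on {a..b} f"
    and \<rho>: "AE t in lborel. t \<in> {a..b} \<longrightarrow> \<rho> t = g t"
    and h: "h = (\<lambda>t. integral {a..c} (\<lambda>s. \<rho> s * (t - s) powr (\<beta> - 1)))"
    and t: "t \<in> {c..b}" and ex: "RL_left_exists {c..b} c \<beta> f t" "RL_left_exists {c..b} c \<beta> h t"
  shows "((\<lambda>x. integral {c..x} g) has_vector_derivative
     RL_left {c..b} c \<beta> f t - 1 / Gamma \<beta> * RL_left {c..b} c \<beta> h t) (at t within {c..b})"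
proof -
  define g1 where "g1 = (\<lambda>s. indicator {..c} s * g s)"
  define g2 where "g2 = (\<lambda>s. indicator {c<..} s * g s)"
  have G: "Gamma \<beta> \<noteq> 0" using Gamma_real_pos[OF assms(3)] by simp
  have g2: "integrable lborel g2" "\<forall>s<c. g2 s = 0"
    using g(1) integrable_mult_indicator[of "{c<..}" lborel g] by (auto simp: g2_def)
  have ae: "AE t in lborel. t \<in> {c..b} \<longrightarrow> f t - 1 / Gamma \<beta> * h t = rl_int \<beta> g2 t"
    using f rl_int_AE_integrable[OF assms(3) g] AE_lborel_singleton[of c]
  proof eventually_elim
    case (elim t)
    show ?case
    proof
      assume t: "t \<in> {c..b}"
      then have ct: "c < t" using elim(3) by auto
      have int1: "integrable lborel (\<lambda>s. rl_kernel \<beta> (t - s) * g1 s)" "integrable lborel (\<lambda>s. rl_kernel \<beta> (t - s) * g2 s)"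
        using integrable_mult_indicator[OF _ elim(2), of "{..c}"] integrable_mult_indicator[OF _ elim(2), of "{c<..}"]
        by (auto simp: g1_def g2_def mult.assoc mult.left_commute)
      have "rl_int \<beta> g t = (LBINT s. rl_kernel \<beta> (t - s) * g1 s + rl_kernel \<beta> (t - s) * g2 s)"
        unfolding rl_int_def by (rule Bochner_Integration.integral_cong) (auto simp: g1_def g2_def indicator_def)
      also have "\<dots> = rl_int \<beta> g1 t + rl_int \<beta> g2 t" using int1 by (simp add: rl_int_def)
      finally have sum: "rl_int \<beta> g t = rl_int \<beta> g1 t + rl_int \<beta> g2 t" .
      have "((\<lambda>s. (t - s) powr (\<beta> - 1) * g1 s) has_integral Gamma \<beta> * rl_int \<beta> g1 t) {a..t}"
        by (rule has_integral_rl_int[OF assms(3) int1(1)]) (use g in \<open>auto simp: g1_def\<close>)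
      also have "?this \<longleftrightarrow> ((\<lambda>s. if s \<in> {a..c} then (t - s) powr (\<beta> - 1) * g1 s else 0) has_integral Gamma \<beta> * rl_int \<beta> g1 t) {a..t}"
        by (rule has_integral_cong) (auto simp: g1_def)
      also have "\<dots> \<longleftrightarrow> ((\<lambda>s. (t - s) powr (\<beta> - 1) * g1 s) has_integral Gamma \<beta> * rl_int \<beta> g1 t) {a..c}"
        by (rule has_integral_restrict) (use ct in auto)
      also have "\<dots> \<longleftrightarrow> ((\<lambda>s. \<rho> s * (t - s) powr (\<beta> - 1)) has_integral Gamma \<beta> * rl_int \<beta> g1 t) {a..c}"
        by (rule has_integral_AE) (use \<rho> assms(2) in \<open>auto simp: g1_def elim!: eventually_mono\<close>)
      finally have "h t = Gamma \<beta> * rl_int \<beta> g1 t" unfolding h by (rule integral_unique)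
      then show "f t - 1 / Gamma \<beta> * h t = rl_int \<beta> g2 t" using sum elim(1) t assms(1) G by auto
    qed
  qed
  note N = order_N_bounds[OF assms(3,4)]
  have if': "(\<lambda>s. (r - s) powr (real (order_N \<beta>) - \<beta> - 1) * f s) integrable_on {c..r}" if "r \<in> {c..b}" for r
    using has_integral_RL_kernel_continuous[of "real (order_N \<beta>) - \<beta>" c b f r, THEN has_integral_integrable]
      N that continuous_on_subset[OF cont, of "{c..b}"] assms(1) by auto
  (* Nothing is known about h on its own; its integrability comes from that of f and of the difference. *)
  have ih': "(\<lambda>s. (r - s) powr (real (order_N \<beta>) - \<beta> - 1) * h s) integrable_on {c..r}" if "r \<in> {c..b}" for r
  proof -
    let ?k = "\<lambda>s. (r - s) powr (real (order_N \<beta>) - \<beta> - 1)"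
    have "(\<lambda>s. ?k s * (f s - 1 / Gamma \<beta> * h s)) integrable_on {c..r}"
      using has_integral_RL_kernel[OF assms(3) N(1) g2 ae that] by (rule has_integral_integrable)
    then have "(\<lambda>s. Gamma \<beta> * (?k s * f s - ?k s * (f s - 1 / Gamma \<beta> * h s))) integrable_on {c..r}"
      using if'[OF that] by (intro integrable_on_mult_right integrable_diff)
    moreover have "Gamma \<beta> * (?k s * f s - ?k s * (f s - 1 / Gamma \<beta> * h s)) = ?k s * h s" for s
      using G by (simp add: field_simps)
    ultimately show ?thesis by simp
  qed
  have lin: "RL_left_exists {c..b} c \<beta> (\<lambda>s. f s - 1 / Gamma \<beta> * h s) t"
    "RL_left {c..b} c \<beta> (\<lambda>s. f s - 1 / Gamma \<beta> * h s) t = RL_left {c..b} c \<beta> f t - 1 / Gamma \<beta> * RL_left {c..b} c \<beta> h t"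
    by (rule RL_left_linear[OF assms(2) t if' ih' ex]; assumption)+
  have "((\<lambda>x. integral {c..x} g2) has_vector_derivative RL_left {c..b} c \<beta> (\<lambda>s. f s - 1 / Gamma \<beta> * h s) t) (at t within {c..b})"
    by (rule RL_left_imp_integral_derivative[OF assms(2,3,4) g2 ae t lin(1)])
  moreover have "integral {c..x} g2 = integral {c..x} g" for x
    by (rule integral_spike[of "{c}"]) (auto simp: g2_def)
  ultimately show ?thesis unfolding lin(2) by simp
qed

section \<open>Right-sided operators and fractional integration by parts\<close>

lemma AE_lborel_reflect:
  assumes "AE x::real in lborel. P x"
  shows "AE x in lborel. P (- x)"
proof -
  obtain N where N: "N \<in> null_sets lborel" "{x \<in> space lborel. \<not> P x} \<subseteq> N"
    using assms unfolding eventually_ae_filter by blast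
  have "AE x in lborel. x \<notin> N" using N(1) by (rule AE_not_in)
  moreover have "Measurable.pred borel (\<lambda>x. x \<notin> N)" using N(1) by (auto simp: pred_def)
  ultimately have "AE x in lborel. 0 + (-1) * x \<notin> N" by (intro AE_borel_affine) auto
  then show ?thesis by (rule eventually_mono) (use N(2) in auto)
qed

text \<open>The Lebesgue integrable density is replaced by a Borel measurable one that vanishes outside the interval,
so that the convolution calculus on the whole line applies.\<close>

lemma RL_integral_range_leftE:
  assumes "0 < \<beta>" "f \<in> RL_integral_range_left a b \<beta>"
  obtains g where "integrable lborel g" "\<forall>s<a. g s = 0" "\<forall>s>b. g s = 0"
    "AE t in lborel. t \<in> {a..b} \<longrightarrow> f t = rl_int \<beta> g t"
proof -
  obtain g0 where g0: "g0 absolutely_integrable_on {a..b}" and f: "AE t in lborel. t \<in> {a..b} \<longrightarrow>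
      f t = 1 / Gamma \<beta> * integral {a..t} (\<lambda>s. (t - s) powr (\<beta> - 1) * g0 s)"
    using assms(2) unfolding RL_integral_range_left_def by blast
  have int0: "integrable lebesgue (\<lambda>s. indicator {a..b} s * g0 s)" using g0 by (simp add: set_integrable_def)
  then obtain g' where g' [measurable]: "g' \<in> borel_measurable borel"
    and ae: "AE s in lborel. indicator {a..b} s * g0 s = g' s"
    using completion_ex_borel_measurable_real[OF borel_measurable_integrable] by force
  have "integrable lebesgue g'"
    by (rule Bochner_Integration.integrable_cong_AE_imp[OF int0])
      (use ae in \<open>auto simp: AE_completion_iff measurable_completion\<close>)
  then have "integrable lborel g'" by (simp add: integrable_completion)
  define g where "g = (\<lambda>s. indicator {a..b} s * g' s)"
  have int: "integrable lborel g" unfolding g_def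
    using integrable_mult_indicator[OF _ \<open>integrable lborel g'\<close>, of "{a..b}"] by simp
  have z: "\<forall>s<a. g s = 0" "\<forall>s>b. g s = 0" by (auto simp: g_def)
  have gg: "AE s in lborel. s \<in> {a..b} \<longrightarrow> g s = g0 s" using ae by eventually_elim (auto simp: g_def)
  have G: "Gamma \<beta> \<noteq> 0" using Gamma_real_pos[OF assms(1)] by simp
  have "AE t in lborel. t \<in> {a..b} \<longrightarrow> f t = rl_int \<beta> g t"
    using f rl_int_AE_integrable[OF assms(1) int z(1)]
  proof eventually_elim
    case (elim t)
    show ?case
    proof
      assume t: "t \<in> {a..b}"
      have "((\<lambda>s. (t - s) powr (\<beta> - 1) * g s) has_integral Gamma \<beta> * rl_int \<beta> g t) {a..t}"
        by (rule has_integral_rl_int[OF assms(1) elim(2) z(1)])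
      also have "?this \<longleftrightarrow> ((\<lambda>s. (t - s) powr (\<beta> - 1) * g0 s) has_integral Gamma \<beta> * rl_int \<beta> g t) {a..t}"
        by (rule has_integral_AE) (use gg t in \<open>auto elim!: eventually_mono\<close>)
      finally have "integral {a..t} (\<lambda>s. (t - s) powr (\<beta> - 1) * g0 s) = Gamma \<beta> * rl_int \<beta> g t"
        by (rule integral_unique)
      then show "f t = rl_int \<beta> g t" using elim(1) t G by simp
    qed
  qed
  with int z show ?thesis by (rule that)
qed

lemma integral_reflect_Icc: "integral {- b..- a} (\<lambda>x. f (- x)) = integral {a..b::real} f" for f :: "real \<Rightarrow> real"
  by (rule Henstock_Kurzweil_Integration.integral_reflect_real)

lemma RL_integral_range_right_reflect:
  assumes "f \<in> RL_integral_range_right a b \<alpha>"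
  shows "(\<lambda>x. f (- x)) \<in> RL_integral_range_left (- b) (- a) \<alpha>"
proof -
  obtain g where g: "g absolutely_integrable_on {a..b}" and f: "AE t in lborel. t \<in> {a..b} \<longrightarrow>
      f t = 1 / Gamma \<alpha> * integral {t..b} (\<lambda>s. (s - t) powr (\<alpha> - 1) * g s)"
    using assms unfolding RL_integral_range_right_def by blast
  have "(\<lambda>x. g (- x)) absolutely_integrable_on {- b..- a}"
    using g by (simp add: absolutely_integrable_reflect_real)
  moreover have "AE t in lborel. t \<in> {- b..- a} \<longrightarrow>
      f (- t) = 1 / Gamma \<alpha> * integral {- b..t} (\<lambda>s. (t - s) powr (\<alpha> - 1) * g (- s))"
    using AE_lborel_reflect[OF f]
  proof eventually_elim
    case (elim t)
    have "integral {- b..- (- t)} (\<lambda>s. (- s - - t) powr (\<alpha> - 1) * g (- s)) = integral {- t..b} (\<lambda>s. (s - - t) powr (\<alpha> - 1) * g s)"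
      by (rule integral_reflect_Icc)
    then show ?case using elim by (auto simp: algebra_simps)
  qed
  ultimately show ?thesis unfolding RL_integral_range_left_def by blast
qed

lemma RL_integral_range_rightE:
  assumes "0 < \<alpha>" "f \<in> RL_integral_range_right a b \<alpha>"
  obtains g where "integrable lborel g" "\<forall>s<a. g s = 0" "\<forall>s>b. g s = 0"
    "AE t in lborel. t \<in> {a..b} \<longrightarrow> f t = rl_int_right \<alpha> g t"
proof -
  obtain g where g: "integrable lborel g" "\<forall>s<(- b). g s = 0" "\<forall>s>(- a). g s = 0"
    "AE t in lborel. t \<in> {- b..- a} \<longrightarrow> f (- t) = rl_int \<alpha> g t"
    using RL_integral_range_leftE[OF assms(1) RL_integral_range_right_reflect[OF assms(2)]] by blast
  show ?thesis
  proof (rule that[of "\<lambda>s. g (- s)"])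
    show "integrable lborel (\<lambda>s. g (- s))"
      using lborel_integrable_real_affine[OF g(1), of "-1" 0] by simp
    show "AE t in lborel. t \<in> {a..b} \<longrightarrow> f t = rl_int_right \<alpha> (\<lambda>s. g (- s)) t"
      using AE_lborel_reflect[OF g(4)] by eventually_elim (auto simp: rl_int_right_reflect)
  qed (use g in auto)
qed

text \<open>Equality of the values needs existence: where the derivative does not exist, the two sides are
unrelated default values.\<close>

lemma RL_right_reflect:
  assumes "c < d" "t \<in> {c..d}"
  shows "RL_right_exists {c..d} d \<alpha> f t \<longleftrightarrow> RL_left_exists {- d..- c} (- d) \<alpha> (\<lambda>x. f (- x)) (- t)"
    and "RL_right_exists {c..d} d \<alpha> f t \<Longrightarrow>
      RL_right {c..d} d \<alpha> f t = RL_left {- d..- c} (- d) \<alpha> (\<lambda>x. f (- x)) (- t)"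
proof -
  define N where "N = order_N \<alpha>"
  define \<Psi> where "\<Psi> = (\<lambda>r. integral {r..d} (\<lambda>s. (s - r) powr (real N - \<alpha> - 1) * f s))"
  define \<Phi> where "\<Phi> = (\<lambda>r. integral {- d..r} (\<lambda>s. (r - s) powr (real N - \<alpha> - 1) * f (- s)))"
  have eq: "\<Phi> = (\<lambda>x. \<Psi> (- x))"
  proof
    fix x
    have "integral {- d..- (- x)} (\<lambda>s. (- s - - x) powr (real N - \<alpha> - 1) * f (- s)) =
        integral {- x..d} (\<lambda>s. (s - - x) powr (real N - \<alpha> - 1) * f s)"
      by (rule integral_reflect_Icc)
    then show "\<Phi> x = \<Psi> (- x)" by (simp add: \<Phi>_def \<Psi>_def algebra_simps)
  qed
  have eq': "\<Psi> = (\<lambda>x. \<Phi> (- x))" by (simp add: eq)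
  have R: "RL_right_exists {c..d} d \<alpha> f t \<longleftrightarrow> iter_deriv_exists {c..d} N \<Psi> t"
      "RL_left_exists {- d..- c} (- d) \<alpha> (\<lambda>x. f (- x)) (- t) \<longleftrightarrow> iter_deriv_exists {- d..- c} N \<Phi> (- t)"
    unfolding RL_right_exists_def RL_left_exists_def \<Phi>_def \<Psi>_def N_def by simp_all
  have 1: "iter_deriv_exists {- d..- c} N \<Phi> (- t) \<and> iter_deriv {- d..- c} N \<Phi> (- t) = (- 1) ^ N * iter_deriv {c..d} N \<Psi> t"
    if "iter_deriv_exists {c..d} N \<Psi> t"
    unfolding eq by (rule iter_deriv_reflect[OF assms(1) that assms(2)])
  have 2: "iter_deriv_exists {c..d} N \<Psi> t" if "iter_deriv_exists {- d..- c} N \<Phi> (- t)"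
    using iter_deriv_reflect[of "- d" "- c" N \<Phi> "- t"] that assms unfolding eq' by simp
  show "RL_right_exists {c..d} d \<alpha> f t \<longleftrightarrow> RL_left_exists {- d..- c} (- d) \<alpha> (\<lambda>x. f (- x)) (- t)"
    unfolding R using 1 2 by blast
  show "RL_right {c..d} d \<alpha> f t = RL_left {- d..- c} (- d) \<alpha> (\<lambda>x. f (- x)) (- t)"
    if "RL_right_exists {c..d} d \<alpha> f t"
    using 1 that unfolding R(1) RL_right_def RL_left_def N_def[symmetric] \<Phi>_def[symmetric] \<Psi>_def[symmetric] by simp
qed

lemma integral_derivative_reflect:
  assumes "g integrable_on {c..d}" "t \<in> {c..d}"
    and D: "((\<lambda>x. integral {- d..x} (\<lambda>s. g (- s))) has_vector_derivative V) (at (- t) within {- d..- c})"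
  shows "((\<lambda>x. integral {c..x} g) has_vector_derivative (V :: real)) (at t within {c..d})"
proof -
  have "uminus ` {c..d} = {- d..- c}" by (simp add: image_uminus_atLeastAtMost)
  then have "((\<lambda>x. integral {- d..x} (\<lambda>s. g (- s))) has_vector_derivative V) (at (- t) within uminus ` {c..d})"
    using D by simp
  moreover have "(uminus has_vector_derivative (- 1 :: real)) (at t within {c..d})"
    by (auto intro!: derivative_eq_intros)
  ultimately have "((\<lambda>x. integral {- d..x} (\<lambda>s. g (- s))) \<circ> uminus has_vector_derivative (- 1) *\<^sub>R V) (at t within {c..d})"
    by (intro vector_diff_chain_within)
  then have "((\<lambda>x. integral {c..d} g - integral {- d..- x} (\<lambda>s. g (- s))) has_vector_derivative 0 - - V) (at t within {c..d})"
    by (intro has_vector_derivative_diff has_vector_derivative_const) (simp add: o_def)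
  then have *: "((\<lambda>x. integral {c..d} g - integral {- d..- x} (\<lambda>s. g (- s))) has_vector_derivative V) (at t within {c..d})"
    by simp
  show ?thesis
  proof (rule has_vector_derivative_transform[OF assms(2) _ *])
    fix x assume x: "x \<in> {c..d}"
    have "integral {c..x} g + integral {x..d} g = integral {c..d} g"
      by (rule Henstock_Kurzweil_Integration.integral_combine) (use x assms(1) in auto)
    then show "integral {c..x} g = integral {c..d} g - integral {- d..- x} (\<lambda>s. g (- s))"
      by (simp add: integral_reflect_Icc)
  qed
qed

lemma integrable_on_Icc_of_lborel: "integrable lborel g \<Longrightarrow> g integrable_on {c..d::real}" for g :: "real \<Rightarrow> real"
  by (rule integrable_on_subinterval[OF has_integral_integrable[OF has_integral_integral_lborel]]) auto

lemma AE_rl_int_right_reflect: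
  assumes "AE t in lborel. t \<in> {c..d} \<longrightarrow> f t = rl_int_right \<alpha> g t"
  shows "AE t in lborel. t \<in> {- d..- c} \<longrightarrow> f (- t) = rl_int \<alpha> (\<lambda>s. g (- s)) t"
  using AE_lborel_reflect[OF assms] by eventually_elim (auto simp: rl_int_right_reflect)

lemma RL_right_imp_integral_derivative:
  assumes "c < d" "0 < \<alpha>" "\<alpha> \<notin> \<int>" and g: "integrable lborel g" "\<forall>s>d. g s = 0"
    and f: "AE t in lborel. t \<in> {c..d} \<longrightarrow> f t = rl_int_right \<alpha> g t" and t: "t \<in> {c..d}"
    and ex: "RL_right_exists {c..d} d \<alpha> f t"
  shows "((\<lambda>x. integral {c..x} g) has_vector_derivative RL_right {c..d} d \<alpha> f t) (at t within {c..d})"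
proof (rule integral_derivative_reflect[OF integrable_on_Icc_of_lborel[OF g(1)] t])
  have "integrable lborel (\<lambda>s. g (- s))" using lborel_integrable_real_affine[OF g(1), of "-1" 0] by simp
  then show "((\<lambda>x. integral {- d..x} (\<lambda>s. g (- s))) has_vector_derivative RL_right {c..d} d \<alpha> f t) (at (- t) within {- d..- c})"
    unfolding RL_right_reflect(2)[OF assms(1) t ex] using assms(1) t ex g(2) RL_right_reflect(1)[OF assms(1) t]
    by (intro RL_left_imp_integral_derivative assms(2,3) AE_rl_int_right_reflect[OF f]) auto
qed

lemma RL_right_ae_eq:
  assumes "c < d" "0 < \<alpha>" "\<alpha> \<notin> \<int>" and g: "integrable lborel g" "\<forall>s>d. g s = 0"
    and f: "AE t in lborel. t \<in> {c..d} \<longrightarrow> f t = rl_int_right \<alpha> g t"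
  shows "AE t in lborel. t \<in> {c..d} \<longrightarrow> RL_right {c..d} d \<alpha> f t = g t"
proof -
  have "integrable lborel (\<lambda>s. g (- s))" using lborel_integrable_real_affine[OF g(1), of "-1" 0] by simp
  then have "AE t in lborel. t \<in> {- d..- c} \<longrightarrow> RL_left_exists {- d..- c} (- d) \<alpha> (\<lambda>x. f (- x)) t \<and>
     RL_left {- d..- c} (- d) \<alpha> (\<lambda>x. f (- x)) t = g (- t)"
    using assms(1) g(2) by (intro RL_left_ae_eq assms(2,3) AE_rl_int_right_reflect[OF f]) auto
  from AE_lborel_reflect[OF this] show ?thesis
    by eventually_elim (auto simp: RL_right_reflect[OF assms(1)])
qed

lemma RL_right_shifted_imp_integral_derivative:
  assumes "a < c" "c < b" "0 < \<alpha>" "\<alpha> \<notin> \<int>" and g: "integrable lborel g" "\<forall>s>b. g s = 0"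
    and f: "AE t in lborel. t \<in> {a..b} \<longrightarrow> f t = rl_int_right \<alpha> g t" and cont: "continuous_on {a..b} f"
    and \<rho>: "AE t in lborel. t \<in> {a..b} \<longrightarrow> \<rho> t = g t"
    and h: "h = (\<lambda>t. integral {c..b} (\<lambda>s. \<rho> s * (s - t) powr (\<alpha> - 1)))"
    and t: "t \<in> {a..c}" and ex: "RL_right_exists {a..c} c \<alpha> f t" "RL_right_exists {a..c} c \<alpha> h t"
  shows "((\<lambda>x. integral {a..x} g) has_vector_derivative
     RL_right {a..c} c \<alpha> f t - 1 / Gamma \<alpha> * RL_right {a..c} c \<alpha> h t) (at t within {a..c})"
proof (rule integral_derivative_reflect[OF integrable_on_Icc_of_lborel[OF g(1)] t])
  have ig: "integrable lborel (\<lambda>s. g (- s))" using lborel_integrable_real_affine[OF g(1), of "-1" 0] by simp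
  have \<rho>': "AE t in lborel. t \<in> {- b..- a} \<longrightarrow> \<rho> (- t) = g (- t)"
    using AE_lborel_reflect[OF \<rho>] by eventually_elim auto
  have h': "(\<lambda>x. h (- x)) = (\<lambda>t. integral {- b..- c} (\<lambda>s. \<rho> (- s) * (t - s) powr (\<alpha> - 1)))"
  proof
    fix x
    have "integral {- b..- c} (\<lambda>s. \<rho> (- s) * (- s - - x) powr (\<alpha> - 1)) = integral {c..b} (\<lambda>s. \<rho> s * (s - - x) powr (\<alpha> - 1))"
      by (rule integral_reflect_Icc)
    then show "h (- x) = integral {- b..- c} (\<lambda>s. \<rho> (- s) * (x - s) powr (\<alpha> - 1))" by (simp add: h algebra_simps)
  qed
  have cont': "continuous_on {- b..- a} (\<lambda>x. f (- x))"
    by (rule continuous_on_compose2[OF cont]) (auto intro!: continuous_intros)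
  show "((\<lambda>x. integral {- c..x} (\<lambda>s. g (- s))) has_vector_derivative
     RL_right {a..c} c \<alpha> f t - 1 / Gamma \<alpha> * RL_right {a..c} c \<alpha> h t) (at (- t) within {- c..- a})"
    unfolding RL_right_reflect(2)[OF assms(1) t ex(1)] RL_right_reflect(2)[OF assms(1) t ex(2)]
    by (rule RL_left_shifted_imp_integral_derivative[OF _ _ assms(3,4) ig _ AE_rl_int_right_reflect[OF f] cont' \<rho>' h'])
      (use assms(1,2) t ex g(2) RL_right_reflect(1)[OF assms(1) t] in auto)
qed

lemma integrable_truncate:
  assumes "continuous_on {a..b::real} f"
  shows "integrable lborel (\<lambda>s. if s \<in> {a..b} then f s else (0 :: real))"
proof -
  have "integrable lborel (\<lambda>s. indicator {a..b} s * f s)"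
    using borel_integrable_atLeastAtMost'[OF assms] by (simp add: set_integrable_def)
  moreover have "(\<lambda>s. indicator {a..b} s * f s) = (\<lambda>s. if s \<in> {a..b} then f s else 0)"
    by (auto simp: indicator_def fun_eq_iff)
  ultimately show ?thesis by simp
qed

text \<open>The fundamental theorem of calculus, iterated: a function whose first \<open>n\<close> derivatives vanish at \<open>a\<close>
is the \<open>n\<close>-fold integral of its \<open>n\<close>-th derivative. The latter may be cut off outside the interval, as
the integral at \<open>s\<close> depends on values to the left of \<open>s\<close> only.\<close>

lemma rl_int_jet:
  assumes "1 \<le> n" and "\<And>p t. p < n \<Longrightarrow> t \<in> {a..b} \<Longrightarrow> (e p has_vector_derivative e (Suc p) t) (at t within {a..b})"
    and "continuous_on {a..b} (e n)" and "\<And>p. p < n \<Longrightarrow> e p a = 0" and "s \<in> {a..b}"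
  shows "rl_int (real n) (\<lambda>s. if s \<in> {a..b} then e n s else 0) s = e 0 s"
  using assms
proof (induction n arbitrary: s rule: dec_induct)
  case base
  have z: "\<forall>r<a. (if r \<in> {a..b} then e 1 r else 0) = 0" by simp
  have "((\<lambda>s. if s \<in> {a..b} then e 1 s else 0) has_integral rl_int 1 (\<lambda>s. if s \<in> {a..b} then e 1 s else 0) s) {a..s}"
    by (rule has_integral_rl_int_1[OF integrable_rl_kernel_mult[OF _ integrable_truncate[OF base(2)] z] z]) simp
  moreover have "(e 1 has_integral e 0 s - e 0 a) {a..s}"
  proof (rule fundamental_theorem_of_calculus)
    fix x assume "x \<in> {a..s}"
    then show "(e 0 has_vector_derivative e 1 x) (at x within {a..s})"
      using base(1)[of 0 x] base(4) by (auto intro: has_vector_derivative_within_subset)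
  qed (use base(4) in auto)
  then have "((\<lambda>s. if s \<in> {a..b} then e 1 s else 0) has_integral e 0 s - e 0 a) {a..s}"
    by (rule has_integral_eq[rotated]) (use base(4) in auto)
  ultimately have "rl_int 1 (\<lambda>s. if s \<in> {a..b} then e 1 s else 0) s = e 0 s - e 0 a" by (rule has_integral_unique)
  then show ?case using base(3)[of 0] by simp
next
  case (step n)
  let ?E = "\<lambda>p s. if s \<in> {a..b} then e p s else 0"
  have cont: "continuous_on {a..b} (e n)"
    using step.prems(1)[of n] has_vector_derivative_continuous
    by (force simp: continuous_on_eq_continuous_within)
  have z: "\<forall>r<a. ?E p r = 0" for p by simp
  have one: "rl_int 1 (?E (Suc n)) r = ?E n r" if "r < s" for r
  proof (cases "a \<le> r")
    case True
    then have r: "r \<in> {a..b}" using that step.prems(4) by auto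
    have "((?E (Suc n)) has_integral rl_int 1 (?E (Suc n)) r) {a..r}"
      by (rule has_integral_rl_int_1[OF integrable_rl_kernel_mult[OF _ integrable_truncate[OF step.prems(2)] z] z]) simp
    moreover have "(e (Suc n) has_integral e n r - e n a) {a..r}"
    proof (rule fundamental_theorem_of_calculus)
      fix x assume "x \<in> {a..r}"
      then show "(e n has_vector_derivative e (Suc n) x) (at x within {a..r})"
        using step.prems(1)[of n x] r by (auto intro: has_vector_derivative_within_subset)
    qed (use r in auto)
    then have "(?E (Suc n) has_integral e n r - e n a) {a..r}"
      by (rule has_integral_eq[rotated]) (use r in auto)
    ultimately have "rl_int 1 (?E (Suc n)) r = e n r - e n a" by (rule has_integral_unique)
    then show ?thesis using step.prems(3)[of n] r by simp
  next
    case False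
    then show ?thesis using rl_int_eq_0[of r "?E (Suc n)" 1] by simp
  qed
  have "rl_int (real (Suc n)) (?E (Suc n)) s = rl_int (real n + 1) (?E (Suc n)) s" by (simp add: add.commute)
  also have "\<dots> = rl_int (real n) (rl_int 1 (?E (Suc n))) s"
    by (rule rl_int_semigroup(2)[symmetric, OF _ _ _ integrable_truncate[OF step.prems(2)] z]) (use step.hyps in auto)
  also have "\<dots> = rl_int (real n) (?E n) s" by (rule rl_int_cong) (rule one)
  also have "\<dots> = e 0 s" by (rule step.IH) (use step.prems cont in auto)
  finally show ?case .
qed

text \<open>The right fractional integral \<open>f\<close> of \<open>g\<close>, tested against the left Caputo derivative of \<open>e 0\<close>, is by
adjointness \<open>g\<close> tested against the integral of order \<open>\<alpha> + (N - \<alpha>)\<close> of \<open>e N\<close>. By \<open>rl_int_jet\<close>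
that integral is \<open>e 0\<close>: no boundary terms appear, and no derivative falls on \<open>f\<close>.\<close>

lemma fractional_integration_by_parts:
  assumes "a < b" "0 < \<alpha>" "\<alpha> < real N" and g: "integrable lborel g" "\<forall>s<a. g s = 0" "\<forall>s>b. g s = 0"
    and f: "AE t in lborel. t \<in> {a..b} \<longrightarrow> f t = rl_int_right \<alpha> g t"
    and e: "\<And>p t. p < N \<Longrightarrow> t \<in> {a..b} \<Longrightarrow> (e p has_vector_derivative e (Suc p) t) (at t within {a..b})"
      "continuous_on {a..b} (e N)" "\<And>p. p < N \<Longrightarrow> e p a = 0"
  shows "((\<lambda>t. f t * (1 / Gamma (real N - \<alpha>) * integral {a..t} (\<lambda>s. (t - s) powr (real N - \<alpha> - 1) * e N s)))
      has_integral integral {a..b} (\<lambda>s. g s * e 0 s)) {a..b}"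
    and "(\<lambda>s. g s * e 0 s) integrable_on {a..b}"
proof -
  have N: "1 \<le> N" using assms(2,3) by (cases N) auto
  define \<mu> where "\<mu> = real N - \<alpha>"
  have \<mu>: "0 < \<mu>" using assms(3) by (simp add: \<mu>_def)
  have G: "Gamma \<mu> \<noteq> 0" using Gamma_real_pos[OF \<mu>] by simp
  define E where "E = (\<lambda>s. if s \<in> {a..b} then e N s else 0)"
  have Ez: "\<forall>s<a. E s = 0" by (simp add: E_def)
  have Eint: "integrable lborel E" unfolding E_def by (rule integrable_truncate[OF e(2)])
  have [measurable]: "E \<in> borel_measurable borel" using Eint by auto
  have "bounded (e N ` {a..b})" by (intro compact_imp_bounded compact_continuous_image e(2)) simp
  then obtain C where "\<forall>x\<in>e N ` {a..b}. norm x \<le> C" unfolding bounded_iff by blast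
  then have "\<bar>e N s\<bar> \<le> C" if "s \<in> {a..b}" for s using that by simp
  then have C: "\<bar>E s\<bar> \<le> \<bar>C\<bar>" for s by (cases "s \<in> {a..b}") (force simp: E_def)+
  define \<phi> where "\<phi> = (\<lambda>t. if t \<in> {a..b} then rl_int \<mu> E t else 0)"
  have [measurable]: "\<phi> \<in> borel_measurable borel" unfolding \<phi>_def by measurable
  define M where "M = \<bar>C\<bar> * ((b - a) powr \<mu> / Gamma (\<mu> + 1))"
  have M: "\<bar>\<phi> t\<bar> \<le> \<bar>M\<bar>" for t
  proof (cases "t \<in> {a..b}")
    case True
    have "\<bar>rl_int \<mu> E t\<bar> \<le> (LBINT s. \<bar>rl_kernel \<mu> (t - s) * E s\<bar>)"
      unfolding rl_int_def by (rule integral_abs_bound)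
    also have "\<dots> \<le> \<bar>C\<bar> * ((t - a) powr \<mu> / Gamma (\<mu> + 1))"
      by (rule integrable_rl_kernel_bounded(2)[OF \<mu> _ C Ez]) (use True in auto)
    also have "\<dots> \<le> M" unfolding M_def using True \<mu>
      by (intro mult_left_mono divide_right_mono powr_mono2) (auto simp: Gamma_real_pos less_imp_le)
    finally show ?thesis using True by (simp add: \<phi>_def)
  next
    case False
    then show ?thesis unfolding \<phi>_def if_not_P[OF False] by simp
  qed
  have \<phi>z: "\<forall>t<a. \<phi> t = 0" by (simp add: \<phi>_def)
  note adj = rl_int_adjoint[OF assms(2) g(1,3) \<open>\<phi> \<in> borel_measurable borel\<close> M \<phi>z]
  have ge: "g s * rl_int \<alpha> \<phi> s = (if s \<in> {a..b} then g s * e 0 s else 0)" for s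
  proof (cases "s \<in> {a..b}")
    case True
    have "rl_int \<alpha> \<phi> s = rl_int \<alpha> (rl_int \<mu> E) s"
    proof (rule rl_int_cong)
      fix r assume "r < s"
      then show "\<phi> r = rl_int \<mu> E r" using True Ez rl_int_eq_0[of r E \<mu>] by (auto simp: \<phi>_def)
    qed
    also have "\<dots> = rl_int (\<alpha> + \<mu>) E s"
      by (rule rl_int_semigroup(2)[OF assms(2) \<mu> _ Eint Ez]) (use N in \<open>auto simp: \<mu>_def\<close>)
    also have "\<dots> = rl_int (real N) E s" by (simp add: \<mu>_def)
    also have "\<dots> = e 0 s" unfolding E_def by (rule rl_int_jet[OF N e True])
    finally show ?thesis using True by simp
  next
    case False
    then show ?thesis using g(2,3) by auto
  qed
  have "((\<lambda>s. g s * rl_int \<alpha> \<phi> s) has_integral (LBINT s. g s * rl_int \<alpha> \<phi> s)) UNIV"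
    by (rule has_integral_integral_lborel[OF adj(2)])
  then have R: "((\<lambda>s. g s * e 0 s) has_integral (LBINT s. g s * rl_int \<alpha> \<phi> s)) {a..b}"
    unfolding ge has_integral_restrict_UNIV .
  then show "(\<lambda>s. g s * e 0 s) integrable_on {a..b}" by blast
  have "((\<lambda>t. rl_int_right \<alpha> g t * \<phi> t) has_integral (LBINT t. rl_int_right \<alpha> g t * \<phi> t)) UNIV"
    by (rule has_integral_integral_lborel[OF adj(1)])
  moreover have "(\<lambda>t. rl_int_right \<alpha> g t * \<phi> t) = (\<lambda>t. if t \<in> {a..b} then rl_int_right \<alpha> g t * rl_int \<mu> E t else 0)"
    by (auto simp: \<phi>_def)
  ultimately have "((\<lambda>t. rl_int_right \<alpha> g t * rl_int \<mu> E t) has_integral (LBINT t. rl_int_right \<alpha> g t * \<phi> t)) {a..b}"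
    by (simp only: has_integral_restrict_UNIV)
  also have "(LBINT t. rl_int_right \<alpha> g t * \<phi> t) = integral {a..b} (\<lambda>s. g s * e 0 s)"
    using adj(3) integral_unique[OF R] by simp
  also have "((\<lambda>t. rl_int_right \<alpha> g t * rl_int \<mu> E t) has_integral integral {a..b} (\<lambda>s. g s * e 0 s)) {a..b} \<longleftrightarrow>
    ((\<lambda>t. f t * rl_int \<mu> E t) has_integral integral {a..b} (\<lambda>s. g s * e 0 s)) {a..b}"
    by (rule has_integral_AE) (use f in \<open>auto elim!: eventually_mono\<close>)
  also have "\<dots> \<longleftrightarrow> ((\<lambda>t. f t * (1 / Gamma \<mu> * integral {a..t} (\<lambda>s. (t - s) powr (\<mu> - 1) * e N s)))
      has_integral integral {a..b} (\<lambda>s. g s * e 0 s)) {a..b}"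
  proof (rule has_integral_cong)
    fix t assume t: "t \<in> {a..b}"
    have "((\<lambda>s. (t - s) powr (\<mu> - 1) * e N s) has_integral Gamma \<mu> * rl_int \<mu> E t) {a..t}"
      unfolding E_def by (rule has_integral_RL_kernel_continuous[OF \<mu> e(2) t])
    then show "f t * rl_int \<mu> E t = f t * (1 / Gamma \<mu> * integral {a..t} (\<lambda>s. (t - s) powr (\<mu> - 1) * e N s))"
      using G by (simp add: integral_unique)
  qed
  finally show "((\<lambda>t. f t * (1 / Gamma (real N - \<alpha>) * integral {a..t} (\<lambda>s. (t - s) powr (real N - \<alpha> - 1) * e N s)))
      has_integral integral {a..b} (\<lambda>s. g s * e 0 s)) {a..b}" unfolding \<mu>_def .
qed

lemma fractional_integration_by_parts_right:
  assumes "a < b" "0 < \<beta>" "\<beta> < real N" and g: "integrable lborel g" "\<forall>s<a. g s = 0" "\<forall>s>b. g s = 0"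
    and f: "AE t in lborel. t \<in> {a..b} \<longrightarrow> f t = rl_int \<beta> g t"
    and e: "\<And>p t. p < N \<Longrightarrow> t \<in> {a..b} \<Longrightarrow> (e p has_vector_derivative e (Suc p) t) (at t within {a..b})"
      "continuous_on {a..b} (e N)" "\<And>p. p < N \<Longrightarrow> e p b = 0"
  shows "((\<lambda>t. f t * (1 / Gamma (real N - \<beta>) * integral {t..b} (\<lambda>s. (s - t) powr (real N - \<beta> - 1) * ((- 1) ^ N * e N s))))
      has_integral integral {a..b} (\<lambda>s. g s * e 0 s)) {a..b}"
    and "(\<lambda>s. g s * e 0 s) integrable_on {a..b}"
proof -
  define e' where "e' = (\<lambda>p x. (- 1) ^ p * e p (- x))"
  have ig: "integrable lborel (\<lambda>s. g (- s))" using lborel_integrable_real_affine[OF g(1), of "-1" 0] by simp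
  have f': "AE t in lborel. t \<in> {- b..- a} \<longrightarrow> f (- t) = rl_int_right \<beta> (\<lambda>s. g (- s)) t"
    using AE_lborel_reflect[OF f] by eventually_elim (auto simp: rl_int_right_reflect)
  have im: "uminus ` {- b..- a} = {a..b}" by (simp add: image_uminus_atLeastAtMost)
  have d: "(e' p has_vector_derivative e' (Suc p) t) (at t within {- b..- a})" if "p < N" "t \<in> {- b..- a}" for p t
  proof -
    have "(e p has_vector_derivative e (Suc p) (- t)) (at (- t) within uminus ` {- b..- a})"
      unfolding im using e(1)[of p "- t"] that by auto
    moreover have "(uminus has_vector_derivative (- 1 :: real)) (at t within {- b..- a})"
      by (auto intro!: derivative_eq_intros)
    ultimately have "(e p \<circ> uminus has_vector_derivative (- 1) *\<^sub>R e (Suc p) (- t)) (at t within {- b..- a})"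
      by (intro vector_diff_chain_within)
    then have "((\<lambda>x. (- 1) ^ p * e p (- x)) has_vector_derivative (- 1) ^ p * (- e (Suc p) (- t))) (at t within {- b..- a})"
      by (intro has_vector_derivative_mult_right) (simp add: o_def)
    then show ?thesis by (simp add: e'_def)
  qed
  have c: "continuous_on {- b..- a} (e' N)" unfolding e'_def
    by (intro continuous_intros continuous_on_compose2[OF e(2)]) auto
  have g': "\<forall>s<(- b). g (- s) = 0" "\<forall>s>(- a). g (- s) = 0" using g by auto
  have z: "e' p (- b) = 0" if "p < N" for p using e(3)[OF that] by (simp add: e'_def)
  have ab: "- b < - a" using assms(1) by simp
  note P = fractional_integration_by_parts[OF ab assms(2,3) ig g' f' d c z]
  have "(\<lambda>s. (\<lambda>s. g s * e 0 s) (- s)) integrable_on {- b..- a}" using P(2) by (simp add: e'_def)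
  then show "(\<lambda>s. g s * e 0 s) integrable_on {a..b}" by (rule iffD1[OF Henstock_Kurzweil_Integration.integrable_reflect_real[where f = "\<lambda>s. g s * e 0 s"]])
  have eqi: "integral {- b..- a} (\<lambda>s. g (- s) * e' 0 s) = integral {a..b} (\<lambda>s. g s * e 0 s)"
    using integral_reflect_Icc[of b a "\<lambda>s. g s * e 0 s"] by (simp add: e'_def)
  have inner: "integral {- b..t} (\<lambda>s. (t - s) powr (real N - \<beta> - 1) * e' N s) =
     integral {- t..b} (\<lambda>s. (s - - t) powr (real N - \<beta> - 1) * ((- 1) ^ N * e N s))" for t
    using integral_reflect_Icc[of b "- t" "\<lambda>s. (s - - t) powr (real N - \<beta> - 1) * ((- 1) ^ N * e N s)"]
    by (simp add: e'_def algebra_simps)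
  have "((\<lambda>t. (\<lambda>t. f t * (1 / Gamma (real N - \<beta>) * integral {t..b} (\<lambda>s. (s - t) powr (real N - \<beta> - 1) * ((- 1) ^ N * e N s)))) (- t))
      has_integral integral {a..b} (\<lambda>s. g s * e 0 s)) {- b..- a}"
    using P(1) unfolding eqi inner by simp
  then show "((\<lambda>t. f t * (1 / Gamma (real N - \<beta>) * integral {t..b} (\<lambda>s. (s - t) powr (real N - \<beta> - 1) * ((- 1) ^ N * e N s))))
      has_integral integral {a..b} (\<lambda>s. g s * e 0 s)) {a..b}"
    by (rule iffD1[OF has_integral_reflect_real])
qed

section \<open>The chain rule in the slots and the first variation\<close>

text \<open>Arguments of \<open>L\<close> do not form a normed space, so that the chain rule is proved by induction on the set
\<open>B\<close> of slots that move. In the induction step the new slot gets a parameter of its own, and a function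
of two variables with one partial derivative continuous is differentiated along the diagonal.\<close>

lemma chain_rule_some_slots:
  assumes L: "has_continuous_partials I A L" and "convex U"
    and z: "\<And>\<sigma> \<theta>. \<sigma> \<in> A \<Longrightarrow> \<theta> \<in> U \<Longrightarrow> z \<sigma> + \<theta> * d \<sigma> \<in> slot_range I \<sigma>"
    and "finite B" "B \<subseteq> A" "w \<in> lagrangian_domain I A" "\<theta> \<in> U"
  shows "((\<lambda>\<theta>. L (\<lambda>\<sigma>. if \<sigma> \<in> B then z \<sigma> + \<theta> * d \<sigma> else w \<sigma>)) has_real_derivative
     (\<Sum>s\<in>B. d s * partial I s L (\<lambda>\<sigma>. if \<sigma> \<in> B then z \<sigma> + \<theta> * d \<sigma> else w \<sigma>))) (at \<theta> within U)"
  using assms(4-6)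
proof (induction B arbitrary: w rule: finite_induct)
  case empty
  then show ?case by simp
next
  case (insert s B)
  define p where "p = (\<lambda>x y \<sigma>. if \<sigma> \<in> B then z \<sigma> + x * d \<sigma> else if \<sigma> = s then z s + y * d s else w \<sigma>)"
  have s: "s \<in> A" "s \<notin> B" "B \<subseteq> A" using insert by auto
  have w: "w \<sigma> \<in> slot_range I \<sigma>" if "\<sigma> \<in> A" for \<sigma>
    using insert.prems(2) that by (auto simp: lagrangian_domain_def)
  have pD: "p x y \<in> lagrangian_domain I A" if "x \<in> U" "y \<in> U" for x y
    using z[OF _ that(1)] z[OF _ that(2)] w insert.prems(2) s
    by (auto simp: lagrangian_domain_def p_def PiE_iff extensional_def)
  have peq: "p x y = (\<lambda>\<sigma>. if \<sigma> \<in> B then z \<sigma> + x * d \<sigma> else (w(s := z s + y * d s)) \<sigma>)" for x y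
    by (auto simp: p_def fun_eq_iff)
  have pdiag: "p x x = (\<lambda>\<sigma>. if \<sigma> \<in> insert s B then z \<sigma> + x * d \<sigma> else w \<sigma>)" for x
    using s by (auto simp: p_def fun_eq_iff)
  have wD: "w(s := z s + \<theta> * d s) \<in> lagrangian_domain I A"
    using insert.prems z[OF s(1) assms(7)] s by (auto simp: lagrangian_domain_def PiE_iff extensional_def)
  have fx: "((\<lambda>x. L (p x \<theta>)) has_derivative (*) (\<Sum>r\<in>B. d r * partial I r L (p \<theta> \<theta>))) (at \<theta> within U)"
    using insert.IH[OF s(3) wD] unfolding peq[of _ \<theta>] by (simp add: has_field_derivative_def)
  have fy: "((\<lambda>y. L (p x y)) has_derivative blinfun_apply (blinfun_mult_right (d s * partial I s L (p x y)))) (at y within U)"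
    if "x \<in> U" "y \<in> U" for x y
  proof -
    have ps: "p x y s = z s + y * d s" using s by (simp add: p_def)
    have up: "(p x y)(s := u) = (p x 0)(s := u)" for u using s by (auto simp: p_def fun_eq_iff)
    have py: "p x y = (p x 0)(s := z s + y * d s)" for y using s by (auto simp: p_def fun_eq_iff)
    have "(\<lambda>u. L ((p x y)(s := u))) differentiable (at (p x y s) within slot_range I s)"
      using L s(1) pD[OF that] by (auto simp: has_continuous_partials_def)
    then have "((\<lambda>u. L ((p x 0)(s := u))) has_vector_derivative partial I s L (p x y)) (at (z s + y * d s) within slot_range I s)"
      unfolding partial_def vector_derivative_works up ps by simp
    then have "((\<lambda>u. L ((p x 0)(s := u))) has_vector_derivative partial I s L (p x y))
       (at (z s + y * d s) within (\<lambda>y. z s + y * d s) ` U)"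
      by (rule has_vector_derivative_within_subset) (use z[OF s(1)] in auto)
    moreover have "((\<lambda>y. z s + y * d s) has_vector_derivative d s) (at y within U)"
      by (auto intro!: derivative_eq_intros simp: has_vector_derivative_def)
    ultimately have "((\<lambda>u. L ((p x 0)(s := u))) \<circ> (\<lambda>y. z s + y * d s) has_vector_derivative d s *\<^sub>R partial I s L (p x y)) (at y within U)"
      by (intro vector_diff_chain_within)
    then have "((\<lambda>y. L (p x y)) has_real_derivative d s * partial I s L (p x y)) (at y within U)"
      unfolding o_def py[symmetric] by (simp add: has_real_derivative_iff_has_vector_derivative)
    then show ?thesis by (simp add: has_field_derivative_def blinfun_mult_right.rep_eq)
  qed
  have cp: "continuous_on (U \<times> U) (\<lambda>(x, y). p x y)"
    unfolding p_def split_beta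
  proof (rule continuous_on_coordinatewise_then_product)
    fix \<sigma>
    show "continuous_on (U \<times> U) (\<lambda>q. if \<sigma> \<in> B then z \<sigma> + fst q * d \<sigma> else if \<sigma> = s then z s + snd q * d s else w \<sigma>)"
      by (cases "\<sigma> \<in> B"; cases "\<sigma> = s") (auto intro!: continuous_intros)
  qed
  have "continuous_on (U \<times> U) (\<lambda>q. partial I s L ((\<lambda>(x, y). p x y) q))"
    by (rule continuous_on_compose2[OF _ cp, of "lagrangian_domain I A"])
      (use L s(1) pD in \<open>auto simp: has_continuous_partials_def\<close>)
  then have "continuous_on (U \<times> U) (\<lambda>(x, y). blinfun_mult_right (d s * partial I s L (p x y)))"
    unfolding split_beta by (intro bounded_linear.continuous_on[OF bounded_linear_blinfun_mult_right] continuous_intros)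
  then have cont: "continuous (at (\<theta>, \<theta>) within U \<times> U) (\<lambda>(x, y). blinfun_mult_right (d s * partial I s L (p x y)))"
    using assms(7) by (auto simp: continuous_on_eq_continuous_within)
  have "((\<lambda>(x, y). L (p x y)) has_derivative (\<lambda>(tx, ty). (\<Sum>r\<in>B. d r * partial I r L (p \<theta> \<theta>)) * tx +
      blinfun_apply (blinfun_mult_right (d s * partial I s L (p \<theta> \<theta>))) ty)) (at (\<theta>, \<theta>) within U \<times> U)"
    by (rule has_derivative_partialsI[OF fx fy cont assms(7,2)])
  then have "((\<lambda>(x, y). L (p x y)) has_derivative (\<lambda>(tx, ty). (\<Sum>r\<in>B. d r * partial I r L (p \<theta> \<theta>)) * tx +
      blinfun_apply (blinfun_mult_right (d s * partial I s L (p \<theta> \<theta>))) ty)) (at (\<theta>, \<theta>) within (\<lambda>x. (x, x)) ` U)"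
    by (rule has_derivative_subset) auto
  from has_derivative_in_compose[OF _ this, of "\<lambda>x. (x, x)", OF has_derivative_Pair[OF has_derivative_ident has_derivative_ident]]
  have "((\<lambda>x. L (p x x)) has_derivative (\<lambda>t. (\<Sum>r\<in>B. d r * partial I r L (p \<theta> \<theta>)) * t +
      d s * partial I s L (p \<theta> \<theta>) * t)) (at \<theta> within U)"
    by (simp add: blinfun_mult_right.rep_eq)
  moreover have "(\<lambda>t. (\<Sum>r\<in>B. d r * partial I r L (p \<theta> \<theta>)) * t + d s * partial I s L (p \<theta> \<theta>) * t) =
      (*) (\<Sum>r\<in>insert s B. d r * partial I r L (p \<theta> \<theta>))"
    using insert.hyps by (auto simp: fun_eq_iff distrib_right)
  ultimately have "((\<lambda>x. L (p x x)) has_real_derivative (\<Sum>r\<in>insert s B. d r * partial I r L (p \<theta> \<theta>))) (at \<theta> within U)"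
    by (simp only: has_field_derivative_def)
  then show ?case unfolding pdiag .
qed

lemma chain_rule_slots:
  assumes L: "has_continuous_partials I A L" and "finite A" "convex U"
    and z: "\<And>\<sigma> \<theta>. \<sigma> \<in> A \<Longrightarrow> \<theta> \<in> U \<Longrightarrow> z \<sigma> + \<theta> * d \<sigma> \<in> slot_range I \<sigma>" and "\<theta> \<in> U"
  shows "((\<lambda>\<theta>. L (restrict (\<lambda>\<sigma>. z \<sigma> + \<theta> * d \<sigma>) A)) has_real_derivative
     (\<Sum>s\<in>A. d s * partial I s L (restrict (\<lambda>\<sigma>. z \<sigma> + \<theta> * d \<sigma>) A))) (at \<theta> within U)"
proof -
  define w where "w = restrict (\<lambda>\<sigma>. z \<sigma> + \<theta> * d \<sigma>) A"
  have "w \<in> lagrangian_domain I A" using z assms(5) by (auto simp: w_def lagrangian_domain_def)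
  moreover have "(\<lambda>\<sigma>. if \<sigma> \<in> A then z \<sigma> + x * d \<sigma> else w \<sigma>) = restrict (\<lambda>\<sigma>. z \<sigma> + x * d \<sigma>) A" for x
    by (auto simp: w_def fun_eq_iff)
  ultimately show ?thesis
    using chain_rule_some_slots[where I=I and A=A and L=L and U=U and z=z and d=d and B=A and w=w and \<theta>=\<theta>] assms by simp
qed

text \<open>Continuity of \<open>L\<close> itself is not among its defining properties, but follows along a continuous curve
from the mean value inequality on segments, because all partial derivatives are bounded on the compact set
of segments between points of the curve. It makes the integral in the functional meaningful.\<close>

lemma continuous_on_along_curve:
  fixes u :: "real \<Rightarrow> slot \<Rightarrow> real"
  assumes L: "has_continuous_partials I A L" and "finite A" "convex I"
    and u: "\<And>\<sigma>. \<sigma> \<in> A \<Longrightarrow> continuous_on {a..b} (\<lambda>t. u t \<sigma>)"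
    and range: "\<And>\<sigma> t. \<sigma> \<in> A \<Longrightarrow> t \<in> {a..b} \<Longrightarrow> u t \<sigma> \<in> slot_range I \<sigma>"
  shows "continuous_on {a..b} (\<lambda>t. L (restrict (u t) A))"
proof -
  define q where "q = (\<lambda>s t \<theta>. restrict (\<lambda>\<sigma>. u s \<sigma> + \<theta> * (u t \<sigma> - u s \<sigma>)) A)"
  have conv: "convex (slot_range I \<sigma>)" for \<sigma> using assms(3) by (simp add: slot_range_def)
  have seg: "u s \<sigma> + \<theta> * (u t \<sigma> - u s \<sigma>) \<in> slot_range I \<sigma>"
    if "\<sigma> \<in> A" "s \<in> {a..b}" "t \<in> {a..b}" "\<theta> \<in> {0..1}" for \<sigma> s t \<theta>
  proof -
    have "(1 - \<theta>) *\<^sub>R u s \<sigma> + \<theta> *\<^sub>R u t \<sigma> \<in> slot_range I \<sigma>"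
      using that by (intro convexD[OF conv] range) auto
    then show ?thesis by (simp add: algebra_simps)
  qed
  let ?X = "{a..b} \<times> {a..b} \<times> {0..1::real}"
  have cq: "continuous_on ?X (\<lambda>(s, t, \<theta>). q s t \<theta>)"
    unfolding q_def split_beta
  proof (rule continuous_on_coordinatewise_then_product)
    fix \<sigma>
    show "continuous_on ?X (\<lambda>x. restrict (\<lambda>\<sigma>. u (fst x) \<sigma> + snd (snd x) * (u (fst (snd x)) \<sigma> - u (fst x) \<sigma>)) A \<sigma>)"
    proof (cases "\<sigma> \<in> A")
      case True
      have "continuous_on ?X (\<lambda>x. u (fst x) \<sigma>)" "continuous_on ?X (\<lambda>x. u (fst (snd x)) \<sigma>)"
        by (rule continuous_on_compose2[OF u[OF True]]; auto intro!: continuous_intros)+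
      then show ?thesis using True by (auto intro!: continuous_intros)
    qed simp
  qed
  have "\<exists>M. \<forall>x\<in>?X. \<bar>partial I \<sigma> L ((\<lambda>(s, t, \<theta>). q s t \<theta>) x)\<bar> \<le> M" if "\<sigma> \<in> A" for \<sigma>
  proof -
    have "continuous_on ?X (\<lambda>x. partial I \<sigma> L ((\<lambda>(s, t, \<theta>). q s t \<theta>) x))"
      by (rule continuous_on_compose2[OF _ cq, of "lagrangian_domain I A"])
        (use L that seg in \<open>auto simp: has_continuous_partials_def q_def lagrangian_domain_def\<close>)
    then have "bounded ((\<lambda>x. partial I \<sigma> L ((\<lambda>(s, t, \<theta>). q s t \<theta>) x)) ` ?X)"
      by (intro compact_imp_bounded compact_continuous_image compact_Times) auto
    then show ?thesis by (simp add: bounded_iff)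
  qed
  then obtain M where M: "\<And>\<sigma> x. \<sigma> \<in> A \<Longrightarrow> x \<in> ?X \<Longrightarrow> \<bar>partial I \<sigma> L ((\<lambda>(s, t, \<theta>). q s t \<theta>) x)\<bar> \<le> M \<sigma>"
    by metis
  have bound: "\<bar>L (restrict (u t) A) - L (restrict (u s) A)\<bar> \<le> (\<Sum>\<sigma>\<in>A. \<bar>u t \<sigma> - u s \<sigma>\<bar> * M \<sigma>)"
    if "s \<in> {a..b}" "t \<in> {a..b}" for s t
  proof -
    have "norm (L (q s t 1) - L (q s t 0)) \<le> (\<Sum>\<sigma>\<in>A. \<bar>u t \<sigma> - u s \<sigma>\<bar> * M \<sigma>) * norm (1 - 0 :: real)"
    proof (rule field_differentiable_bound[of "{0..1}"])
      fix \<theta> :: real assume \<theta>: "\<theta> \<in> {0..1}"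
      show "((\<lambda>\<theta>. L (q s t \<theta>)) has_field_derivative (\<Sum>\<sigma>\<in>A. (u t \<sigma> - u s \<sigma>) * partial I \<sigma> L (q s t \<theta>))) (at \<theta> within {0..1})"
        unfolding q_def by (rule chain_rule_slots[OF L assms(2)]) (use that seg \<theta> in auto)
      show "norm (\<Sum>\<sigma>\<in>A. (u t \<sigma> - u s \<sigma>) * partial I \<sigma> L (q s t \<theta>)) \<le> (\<Sum>\<sigma>\<in>A. \<bar>u t \<sigma> - u s \<sigma>\<bar> * M \<sigma>)"
      proof (rule order_trans[OF norm_sum sum_mono])
        fix \<sigma> assume "\<sigma> \<in> A"
        then show "norm ((u t \<sigma> - u s \<sigma>) * partial I \<sigma> L (q s t \<theta>)) \<le> \<bar>u t \<sigma> - u s \<sigma>\<bar> * M \<sigma>"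
          using M[of \<sigma> "(s, t, \<theta>)"] that \<theta> by (auto simp: abs_mult intro!: mult_left_mono)
      qed
    qed auto
    moreover have "q s t 1 = restrict (u t) A" "q s t 0 = restrict (u s) A"
      by (auto simp: q_def fun_eq_iff restrict_def)
    ultimately show ?thesis by simp
  qed
  show ?thesis unfolding continuous_on_def
  proof
    fix s assume s: "s \<in> {a..b}"
    have "((\<lambda>t. \<Sum>\<sigma>\<in>A. \<bar>u t \<sigma> - u s \<sigma>\<bar> * M \<sigma>) \<longlongrightarrow> (\<Sum>\<sigma>\<in>A. \<bar>u s \<sigma> - u s \<sigma>\<bar> * M \<sigma>)) (at s within {a..b})"
      using u s by (intro tendsto_intros) (auto simp: continuous_on_def)
    then have *: "((\<lambda>t. \<Sum>\<sigma>\<in>A. \<bar>u t \<sigma> - u s \<sigma>\<bar> * M \<sigma>) \<longlongrightarrow> 0) (at s within {a..b})" by simp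
    have "((\<lambda>t. L (restrict (u t) A) - L (restrict (u s) A)) \<longlongrightarrow> 0) (at s within {a..b})"
      by (rule Lim_null_comparison[OF _ *]) (use bound s in \<open>auto simp: eventually_at_filter\<close>)
    then show "((\<lambda>t. L (restrict (u t) A)) \<longlongrightarrow> L (restrict (u s) A)) (at s within {a..b})"
      by (simp add: LIM_zero_iff)
  qed
qed

text \<open>Differentiation under the integral sign and Fermat's criterion for a local minimum.\<close>

lemma first_variation_eq_0:
  fixes u v :: "real \<Rightarrow> slot \<Rightarrow> real"
  assumes L: "has_continuous_partials I A L" and "finite A" "convex I"
    and u: "\<And>\<sigma>. \<sigma> \<in> A \<Longrightarrow> continuous_on {a..b} (\<lambda>t. u t \<sigma>)"
    and v: "\<And>\<sigma>. \<sigma> \<in> A \<Longrightarrow> continuous_on {a..b} (\<lambda>t. v t \<sigma>)"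
    and range: "\<And>\<sigma> t \<epsilon>. \<sigma> \<in> A \<Longrightarrow> t \<in> {a..b} \<Longrightarrow> u t \<sigma> + \<epsilon> * v t \<sigma> \<in> slot_range I \<sigma>"
    and min: "\<And>\<epsilon>. integral {a..b} (\<lambda>t. L (restrict (u t) A)) \<le> integral {a..b} (\<lambda>t. L (restrict (\<lambda>\<sigma>. u t \<sigma> + \<epsilon> * v t \<sigma>) A))"
  shows "integral {a..b} (\<lambda>t. \<Sum>\<sigma>\<in>A. v t \<sigma> * partial I \<sigma> L (restrict (u t) A)) = 0"
proof -
  define p where "p = (\<lambda>\<epsilon> t. restrict (\<lambda>\<sigma>. u t \<sigma> + \<epsilon> * v t \<sigma>) A)"
  have cp: "continuous_on (UNIV \<times> {a..b}) (\<lambda>(\<epsilon>, t). p \<epsilon> t)"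
    unfolding p_def split_beta
  proof (rule continuous_on_coordinatewise_then_product)
    fix \<sigma>
    show "continuous_on (UNIV \<times> {a..b}) (\<lambda>x. restrict (\<lambda>\<sigma>. u (snd x) \<sigma> + fst x * v (snd x) \<sigma>) A \<sigma>)"
    proof (cases "\<sigma> \<in> A")
      case True
      have "continuous_on (UNIV \<times> {a..b}) (\<lambda>x. u (snd x) \<sigma>)" "continuous_on (UNIV \<times> {a..b}) (\<lambda>x. v (snd x) \<sigma>)"
        by (rule continuous_on_compose2[OF u[OF True]] continuous_on_compose2[OF v[OF True]]; auto intro!: continuous_intros)+
      then show ?thesis using True by (auto intro!: continuous_intros)
    qed simp
  qed
  have "((\<lambda>\<epsilon>. integral (cbox a b) (\<lambda>t. L (p \<epsilon> t))) has_field_derivative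
      integral (cbox a b) (\<lambda>t. \<Sum>\<sigma>\<in>A. v t \<sigma> * partial I \<sigma> L (p 0 t))) (at 0 within UNIV)"
  proof (rule leibniz_rule_field_derivative[where fx = "\<lambda>\<epsilon> t. \<Sum>\<sigma>\<in>A. v t \<sigma> * partial I \<sigma> L (p \<epsilon> t)"])
    fix \<epsilon> t assume t: "t \<in> cbox a b"
    show "((\<lambda>\<epsilon>. L (p \<epsilon> t)) has_field_derivative (\<Sum>\<sigma>\<in>A. v t \<sigma> * partial I \<sigma> L (p \<epsilon> t))) (at \<epsilon> within UNIV)"
      unfolding p_def by (rule chain_rule_slots[OF L assms(2)]) (use range t in auto)
  next
    fix \<epsilon>
    have "continuous_on {a..b} (\<lambda>t. L (p \<epsilon> t))"
      unfolding p_def by (rule continuous_on_along_curve[OF L assms(2,3)]) (use u v range in \<open>auto intro!: continuous_intros\<close>)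
    then show "(\<lambda>t. L (p \<epsilon> t)) integrable_on cbox a b" by (simp add: integrable_continuous_real)
  next
    have "continuous_on (UNIV \<times> {a..b}) (\<lambda>x. v (snd x) \<sigma> * partial I \<sigma> L ((\<lambda>(\<epsilon>, t). p \<epsilon> t) x))" if "\<sigma> \<in> A" for \<sigma>
    proof (rule continuous_on_mult)
      show "continuous_on (UNIV \<times> {a..b}) (\<lambda>x. v (snd x) \<sigma>)"
        by (rule continuous_on_compose2[OF v[OF that]]) (auto intro!: continuous_intros)
      show "continuous_on (UNIV \<times> {a..b}) (\<lambda>x. partial I \<sigma> L ((\<lambda>(\<epsilon>, t). p \<epsilon> t) x))"
        by (rule continuous_on_compose2[OF _ cp, of "lagrangian_domain I A"])
          (use L that range in \<open>auto simp: has_continuous_partials_def p_def lagrangian_domain_def\<close>)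
    qed
    then show "continuous_on (UNIV \<times> cbox a b) (\<lambda>(\<epsilon>, t). \<Sum>\<sigma>\<in>A. v t \<sigma> * partial I \<sigma> L (p \<epsilon> t))"
      unfolding split_beta by (intro continuous_on_sum) (auto simp: split_beta)
  qed auto
  then have "((\<lambda>\<epsilon>. integral {a..b} (\<lambda>t. L (p \<epsilon> t))) has_real_derivative
      integral {a..b} (\<lambda>t. \<Sum>\<sigma>\<in>A. v t \<sigma> * partial I \<sigma> L (p 0 t))) (at 0)" by simp
  moreover have p0: "p 0 t = restrict (u t) A" for t by (auto simp: p_def restrict_def fun_eq_iff)
  moreover have "integral {a..b} (\<lambda>t. L (p 0 t)) \<le> integral {a..b} (\<lambda>t. L (p \<epsilon> t))" for \<epsilon>
    unfolding p0 using min by (simp add: p_def)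
  ultimately show ?thesis
    using DERIV_local_min[of "\<lambda>\<epsilon>. integral {a..b} (\<lambda>t. L (p \<epsilon> t))" _ 0 1] by simp
qed

section \<open>Weak equations of higher order\<close>

text \<open>The derivative of order \<open>k\<close> has to vanish at the ends as well: only then is the extension by zero of
class \<open>C^k\<close>.\<close>

definition test_jet :: "nat \<Rightarrow> real \<Rightarrow> real \<Rightarrow> (nat \<Rightarrow> real \<Rightarrow> real) \<Rightarrow> bool" where
  "test_jet k c d e \<longleftrightarrow> jet_on k {c..d} e \<and> (\<forall>p\<le>k. e p c = 0 \<and> e p d = 0)"

lemma jet_on_continuous:
  assumes "jet_on k S e" "p \<le> k"
  shows "continuous_on S (e p)"
proof (cases "p = k")
  case False
  then have "\<forall>t\<in>S. (e p has_vector_derivative e (Suc p) t) (at t within S)"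
    using assms by (auto simp: jet_on_def)
  then show ?thesis
    using has_vector_derivative_continuous by (force simp: continuous_on_eq_continuous_within)
qed (use assms in \<open>auto simp: jet_on_def\<close>)

lemma power_dvd_pderiv:
  fixes u :: "real poly"
  assumes "u ^ Suc j dvd P"
  shows "u ^ j dvd pderiv P"
proof -
  obtain Q where "P = u ^ Suc j * Q" using assms by (elim dvdE)
  then have "pderiv P = u ^ j * (u * pderiv Q + Q * smult (of_nat (Suc j)) (pderiv u))"
    by (simp add: pderiv_mult pderiv_power_Suc algebra_simps del: power_Suc) (simp add: algebra_simps)
  then show ?thesis by simp
qed

text \<open>A power of the quadratic polynomial that vanishes at both ends.\<close>

lemma test_jet_bump:
  assumes "c < d"
  obtains h where "test_jet k c d h" "integral {c..d} (h 0) \<noteq> 0"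
proof -
  define u where "u = [:- c, 1:] * [:d, - 1 :: real:]"
  define h where "h = (\<lambda>p. poly ((pderiv ^^ p) (u ^ Suc k)))"
  have "u ^ (Suc k - p) dvd (pderiv ^^ p) (u ^ Suc k)" if "p \<le> k" for p
    using that
  proof (induction p)
    case (Suc p)
    then have "u ^ Suc (k - p) dvd (pderiv ^^ p) (u ^ Suc k)" by (simp add: Suc_diff_le del: power_Suc)
    then show ?case using power_dvd_pderiv by auto
  qed simp
  then have dv: "u dvd (pderiv ^^ p) (u ^ Suc k)" if "p \<le> k" for p
    using that dvd_trans[of u "u ^ (Suc k - p)"] by (simp add: Suc_diff_le)
  have "poly u c = 0" "poly u d = 0" by (simp_all add: u_def)
  then have zero: "h p c = 0 \<and> h p d = 0" if "p \<le> k" for p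
    using dv[OF that] unfolding h_def by (elim dvdE) simp
  have D: "(h p has_vector_derivative h (Suc p) t) (at t within S)" for p t S
  proof -
    have "(h p has_real_derivative h (Suc p) t) (at t)"
      unfolding h_def using poly_DERIV[of "(pderiv ^^ p) (u ^ Suc k)" t] by (simp del: power_Suc)
    then show ?thesis
      unfolding has_real_derivative_iff_has_vector_derivative by (rule has_vector_derivative_at_within)
  qed
  have cont: "continuous_on S (h p)" for p S unfolding h_def by (intro continuous_intros)
  have h0: "h 0 t = ((t - c) * (d - t)) ^ Suc k" for t by (simp add: h_def u_def algebra_simps)
  have "integral {c..d} (h 0) \<noteq> 0"
  proof
    assume "integral {c..d} (h 0) = 0"
    moreover have "\<forall>t\<in>{c..d}. 0 \<le> h 0 t" unfolding h0 by auto
    ultimately have "\<forall>t\<in>{c..d}. h 0 t = 0"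
      using integral_eq_0_iff[OF cont assms] by blast
    moreover have "(c + d) / 2 \<in> {c..d}" using assms by auto
    ultimately have "h 0 ((c + d) / 2) = 0" by blast
    moreover have "0 < ((c + d) / 2 - c) * (d - (c + d) / 2)"
      using assms by (intro mult_pos_pos) (auto simp: field_simps)
    then have "0 < h 0 ((c + d) / 2)" unfolding h0 by (rule zero_less_power)
    ultimately show False by simp
  qed
  then show ?thesis using zero D cont by (intro that[of h]) (auto simp: test_jet_def jet_on_def)
qed

text \<open>The test functions with zero mean are precisely the derivatives of test functions of the next order.\<close>

lemma test_jet_antiderivative:
  assumes "c < d" "test_jet k c d e" "integral {c..d} (e 0) = 0"
  shows "test_jet (Suc k) c d (case_nat (\<lambda>t. integral {c..t} (e 0)) e)"
proof -
  have cont: "continuous_on {c..d} (e 0)" using assms(2) jet_on_continuous[of k "{c..d}" e 0] by (auto simp: test_jet_def)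
  have "((\<lambda>t. integral {c..t} (e 0)) has_vector_derivative e 0 t) (at t within {c..d})" if "t \<in> {c..d}" for t
    by (rule integral_has_vector_derivative[OF cont that])
  then show ?thesis using assms(2,3) by (auto simp: test_jet_def jet_on_def less_Suc_eq_0_disj split: nat.split)
qed

text \<open>The antiderivative of \<open>F\<close> is in general not differentiable everywhere, so the product rule is not
available. Instead the order of integration is exchanged, as a case of adjointness for order one.\<close>

lemma integral_times_jet_by_parts:
  fixes F :: "real \<Rightarrow> real"
  assumes "c < d" "integrable lborel F" "jet_on 1 {c..d} e"
  shows "(\<lambda>t. F t * e 0 t) integrable_on {c..d}"
    and "integral {c..d} (\<lambda>t. F t * e 0 t) = (C + integral {c..d} F) * e 0 d - C * e 0 c -
       integral {c..d} (\<lambda>t. (C + integral {c..t} F) * e 1 t)"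
proof -
  define F1 where "F1 = (\<lambda>s. if s \<in> {c..d} then F s else 0)"
  have F1: "integrable lborel F1" "\<forall>s>d. F1 s = 0"
  proof -
    have "(\<lambda>s. indicator {c..d} s *\<^sub>R F s) = F1" by (auto simp: F1_def indicator_def fun_eq_iff)
    then show "integrable lborel F1" using integrable_mult_indicator[OF _ assms(2), of "{c..d}"] by simp
  qed (simp add: F1_def)
  have c1: "continuous_on {c..d} (e 1)" and c0: "continuous_on {c..d} (e 0)"
    using jet_on_continuous[OF assms(3)] by auto
  define \<phi> where "\<phi> = (\<lambda>s. if s \<in> {c..d} then e 1 s else 0)"
  have \<phi>i: "integrable lborel \<phi>" unfolding \<phi>_def by (rule integrable_truncate[OF c1])
  have \<phi>m: "\<phi> \<in> borel_measurable borel" using \<phi>i by auto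
  have "bounded (e 1 ` {c..d})" by (intro compact_imp_bounded compact_continuous_image c1) simp
  then obtain M where "\<forall>x\<in>e 1 ` {c..d}. norm x \<le> M" unfolding bounded_iff by blast
  then have "\<bar>e 1 s\<bar> \<le> M" if "s \<in> {c..d}" for s using that by simp
  then have M: "\<bar>\<phi> s\<bar> \<le> \<bar>M\<bar>" for s by (cases "s \<in> {c..d}") (force simp: \<phi>_def)+
  have \<phi>z: "\<forall>s<c. \<phi> s = 0" by (simp add: \<phi>_def)
  note adj = rl_int_adjoint[OF _ F1 \<phi>m M \<phi>z, of 1]
  have e0: "e 0 s = e 0 c + rl_int 1 \<phi> s" if s: "s \<in> {c..d}" for s
  proof -
    have "(\<phi> has_integral rl_int 1 \<phi> s) {c..s}"
      by (rule has_integral_rl_int_1[OF integrable_rl_kernel_mult[OF _ \<phi>i \<phi>z] \<phi>z]) simp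
    moreover have "(e 1 has_integral e 0 s - e 0 c) {c..s}"
    proof (rule fundamental_theorem_of_calculus)
      fix x assume "x \<in> {c..s}"
      then have "(e 0 has_vector_derivative e 1 x) (at x within {c..d})"
        using assms(3) s by (auto simp: jet_on_def)
      then show "(e 0 has_vector_derivative e 1 x) (at x within {c..s})"
        by (rule has_vector_derivative_within_subset) (use s in auto)
    qed (use s in auto)
    then have "(\<phi> has_integral e 0 s - e 0 c) {c..s}"
      by (rule has_integral_eq[rotated]) (use s in \<open>auto simp: \<phi>_def\<close>)
    ultimately have "rl_int 1 \<phi> s = e 0 s - e 0 c" by (rule has_integral_unique)
    then show ?thesis by simp
  qed
  have R: "rl_int_right 1 F1 t = integral {c..d} F - integral {c..t} F" if t: "t \<in> {c..d}" for t
  proof -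
    have ii: "integrable lborel (\<lambda>s. rl_kernel 1 (- t - s) * F1 (- s))"
    proof -
      have "integrable lborel (\<lambda>s. F1 (- s))" using lborel_integrable_real_affine[OF F1(1), of "-1" 0] by simp
      then show ?thesis using F1(2) by (intro integrable_rl_kernel_mult[where a = "- d"]) auto
    qed
    have "((\<lambda>s. F1 (- s)) has_integral rl_int 1 (\<lambda>s. F1 (- s)) (- t)) {- d..- t}"
      by (rule has_integral_rl_int_1[OF ii]) (use F1(2) in auto)
    then have "(F1 has_integral rl_int_right 1 F1 t) {t..d}"
      unfolding rl_int_right_reflect by (rule iffD1[OF has_integral_reflect_real])
    then have "(F has_integral rl_int_right 1 F1 t) {t..d}"
      by (rule has_integral_eq[rotated]) (use t in \<open>auto simp: F1_def\<close>)
    moreover have "integral {c..t} F + integral {t..d} F = integral {c..d} F"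
      by (rule Henstock_Kurzweil_Integration.integral_combine)
        (use t integrable_on_Icc_of_lborel[OF assms(2)] in auto)
    ultimately show ?thesis by (simp add: integral_unique)
  qed
  have "((\<lambda>s. F1 s * rl_int 1 \<phi> s) has_integral (LBINT s. F1 s * rl_int 1 \<phi> s)) UNIV"
    by (rule has_integral_integral_lborel[OF adj(2)]) simp
  moreover have "(\<lambda>s. F1 s * rl_int 1 \<phi> s) = (\<lambda>s. if s \<in> {c..d} then F s * rl_int 1 \<phi> s else 0)"
    by (auto simp: F1_def)
  ultimately have h1: "((\<lambda>s. F s * rl_int 1 \<phi> s) has_integral (LBINT s. F1 s * rl_int 1 \<phi> s)) {c..d}"
    by (simp only: has_integral_restrict_UNIV)
  have h2: "((\<lambda>s. F s * e 0 c) has_integral integral {c..d} F * e 0 c) {c..d}"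
    by (intro has_integral_mult_left integrable_integral integrable_on_Icc_of_lborel assms(2))
  have "((\<lambda>s. F s * e 0 c + F s * rl_int 1 \<phi> s) has_integral integral {c..d} F * e 0 c + (LBINT s. F1 s * rl_int 1 \<phi> s)) {c..d}"
    by (rule has_integral_add[OF h2 h1])
  then have hF: "((\<lambda>s. F s * e 0 s) has_integral integral {c..d} F * e 0 c + (LBINT s. F1 s * rl_int 1 \<phi> s)) {c..d}"
  proof (rule has_integral_eq[rotated])
    fix s assume "s \<in> {c..d}"
    from e0[OF this] show "F s * e 0 c + F s * rl_int 1 \<phi> s = F s * e 0 s" by (simp only: distrib_left)
  qed
  then show "(\<lambda>t. F t * e 0 t) integrable_on {c..d}" by blast
  have "((\<lambda>t. rl_int_right 1 F1 t * \<phi> t) has_integral (LBINT t. rl_int_right 1 F1 t * \<phi> t)) UNIV"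
    by (rule has_integral_integral_lborel[OF adj(1)]) simp
  moreover have "(\<lambda>t. rl_int_right 1 F1 t * \<phi> t) = (\<lambda>t. if t \<in> {c..d} then (integral {c..d} F - integral {c..t} F) * e 1 t else 0)"
    using R by (auto simp: \<phi>_def fun_eq_iff)
  ultimately have hR: "((\<lambda>t. (integral {c..d} F - integral {c..t} F) * e 1 t) has_integral (LBINT t. rl_int_right 1 F1 t * \<phi> t)) {c..d}"
    by (simp only: has_integral_restrict_UNIV)
  have "(e 1 has_integral e 0 d - e 0 c) {c..d}"
    by (rule fundamental_theorem_of_calculus) (use assms in \<open>auto simp: jet_on_def\<close>)
  then have "((\<lambda>t. (C + integral {c..d} F) * e 1 t) has_integral (C + integral {c..d} F) * (e 0 d - e 0 c)) {c..d}"
    by (rule has_integral_mult_right)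
  from has_integral_diff[OF this hR]
  have "((\<lambda>t. (C + integral {c..t} F) * e 1 t) has_integral (C + integral {c..d} F) * (e 0 d - e 0 c) - (LBINT t. rl_int_right 1 F1 t * \<phi> t)) {c..d}"
    by (simp add: algebra_simps)
  then show "integral {c..d} (\<lambda>t. F t * e 0 t) = (C + integral {c..d} F) * e 0 d - C * e 0 c -
       integral {c..d} (\<lambda>t. (C + integral {c..t} F) * e 1 t)"
    using hF adj(3) by (simp add: integral_unique algebra_simps)
qed

text \<open>The test function is \<open>f\<close> itself, multiplied by a weight that vanishes at the ends.\<close>

lemma continuous_eq_0_of_weak:
  assumes "c < d" "continuous_on {c..d} f"
    and weak: "\<And>e. test_jet 0 c d e \<Longrightarrow> integral {c..d} (\<lambda>t. f t * e 0 t) = 0" and "t \<in> {c..d}"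
  shows "f t = (0 :: real)"
proof -
  define w where "w = (\<lambda>t. (t - c) * (d - t))"
  have "test_jet 0 c d (\<lambda>_ t. w t * f t)"
    unfolding test_jet_def jet_on_def w_def using assms(2) by (auto intro!: continuous_intros)
  then have "integral {c..d} (\<lambda>t. f t * (w t * f t)) = 0" by (rule weak)
  moreover have "continuous_on {c..d} (\<lambda>t. f t * (w t * f t))"
    unfolding w_def using assms(2) by (intro continuous_intros)
  moreover have "\<forall>t\<in>{c..d}. 0 \<le> f t * (w t * f t)"
  proof
    fix t assume "t \<in> {c..d}"
    then have "0 \<le> w t * (f t * f t)" by (auto simp: w_def)
    then show "0 \<le> f t * (w t * f t)" by (simp add: algebra_simps)
  qed
  ultimately have "\<forall>t\<in>{c..d}. f t * (w t * f t) = 0" using integral_eq_0_iff assms(1) by blast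
  then have "f t = 0" if "t \<in> {c<..<d}" for t using that by (force simp: w_def)
  moreover have "t \<in> closure {c<..<d}" "continuous_on (closure {c<..<d}) f"
    using assms by (auto simp: closure_greaterThanLessThan)
  ultimately show ?thesis using continuous_constant_on_closure[of "{c<..<d}" f 0 t] by blast
qed

text \<open>Integration by parts moves a derivative from the test function to \<open>F\<close>, and turns the equation into one
for the derivative of the test function, which is an arbitrary test function of zero mean. Removing the
restriction on the mean with a fixed bump function costs a multiple of the mean; this is the constant
\<open>C\<close>, and it is absorbed in the antiderivative of \<open>F\<close>.\<close>

lemma weak_equation_step:
  fixes F :: "real \<Rightarrow> real"
  assumes "c < d" "integrable lborel F" and R: "\<And>p. p \<le> k \<Longrightarrow> continuous_on {c..d} (R p)"
    and weak: "\<And>e. test_jet (Suc k) c d e \<Longrightarrow>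
      integral {c..d} (\<lambda>t. F t * e 0 t) + integral {c..d} (\<lambda>t. \<Sum>p\<le>k. R p t * e (Suc p) t) = 0"
  obtains C where "\<And>e. test_jet k c d e \<Longrightarrow>
      integral {c..d} (\<lambda>t. (\<Sum>p\<le>k. R p t * e p t) - (C + integral {c..t} F) * e 0 t) = 0"
proof -
  define \<Lambda> where "\<Lambda> = (\<lambda>e. integral {c..d} (\<lambda>t. (\<Sum>p\<le>k. R p t * e p t) - integral {c..t} F * e 0 t))"
  have cF: "continuous_on {c..d} (\<lambda>t. integral {c..t} F)"
    by (rule indefinite_integral_continuous_1[OF integrable_on_Icc_of_lborel[OF assms(2)]])
  have jc: "continuous_on {c..d} (e p)" if "test_jet k c d e" "p \<le> k" for e p
    using jet_on_continuous that by (auto simp: test_jet_def)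
  have int: "(\<lambda>t. (\<Sum>p\<le>k. R p t * e p t) - integral {c..t} F * e 0 t) integrable_on {c..d}"
    if "test_jet k c d e" for e
    by (intro integrable_continuous_real continuous_intros R cF jc[OF that]) auto
  have int0: "e 0 integrable_on {c..d}" if "test_jet k c d e" for e
    by (intro integrable_continuous_real jc[OF that]) simp
  have zero: "\<Lambda> e = 0" if e: "test_jet k c d e" and m: "integral {c..d} (e 0) = 0" for e
  proof -
    let ?E = "case_nat (\<lambda>t. integral {c..t} (e 0)) e"
    have E: "test_jet (Suc k) c d ?E" by (rule test_jet_antiderivative[OF assms(1) e m])
    then have j1: "jet_on 1 {c..d} ?E"
      using jet_on_continuous[of "Suc k" _ ?E 1] by (auto simp: test_jet_def jet_on_def)
    have s: "(\<Sum>p\<le>k. R p t * ?E (Suc p) t) = (\<Sum>p\<le>k. R p t * e p t)" for t by simp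
    have "0 = integral {c..d} (\<lambda>t. F t * ?E 0 t) + integral {c..d} (\<lambda>t. \<Sum>p\<le>k. R p t * ?E (Suc p) t)"
      using weak[OF E] by simp
    also have "integral {c..d} (\<lambda>t. F t * ?E 0 t) = - integral {c..d} (\<lambda>t. integral {c..t} F * e 0 t)"
      using integral_times_jet_by_parts(2)[OF assms(1,2) j1, of 0] m by simp
    also have "- integral {c..d} (\<lambda>t. integral {c..t} F * e 0 t) + integral {c..d} (\<lambda>t. \<Sum>p\<le>k. R p t * ?E (Suc p) t) = \<Lambda> e"
    proof -
      have "(\<lambda>t. \<Sum>p\<le>k. R p t * e p t) integrable_on {c..d}" "(\<lambda>t. integral {c..t} F * e 0 t) integrable_on {c..d}"
        by (intro integrable_continuous_real continuous_intros R cF jc[OF e]; simp)+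
      then show ?thesis unfolding \<Lambda>_def s by (simp add: Henstock_Kurzweil_Integration.integral_diff)
    qed
    finally show ?thesis by simp
  qed
  obtain h where h: "test_jet k c d h" "integral {c..d} (h 0) \<noteq> 0" using test_jet_bump[OF assms(1)] .
  define C where "C = \<Lambda> h / integral {c..d} (h 0)"
  show ?thesis
  proof (rule that[of C])
    fix e assume e: "test_jet k c d e"
    (* With this multiple of the bump subtracted, the test function e has zero mean. *)
    define r where "r = integral {c..d} (e 0) / integral {c..d} (h 0)"
    define g where "g = (\<lambda>p t. e p t - r * h p t)"
    have g: "test_jet k c d g" unfolding test_jet_def jet_on_def g_def
      using e h(1) by (auto simp: test_jet_def jet_on_def intro!: continuous_intros has_vector_derivative_diff has_vector_derivative_mult_right)
    have "integral {c..d} (g 0) = integral {c..d} (e 0) - r * integral {c..d} (h 0)"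
      unfolding g_def
      by (subst Henstock_Kurzweil_Integration.integral_diff[OF int0[OF e] integrable_on_mult_right[OF int0[OF h(1)]]]) simp
    then have "integral {c..d} (g 0) = 0" using h(2) by (simp add: r_def)
    then have "\<Lambda> g = 0" by (rule zero[OF g])
    moreover have "\<Lambda> g = \<Lambda> e - r * \<Lambda> h"
    proof -
      have "\<Lambda> g = integral {c..d} (\<lambda>t. ((\<Sum>p\<le>k. R p t * e p t) - integral {c..t} F * e 0 t) -
          r * ((\<Sum>p\<le>k. R p t * h p t) - integral {c..t} F * h 0 t))"
        unfolding \<Lambda>_def g_def
        by (simp add: right_diff_distrib sum_subtractf sum_distrib_left algebra_simps)
      also have "\<dots> = \<Lambda> e - r * \<Lambda> h"
        unfolding \<Lambda>_def using int[OF e] int[OF h(1)]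
        by (subst Henstock_Kurzweil_Integration.integral_diff) (auto intro: integrable_on_mult_right)
      finally show ?thesis .
    qed
    ultimately have "\<Lambda> e - C * integral {c..d} (e 0) = 0" by (simp add: r_def C_def)
    moreover have "integral {c..d} (\<lambda>t. ((\<Sum>p\<le>k. R p t * e p t) - integral {c..t} F * e 0 t) - C * e 0 t) =
        \<Lambda> e - C * integral {c..d} (e 0)"
      unfolding \<Lambda>_def using int[OF e] int0[OF e]
      by (subst Henstock_Kurzweil_Integration.integral_diff) (auto intro: integrable_on_mult_right)
    ultimately show "integral {c..d} (\<lambda>t. (\<Sum>p\<le>k. R p t * e p t) - (C + integral {c..t} F) * e 0 t) = 0"
      by (simp add: algebra_simps)
  qed
qed

text \<open>Here \<open>D p q\<close> is the \<open>q\<close>-th derivative of the coefficient of the derivative of order \<open>p + 1\<close> of the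
test function. Each coefficient is differentiable one time less than the Euler-Poisson equation seems
to require, and the formula for the antiderivative of \<open>F\<close> is this equation integrated once. In the
induction step, \<open>D 0 0\<close> minus that antiderivative takes the role of \<open>F\<close>; it is continuous, so the
formula given by the induction hypothesis can be differentiated everywhere.\<close>

lemma euler_poisson:
  fixes F :: "real \<Rightarrow> real" and D :: "nat \<Rightarrow> nat \<Rightarrow> real \<Rightarrow> real"
  assumes "c < d" "integrable lborel F"
    and "\<And>p. p \<le> k \<Longrightarrow> continuous_on {c..d} (D p 0)"
    and "\<And>p q t. p \<le> k \<Longrightarrow> q < p \<Longrightarrow> t \<in> {c..d} \<Longrightarrow> (D p q has_vector_derivative D p (Suc q) t) (at t within {c..d})"
    and "\<And>e. test_jet (Suc k) c d e \<Longrightarrow>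
      integral {c..d} (\<lambda>t. F t * e 0 t) + integral {c..d} (\<lambda>t. \<Sum>p\<le>k. D p 0 t * e (Suc p) t) = 0"
  shows "\<exists>C. (\<forall>t\<in>{c..d}. C + integral {c..t} F = (\<Sum>p\<le>k. (- 1) ^ p * D p p t)) \<and>
    (\<forall>e. jet_on (Suc k) {c..d} e \<longrightarrow>
      integral {c..d} (\<lambda>t. F t * e 0 t) + integral {c..d} (\<lambda>t. \<Sum>p\<le>k. D p 0 t * e (Suc p) t) =
      increment (\<lambda>t. \<Sum>p\<le>k. \<Sum>q\<le>p. (- 1) ^ q * D p q t * e (p - q) t) c d)"
  using assms(2-)
proof (induction k arbitrary: F D)
  case (0 F D)
  obtain C where C: "\<And>e. test_jet 0 c d e \<Longrightarrow>
      integral {c..d} (\<lambda>t. (\<Sum>p\<le>0. D p 0 t * e p t) - (C + integral {c..t} F) * e 0 t) = 0"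
    by (rule weak_equation_step[OF assms(1) "0.prems"(1), of 0 "\<lambda>p. D p 0"]) (use "0.prems" in auto)
  have cF: "continuous_on {c..d} (\<lambda>t. integral {c..t} F)"
    by (rule indefinite_integral_continuous_1[OF integrable_on_Icc_of_lborel[OF "0.prems"(1)]])
  have eq: "D 0 0 t - (C + integral {c..t} F) = 0" if "t \<in> {c..d}" for t
  proof (rule continuous_eq_0_of_weak[OF assms(1) _ _ that])
    show "continuous_on {c..d} (\<lambda>t. D 0 0 t - (C + integral {c..t} F))"
      using "0.prems"(2)[of 0] by (intro continuous_intros cF) auto
    show "integral {c..d} (\<lambda>t. (D 0 0 t - (C + integral {c..t} F)) * e 0 t) = 0" if "test_jet 0 c d e" for e
      using C[OF that] by (simp add: left_diff_distrib)
  qed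
  show ?case
  proof (intro exI[of _ C] conjI ballI allI impI)
    fix e assume e: "jet_on (Suc 0) {c..d} e"
    have "integral {c..d} (\<lambda>t. D 0 0 t * e 1 t) = integral {c..d} (\<lambda>t. (C + integral {c..t} F) * e 1 t)"
      by (rule Henstock_Kurzweil_Integration.integral_cong) (use eq in auto)
    moreover have "D 0 0 c = C" "D 0 0 d = C + integral {c..d} F" using eq[of c] eq[of d] assms(1) by auto
    ultimately show "integral {c..d} (\<lambda>t. F t * e 0 t) + integral {c..d} (\<lambda>t. \<Sum>p\<le>0. D p 0 t * e (Suc p) t) =
        increment (\<lambda>t. \<Sum>p\<le>0. \<Sum>q\<le>p. (- 1) ^ q * D p q t * e (p - q) t) c d"
      using integral_times_jet_by_parts(2)[OF assms(1) "0.prems"(1), of e C] e by (simp add: increment_def)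
  qed (use eq in auto)
next
  case (Suc k F D)
  obtain C where C: "\<And>e. test_jet (Suc k) c d e \<Longrightarrow>
      integral {c..d} (\<lambda>t. (\<Sum>p\<le>Suc k. D p 0 t * e p t) - (C + integral {c..t} F) * e 0 t) = 0"
    by (rule weak_equation_step[OF assms(1) Suc.prems(1), of "Suc k" "\<lambda>p. D p 0"]) (use Suc.prems in auto)
  define \<Phi> where "\<Phi> = (\<lambda>t. C + integral {c..t} F)"
  have c\<Phi>: "continuous_on {c..d} \<Phi>" unfolding \<Phi>_def
    by (intro continuous_intros indefinite_integral_continuous_1 integrable_on_Icc_of_lborel Suc.prems(1))
  define f where "f = (\<lambda>t. D 0 0 t - \<Phi> t)"
  have cf: "continuous_on {c..d} f" unfolding f_def
    using Suc.prems(2)[of 0] by (intro continuous_intros c\<Phi>) auto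
  (* The induction hypothesis asks for integrability on the whole line. *)
  define F' where "F' = (\<lambda>t. if t \<in> {c..d} then f t else 0)"
  have iF': "integrable lborel F'" unfolding F'_def by (rule integrable_truncate[OF cf])
  have F'eq: "integral {c..d} (\<lambda>t. F' t * g t) = integral {c..d} (\<lambda>t. f t * g t)" for g
    by (rule Henstock_Kurzweil_Integration.integral_cong) (auto simp: F'_def)
  have cD: "continuous_on {c..d} (D (Suc p) 0)" if "p \<le> k" for p using Suc.prems(2) that by auto
  have split: "integral {c..d} (\<lambda>t. (\<Sum>p\<le>Suc k. D p 0 t * e p t) - \<Phi> t * e 0 t) =
     integral {c..d} (\<lambda>t. F' t * e 0 t) + integral {c..d} (\<lambda>t. \<Sum>p\<le>k. D (Suc p) 0 t * e (Suc p) t)"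
    if "\<And>p. p \<le> Suc k \<Longrightarrow> continuous_on {c..d} (e p)" for e
  proof -
    have i1: "(\<lambda>t. f t * e 0 t) integrable_on {c..d}"
      using that[of 0] by (intro integrable_continuous_real continuous_intros cf) auto
    have i2: "(\<lambda>t. \<Sum>p\<le>k. D (Suc p) 0 t * e (Suc p) t) integrable_on {c..d}"
      using that by (intro integrable_continuous_real continuous_intros cD) auto
    have "integral {c..d} (\<lambda>t. (\<Sum>p\<le>Suc k. D p 0 t * e p t) - \<Phi> t * e 0 t) =
       integral {c..d} (\<lambda>t. f t * e 0 t + (\<Sum>p\<le>k. D (Suc p) 0 t * e (Suc p) t))"
      by (simp only: sum.atMost_Suc_shift) (simp add: f_def algebra_simps)
    also have "\<dots> = integral {c..d} (\<lambda>t. f t * e 0 t) + integral {c..d} (\<lambda>t. \<Sum>p\<le>k. D (Suc p) 0 t * e (Suc p) t)"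
      by (rule Henstock_Kurzweil_Integration.integral_add[OF i1 i2])
    finally show ?thesis by (simp add: F'eq)
  qed
  obtain C' where C': "\<And>t. t \<in> {c..d} \<Longrightarrow> C' + integral {c..t} F' = (\<Sum>p\<le>k. (- 1) ^ p * D (Suc p) p t)"
    and B: "\<And>e. jet_on (Suc k) {c..d} e \<Longrightarrow>
      integral {c..d} (\<lambda>t. F' t * e 0 t) + integral {c..d} (\<lambda>t. \<Sum>p\<le>k. D (Suc p) 0 t * e (Suc p) t) =
      increment (\<lambda>t. \<Sum>p\<le>k. \<Sum>q\<le>p. (- 1) ^ q * D (Suc p) q t * e (p - q) t) c d"
  proof -
    have "\<exists>C'. (\<forall>t\<in>{c..d}. C' + integral {c..t} F' = (\<Sum>p\<le>k. (- 1) ^ p * D (Suc p) p t)) \<and>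
      (\<forall>e. jet_on (Suc k) {c..d} e \<longrightarrow>
        integral {c..d} (\<lambda>t. F' t * e 0 t) + integral {c..d} (\<lambda>t. \<Sum>p\<le>k. D (Suc p) 0 t * e (Suc p) t) =
        increment (\<lambda>t. \<Sum>p\<le>k. \<Sum>q\<le>p. (- 1) ^ q * D (Suc p) q t * e (p - q) t) c d)"
    proof (rule Suc.IH[of F' "\<lambda>p. D (Suc p)"])
      show "integrable lborel F'" by (rule iF')
      show "continuous_on {c..d} (D (Suc p) 0)" if "p \<le> k" for p by (rule cD[OF that])
      show "(D (Suc p) q has_vector_derivative D (Suc p) (Suc q) t) (at t within {c..d})"
        if "p \<le> k" "q < p" "t \<in> {c..d}" for p q t using Suc.prems(3) that by simp
      show "integral {c..d} (\<lambda>t. F' t * e 0 t) + integral {c..d} (\<lambda>t. \<Sum>p\<le>k. D (Suc p) 0 t * e (Suc p) t) = 0"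
        if e: "test_jet (Suc k) c d e" for e
      proof -
        have "continuous_on {c..d} (e p)" if "p \<le> Suc k" for p
          using e that jet_on_continuous unfolding test_jet_def by blast
        then show ?thesis using C[OF e] split[of e] by (simp only: \<Phi>_def)
      qed
    qed
    then show ?thesis using that by blast
  qed
  have F't: "F' t = (\<Sum>p\<le>k. (- 1) ^ p * D (Suc p) (Suc p) t)" if t: "t \<in> {c..d}" for t
  proof -
    have "((\<lambda>x. integral {c..x} f) has_vector_derivative f t) (at t within {c..d})"
      by (rule integral_has_vector_derivative[OF cf t])
    then have "((\<lambda>x. C' + integral {c..x} f) has_vector_derivative 0 + f t) (at t within {c..d})"
      by (intro has_vector_derivative_add has_vector_derivative_const)
    moreover have "(\<Sum>p\<le>k. (- 1) ^ p * D (Suc p) p x) = C' + integral {c..x} f" if "x \<in> {c..d}" for x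
    proof -
      have "integral {c..x} F' = integral {c..x} f"
        by (rule Henstock_Kurzweil_Integration.integral_cong) (use that in \<open>auto simp: F'_def\<close>)
      then show ?thesis using C'[OF that] by simp
    qed
    ultimately have 1: "((\<lambda>x. \<Sum>p\<le>k. (- 1) ^ p * D (Suc p) p x) has_vector_derivative f t) (at t within {c..d})"
      using has_vector_derivative_transform[OF t, of "\<lambda>x. \<Sum>p\<le>k. (- 1) ^ p * D (Suc p) p x" "\<lambda>x. C' + integral {c..x} f"] by simp
    have 2: "((\<lambda>x. \<Sum>p\<le>k. (- 1) ^ p * D (Suc p) p x) has_vector_derivative
        (\<Sum>p\<le>k. (- 1) ^ p * D (Suc p) (Suc p) t)) (at t within {c..d})"
      using Suc.prems(3) t by (intro has_vector_derivative_sum has_vector_derivative_mult_right) auto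
    have "f t = (\<Sum>p\<le>k. (- 1) ^ p * D (Suc p) (Suc p) t)"
      using vector_derivative_within_closed_interval[OF assms(1) t 1]
        vector_derivative_within_closed_interval[OF assms(1) t 2] by simp
    then show ?thesis using t by (simp add: F'_def)
  qed
  have \<Phi>t: "\<Phi> t = (\<Sum>p\<le>Suc k. (- 1) ^ p * D p p t)" if "t \<in> {c..d}" for t
    using F't[OF that] that unfolding sum.atMost_Suc_shift
    by (auto simp: F'_def f_def sum_negf algebra_simps)
  show ?case
  proof (intro exI[of _ C] conjI ballI allI impI)
    show "C + integral {c..t} F = (\<Sum>p\<le>Suc k. (- 1) ^ p * D p p t)" if "t \<in> {c..d}" for t
      using \<Phi>t[OF that] by (simp only: \<Phi>_def)
    fix e assume e: "jet_on (Suc (Suc k)) {c..d} e"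
    have ec: "continuous_on {c..d} (e p)" if "p \<le> Suc (Suc k)" for p using jet_on_continuous[OF e that] .
    have j1: "jet_on 1 {c..d} e" using e ec[of 1] by (auto simp: jet_on_def)
    have j: "jet_on (Suc k) {c..d} (\<lambda>p. e (Suc p))" using e by (auto simp: jet_on_def)
    have i1: "(\<lambda>t. \<Sum>p\<le>Suc k. D p 0 t * e (Suc p) t) integrable_on {c..d}"
      using Suc.prems(2) by (intro integrable_continuous_real continuous_intros ec) auto
    have i2: "(\<lambda>t. \<Phi> t * e 1 t) integrable_on {c..d}"
      by (intro integrable_continuous_real continuous_intros ec c\<Phi>) auto
    have "integral {c..d} (\<lambda>t. F t * e 0 t) + integral {c..d} (\<lambda>t. \<Sum>p\<le>Suc k. D p 0 t * e (Suc p) t) =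
       \<Phi> d * e 0 d - \<Phi> c * e 0 c - integral {c..d} (\<lambda>t. \<Phi> t * e 1 t) + integral {c..d} (\<lambda>t. \<Sum>p\<le>Suc k. D p 0 t * e (Suc p) t)"
      using integral_times_jet_by_parts(2)[OF assms(1) Suc.prems(1) j1, of C] by (simp add: \<Phi>_def)
    also have "\<dots> = \<Phi> d * e 0 d - \<Phi> c * e 0 c + integral {c..d} (\<lambda>t. (\<Sum>p\<le>Suc k. D p 0 t * e (Suc p) t) - \<Phi> t * e 1 t)"
      using Henstock_Kurzweil_Integration.integral_diff[OF i1 i2] by simp
    also have "\<dots> = \<Phi> d * e 0 d - \<Phi> c * e 0 c +
        increment (\<lambda>t. \<Sum>p\<le>k. \<Sum>q\<le>p. (- 1) ^ q * D (Suc p) q t * e (Suc (p - q)) t) c d"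
      using split[of "\<lambda>p. e (Suc p)"] ec B[OF j] by simp
    also have "\<dots> = increment (\<lambda>t. \<Sum>p\<le>Suc k. \<Sum>q\<le>p. (- 1) ^ q * D p q t * e (p - q) t) c d"
    proof -
      have "(\<Sum>p\<le>Suc k. \<Sum>q\<le>p. (- 1) ^ q * D p q t * e (p - q) t) =
         \<Phi> t * e 0 t + (\<Sum>p\<le>k. \<Sum>q\<le>p. (- 1) ^ q * D (Suc p) q t * e (Suc (p - q)) t)" if t: "t \<in> {c..d}" for t
      proof -
        have "(\<Sum>p\<le>Suc k. \<Sum>q\<le>p. (- 1) ^ q * D p q t * e (p - q) t) =
           D 0 0 t * e 0 t + (\<Sum>p\<le>k. \<Sum>q\<le>Suc p. (- 1) ^ q * D (Suc p) q t * e (Suc p - q) t)"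
          by (simp only: sum.atMost_Suc_shift[of _ k]) simp
        also have "\<dots> = D 0 0 t * e 0 t + (\<Sum>p\<le>k. (- 1) ^ Suc p * D (Suc p) (Suc p) t * e 0 t) +
            (\<Sum>p\<le>k. \<Sum>q\<le>p. (- 1) ^ q * D (Suc p) q t * e (Suc p - q) t)"
          by (simp add: sum_subtractf sum_negf)
        also have "(\<Sum>p\<le>k. \<Sum>q\<le>p. (- 1) ^ q * D (Suc p) q t * e (Suc p - q) t) =
            (\<Sum>p\<le>k. \<Sum>q\<le>p. (- 1) ^ q * D (Suc p) q t * e (Suc (p - q)) t)"
          by (intro sum.cong refl) (simp add: Suc_diff_le)
        also have "D 0 0 t * e 0 t + (\<Sum>p\<le>k. (- 1) ^ Suc p * D (Suc p) (Suc p) t * e 0 t) = \<Phi> t * e 0 t"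
          unfolding \<Phi>t[OF t] sum.atMost_Suc_shift by (simp add: sum_distrib_right distrib_right)
        finally show ?thesis .
      qed
      then show ?thesis using assms(1) by (simp add: increment_def)
    qed
    finally show "integral {c..d} (\<lambda>t. F t * e 0 t) + integral {c..d} (\<lambda>t. \<Sum>p\<le>Suc k. D p 0 t * e (Suc p) t) =
        increment (\<lambda>t. \<Sum>p\<le>Suc k. \<Sum>q\<le>p. (- 1) ^ q * D p q t * e (p - q) t) c d" .
  qed
qed

section \<open>The weak form of the variational problem\<close>

text \<open>At the ends of the interval the two one-sided derivatives agree, as both are zero.\<close>

lemma test_jet_extend:
  assumes "test_jet k c d e" "c < d" "p < k"
  shows "((\<lambda>t. if t \<in> {c..d} then e p t else 0) has_vector_derivative (if t \<in> {c..d} then e (Suc p) t else 0)) (at t)"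
proof -
  let ?E = "\<lambda>p t. if t \<in> {c..d} then e p t else 0"
  have z: "e p c = 0" "e p d = 0" "e (Suc p) c = 0" "e (Suc p) d = 0" using assms by (auto simp: test_jet_def)
  have D: "(e p has_vector_derivative e (Suc p) t) (at t within {c..d})" if "t \<in> {c..d}"
    using assms that by (auto simp: test_jet_def jet_on_def)
  have cl: "closure (- {c..d}) = {..c} \<union> {d..}"
  proof -
    have "- {c..d} = {..<c} \<union> {d<..}" by auto
    then show ?thesis by simp
  qed
  have int: "closure {c..d} \<inter> closure (- {c..d}) = {c, d}" unfolding cl using assms(2) by auto
  have "(?E p has_vector_derivative (if t \<in> {c..d} then e (Suc p) t else 0)) (at t within UNIV)"
  proof (rule has_vector_derivative_If_within_closures[where f' = "e (Suc p)" and g' = "\<lambda>_. 0" and S = "{c..d}" and T = "- {c..d}"])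
    show "(e p has_vector_derivative e (Suc p) t) (at t within {c..d} \<union> closure {c..d} \<inter> closure (- {c..d}))"
      if "t \<in> {c..d} \<union> closure {c..d} \<inter> closure (- {c..d})"
    proof -
      have "{c..d} \<union> {c, d} = {c..d}" using assms(2) by auto
      then show ?thesis using D that unfolding int by simp
    qed
    have cd: "t = c \<or> t = d" if "t \<in> closure {c..d}" "t \<in> closure (- {c..d})" using int that by blast
    show "e p t = 0" if "t \<in> closure {c..d}" "t \<in> closure (- {c..d})" using cd[OF that] z by auto
    show "e (Suc p) t = 0" if "t \<in> closure {c..d}" "t \<in> closure (- {c..d})" using cd[OF that] z by auto
  qed auto
  then show ?thesis by simp
qed

lemma test_jet_extend_continuous:
  assumes "test_jet k c d e" "c < d" "p \<le> k"
  shows "continuous_on S (\<lambda>t. if t \<in> {c..d} then e p t else 0)"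
proof -
  have c: "continuous_on {c..d} (e p)" using assms by (auto simp: test_jet_def intro: jet_on_continuous)
  have "- {c<..<d} = {..c} \<union> {d..}" by auto
  then have "continuous_on ({c..d} \<union> ({..c} \<union> {d..})) (\<lambda>t. if t \<in> {c..d} then e p t else 0)"
    by (intro continuous_on_If) (use assms c in \<open>auto simp: test_jet_def\<close>)
  moreover have "{c..d} \<union> ({..c} \<union> {d..}) = UNIV" by auto
  ultimately show ?thesis using continuous_on_subset by (metis subset_UNIV)
qed

lemma jet_on_zero_initially:
  assumes "a' < a" "a < b" "jet_on k {a'..b} e" "\<And>t. t \<in> {a'..a} \<Longrightarrow> e 0 t = (0::real)" "p \<le> k" "t \<in> {a'..a}"
  shows "e p t = 0"
  using assms(5,6)
proof (induction p arbitrary: t)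
  case (Suc p)
  have "(e p has_vector_derivative e (Suc p) t) (at t within {a'..b})"
    using assms(2,3) Suc.prems by (auto simp: jet_on_def)
  then have "(e p has_vector_derivative e (Suc p) t) (at t within {a'..a})"
    by (rule has_vector_derivative_within_subset) (use assms(2) in auto)
  moreover have "(e p has_vector_derivative 0) (at t within {a'..a})"
    by (rule has_vector_derivative_transform[OF Suc.prems(2) _ has_vector_derivative_const[of 0]]) (use Suc in auto)
  ultimately show ?case
    using vector_derivative_within_closed_interval[OF assms(1) Suc.prems(2)] by metis
qed (use assms in auto)

lemma jet_on_linear:
  assumes "jet_on k S f" "jet_on k S g"
  shows "jet_on k S (\<lambda>p t. u * f p t + v * g p t)"
  using assms unfolding jet_on_def
  by (auto intro!: continuous_intros has_vector_derivative_add has_vector_derivative_mult_right)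

lemma jet_on_subset:
  assumes "jet_on k S e" "T \<subseteq> S"
  shows "jet_on k T e"
  using assms unfolding jet_on_def
  by (meson continuous_on_subset has_vector_derivative_within_subset subsetD)

lemma sum_slots:
  "(\<Sum>\<sigma>\<in>slots n m k. f \<sigma>) = f SlotT + (\<Sum>i\<in>{1..n}. f (SlotV i)) + (\<Sum>j\<in>{1..m}. f (SlotW j)) +
     (\<Sum>p\<le>k. f (SlotX p)) + (\<Sum>p\<le>k. f (SlotH p) :: real)"
proof -
  have V: "(\<Sum>\<sigma>\<in>SlotV ` {1..n}. f \<sigma>) = (\<Sum>i\<in>{1..n}. f (SlotV i))" by (subst sum.reindex) (auto simp: inj_on_def)
  have W: "(\<Sum>\<sigma>\<in>SlotW ` {1..m}. f \<sigma>) = (\<Sum>j\<in>{1..m}. f (SlotW j))" by (subst sum.reindex) (auto simp: inj_on_def)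
  have X: "(\<Sum>\<sigma>\<in>SlotX ` {0..k}. f \<sigma>) = (\<Sum>p\<le>k. f (SlotX p))" by (subst sum.reindex) (auto simp: inj_on_def atMost_atLeast0)
  have H: "(\<Sum>\<sigma>\<in>SlotH ` {0..k}. f \<sigma>) = (\<Sum>p\<le>k. f (SlotH p))" by (subst sum.reindex) (auto simp: inj_on_def atMost_atLeast0)
  let ?V = "SlotV ` {1..n}" and ?W = "SlotW ` {1..m}" and ?X = "SlotX ` {0..k}" and ?H = "SlotH ` {0..k}"
  have "slots n m k = {SlotT} \<union> (?V \<union> (?W \<union> (?X \<union> ?H)))" by (auto simp: slots_def)
  then have "sum f (slots n m k) = sum f ({SlotT} \<union> (?V \<union> (?W \<union> (?X \<union> ?H))))" by simp
  also have "\<dots> = sum f {SlotT} + sum f (?V \<union> (?W \<union> (?X \<union> ?H)))" by (rule sum.union_disjoint) auto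
  also have "sum f (?V \<union> (?W \<union> (?X \<union> ?H))) = sum f ?V + sum f (?W \<union> (?X \<union> ?H))" by (rule sum.union_disjoint) auto
  also have "sum f (?W \<union> (?X \<union> ?H)) = sum f ?W + sum f (?X \<union> ?H)" by (rule sum.union_disjoint) auto
  also have "sum f (?X \<union> ?H) = sum f ?X + sum f ?H" by (rule sum.union_disjoint) auto
  finally show ?thesis unfolding V W X H by (simp add: add.assoc)
qed

lemma finite_slots: "finite (slots n m k)" by (simp add: slots_def)

lemma continuous_on_RL_integral_left:
  fixes a b \<mu> :: real
  assumes "0 < \<mu>" "continuous_on UNIV E" "\<And>s. s \<notin> {a..b} \<Longrightarrow> E s = 0" "a \<le> b"
  shows "continuous_on {a..b} (\<lambda>t. integral {a..t} (\<lambda>s. (t - s) powr (\<mu> - 1) * E s))"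
proof -
  have "continuous_on {a..b} E" by (rule continuous_on_subset[OF assms(2)]) simp
  then have "bounded (E ` {a..b})" by (intro compact_imp_bounded compact_continuous_image) simp_all
  then obtain C where "\<forall>x\<in>E ` {a..b}. norm x \<le> C" unfolding bounded_iff by blast
  then have "\<bar>E s\<bar> \<le> C" if "s \<in> {a..b}" for s using that by simp
  then have C: "\<bar>E s\<bar> \<le> \<bar>C\<bar>" for s using assms(3)[of s] by (cases "s \<in> {a..b}") force+
  have z: "\<forall>s<a. E s = 0" using assms(3) by auto
  have m: "E \<in> borel_measurable borel" by (rule borel_measurable_continuous_onI[OF assms(2)])
  have "continuous_on {a..b} (\<lambda>t. Gamma \<mu> * rl_int \<mu> E t)"
    by (intro continuous_intros continuous_on_rl_int[OF assms(1,2) C z])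
  then show ?thesis
    by (rule continuous_on_eq)
      (rule integral_unique[symmetric, OF has_integral_rl_int[OF assms(1) integrable_rl_kernel_bounded(1)[OF assms(1) m C z] z]])
qed

lemma continuous_on_RL_integral_right:
  fixes a b \<mu> :: real
  assumes "0 < \<mu>" "continuous_on UNIV E" "\<And>s. s \<notin> {a..b} \<Longrightarrow> E s = 0" "a \<le> b"
  shows "continuous_on {a..b} (\<lambda>t. integral {t..b} (\<lambda>s. (s - t) powr (\<mu> - 1) * E s))"
proof -
  have "continuous_on {- b..- a} (\<lambda>t. integral {- b..t} (\<lambda>s. (t - s) powr (\<mu> - 1) * E (- s)))"
  proof (rule continuous_on_RL_integral_left[OF assms(1)])
    show "continuous_on UNIV (\<lambda>s. E (- s))"
      by (rule continuous_on_compose2[OF assms(2)]) (auto intro!: continuous_intros)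
    show "E (- s) = 0" if "s \<notin> {- b..- a}" for s using that assms(3)[of "- s"] by auto
    show "- b \<le> - a" using assms(4) by simp
  qed
  then have "continuous_on {a..b} (\<lambda>t. integral {- b..- t} (\<lambda>s. (- t - s) powr (\<mu> - 1) * E (- s)))"
    by (rule continuous_on_compose2) (auto intro!: continuous_intros)
  moreover have "integral {- b..- t} (\<lambda>s. (- t - s) powr (\<mu> - 1) * E (- s)) = integral {t..b} (\<lambda>s. (s - t) powr (\<mu> - 1) * E s)" for t
    using integral_reflect_Icc[of b t "\<lambda>s. (s - t) powr (\<mu> - 1) * E s"] by (simp add: minus_diff_commute[of t])
  ultimately show ?thesis by simp
qed

lemma integrable_RL_kernel_continuous_right:
  fixes c d \<mu> :: real
  assumes "0 < \<mu>" "continuous_on {c..d} f" "r \<in> {c..d}"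
  shows "(\<lambda>s. (s - r) powr (\<mu> - 1) * f s) integrable_on {r..d}"
proof -
  have "(\<lambda>s. (- r - s) powr (\<mu> - 1) * f (- s)) integrable_on {- d..- r}"
    by (rule has_integral_integrable[OF has_integral_RL_kernel_continuous[OF assms(1), where c = "- d" and d = "- c" and f = "\<lambda>s. f (- s)" and r = "- r"]])
      (use assms(3) in \<open>auto intro!: continuous_on_compose2[OF assms(2)] continuous_intros\<close>)
  then have "(\<lambda>s. (- s - r) powr (\<mu> - 1) * f (- s)) integrable_on {- d..- r}"
    by (simp add: minus_diff_commute[of r])
  then show ?thesis by (rule iffD1[OF Henstock_Kurzweil_Integration.integrable_reflect_real[where f = "\<lambda>s. (s - r) powr (\<mu> - 1) * f s"]])
qed

text \<open>The hypotheses of the problem, with a choice of densities \<open>gV\<close> and \<open>gW\<close> of which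
the derivatives of \<open>L\<close> in the fractional slots are fractional integrals.\<close>

locale minimizer =
  fixes a b \<tau> :: real and n m k :: nat
    and \<alpha> \<beta> c :: "nat \<Rightarrow> real"
    and \<phi> y :: "real \<Rightarrow> real"
    and L :: "(slot \<Rightarrow> real) \<Rightarrow> real"
    and P :: "slot \<Rightarrow> real \<Rightarrow> real"
    and gV gW :: "nat \<Rightarrow> real \<Rightarrow> real"
  assumes ab: "a < b" and tau: "0 < \<tau>" "\<tau> < b - a"
    and \<alpha>: "\<And>i. i \<in> {1..n} \<Longrightarrow> 0 < \<alpha> i \<and> \<alpha> i \<notin> \<int> \<and> order_N (\<alpha> i) \<le> k"
    and \<beta>: "\<And>j. j \<in> {1..m} \<Longrightarrow> 0 < \<beta> j \<and> \<beta> j \<notin> \<int> \<and> order_N (\<beta> j) \<le> k"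
    and L: "has_continuous_partials {a - \<tau>..b} (slots n m k) L"
    and y: "y \<in> domain_J a b \<tau> n m k \<alpha> \<beta> c \<phi>"
    and min: "\<And>z. z \<in> domain_J a b \<tau> n m k \<alpha> \<beta> c \<phi> \<Longrightarrow>
           functional_J a b \<tau> n m k \<alpha> \<beta> L y \<le> functional_J a b \<tau> n m k \<alpha> \<beta> L z"
    and P: "P = (\<lambda>\<sigma> t. partial {a - \<tau>..b} \<sigma> L (arguments a b \<tau> n m k \<alpha> \<beta> y t))"
    and gV: "\<And>i. i \<in> {1..n} \<Longrightarrow> integrable lborel (gV i) \<and> (\<forall>s<a. gV i s = 0) \<and> (\<forall>s>b. gV i s = 0) \<and>
      (AE t in lborel. t \<in> {a..b} \<longrightarrow> P (SlotV i) t = rl_int_right (\<alpha> i) (gV i) t)"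
    and gW: "\<And>j. j \<in> {1..m} \<Longrightarrow> integrable lborel (gW j) \<and> (\<forall>s<a. gW j s = 0) \<and> (\<forall>s>b. gW j s = 0) \<and>
      (AE t in lborel. t \<in> {a..b} \<longrightarrow> P (SlotW j) t = rl_int (\<beta> j) (gW j) t)"
begin

text \<open>The total contribution of all fractional terms to the weak equation.\<close>

definition density :: "real \<Rightarrow> real" where
  "density t = (\<Sum>i\<in>{1..n}. gV i t) + (\<Sum>j\<in>{1..m}. gW j t)"

text \<open>Sequences of derivatives of variations along which the first variation must vanish.\<close>

definition admissible :: "(nat \<Rightarrow> real \<Rightarrow> real) \<Rightarrow> bool" where
  "admissible e \<longleftrightarrow> jet_on k {a - \<tau>..b} e \<and> (\<forall>t\<in>{a - \<tau>..a}. e 0 t = 0) \<and> (\<forall>p<k. e p b = 0) \<and>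
     (\<forall>i\<in>{1..n}. continuous_on {a..b} (caputo_left {a - \<tau>..b} a (\<alpha> i) (e 0))) \<and>
     (\<forall>j\<in>{1..m}. continuous_on {a..b} (caputo_right {a - \<tau>..b} b (\<beta> j) (e 0)))"

text \<open>The arguments of \<open>L\<close> generated by a sequence of derivatives. The content of the time slot is a parameter:
it is the time for the minimizer, and zero for a variation, since a variation does not move time.\<close>

definition slot_value :: "(nat \<Rightarrow> real \<Rightarrow> real) \<Rightarrow> real \<Rightarrow> real \<Rightarrow> slot \<Rightarrow> real" where
  "slot_value e s t \<sigma> = (case \<sigma> of SlotT \<Rightarrow> s
     | SlotV i \<Rightarrow> caputo_left {a - \<tau>..b} a (\<alpha> i) (e 0) t
     | SlotW j \<Rightarrow> caputo_right {a - \<tau>..b} b (\<beta> j) (e 0) t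
     | SlotX p \<Rightarrow> e p t
     | SlotH p \<Rightarrow> e p (t - \<tau>))"

lemma domain_order: "a - \<tau> < b" "a - \<tau> < a" using ab tau by auto

lemma caputo_left_jet:
  assumes "jet_on k {a - \<tau>..b} e" "i \<in> {1..n}" "t \<in> {a..b}"
  shows "caputo_left {a - \<tau>..b} a (\<alpha> i) (e 0) t = 1 / Gamma (real (order_N (\<alpha> i)) - \<alpha> i) *
     integral {a..t} (\<lambda>s. (t - s) powr (real (order_N (\<alpha> i)) - \<alpha> i - 1) * e (order_N (\<alpha> i)) s)"
    and "(\<lambda>s. (t - s) powr (real (order_N (\<alpha> i)) - \<alpha> i - 1) * e (order_N (\<alpha> i)) s) integrable_on {a..t}"
proof -
  let ?N = "order_N (\<alpha> i)"
  have "integral {a..t} (\<lambda>s. (t - s) powr (real ?N - \<alpha> i - 1) * iter_deriv {a - \<tau>..b} ?N (e 0) s) =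
     integral {a..t} (\<lambda>s. (t - s) powr (real ?N - \<alpha> i - 1) * e ?N s)"
    using iter_deriv_jet(1)[OF domain_order(1) assms(1), of "e 0" ?N] \<alpha>[OF assms(2)] assms(3) domain_order
    by (intro Henstock_Kurzweil_Integration.integral_cong) auto
  then show "caputo_left {a - \<tau>..b} a (\<alpha> i) (e 0) t = 1 / Gamma (real ?N - \<alpha> i) *
     integral {a..t} (\<lambda>s. (t - s) powr (real ?N - \<alpha> i - 1) * e ?N s)"
    by (simp add: caputo_left_def)
  have "continuous_on {a..b} (e ?N)"
    using jet_on_continuous[OF assms(1), of ?N] \<alpha>[OF assms(2)] domain_order by (auto intro: continuous_on_subset)
  then show "(\<lambda>s. (t - s) powr (real ?N - \<alpha> i - 1) * e ?N s) integrable_on {a..t}"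
    using has_integral_RL_kernel_continuous[of "real ?N - \<alpha> i" a b "e ?N" t] order_N_bounds(1)[of "\<alpha> i"] \<alpha>[OF assms(2)] assms(3)
    by (blast intro: has_integral_integrable diff_gt_0_iff_gt[THEN iffD2])
qed

lemma caputo_right_jet:
  assumes "jet_on k {a - \<tau>..b} e" "j \<in> {1..m}" "t \<in> {a..b}"
  shows "caputo_right {a - \<tau>..b} b (\<beta> j) (e 0) t = 1 / Gamma (real (order_N (\<beta> j)) - \<beta> j) *
     integral {t..b} (\<lambda>s. (s - t) powr (real (order_N (\<beta> j)) - \<beta> j - 1) * ((- 1) ^ order_N (\<beta> j) * e (order_N (\<beta> j)) s))"
    and "(\<lambda>s. (s - t) powr (real (order_N (\<beta> j)) - \<beta> j - 1) * ((- 1) ^ order_N (\<beta> j) * e (order_N (\<beta> j)) s)) integrable_on {t..b}"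
proof -
  let ?N = "order_N (\<beta> j)"
  have "integral {t..b} (\<lambda>s. (s - t) powr (real ?N - \<beta> j - 1) * ((- 1) ^ ?N * iter_deriv {a - \<tau>..b} ?N (e 0) s)) =
     integral {t..b} (\<lambda>s. (s - t) powr (real ?N - \<beta> j - 1) * ((- 1) ^ ?N * e ?N s))"
    using iter_deriv_jet(1)[OF domain_order(1) assms(1), of "e 0" ?N] \<beta>[OF assms(2)] assms(3) domain_order
    by (intro Henstock_Kurzweil_Integration.integral_cong) auto
  then show "caputo_right {a - \<tau>..b} b (\<beta> j) (e 0) t = 1 / Gamma (real ?N - \<beta> j) *
     integral {t..b} (\<lambda>s. (s - t) powr (real ?N - \<beta> j - 1) * ((- 1) ^ ?N * e ?N s))"
    by (simp add: caputo_right_def)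
  have "continuous_on {a..b} (e ?N)"
    using jet_on_continuous[OF assms(1), of ?N] \<beta>[OF assms(2)] domain_order by (auto intro: continuous_on_subset)
  then have "continuous_on {a..b} (\<lambda>s. (- 1) ^ ?N * e ?N s)" by (intro continuous_intros)
  then show "(\<lambda>s. (s - t) powr (real ?N - \<beta> j - 1) * ((- 1) ^ ?N * e ?N s)) integrable_on {t..b}"
    by (rule integrable_RL_kernel_continuous_right[rotated])
      (use order_N_bounds(1)[of "\<beta> j"] \<beta>[OF assms(2)] assms(3) in auto)
qed

lemma caputo_linear:
  assumes "jet_on k {a - \<tau>..b} f" "jet_on k {a - \<tau>..b} e" "t \<in> {a..b}"
  shows "i \<in> {1..n} \<Longrightarrow> caputo_left {a - \<tau>..b} a (\<alpha> i) (\<lambda>t. u * f 0 t + v * e 0 t) t =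
      u * caputo_left {a - \<tau>..b} a (\<alpha> i) (f 0) t + v * caputo_left {a - \<tau>..b} a (\<alpha> i) (e 0) t"
    and "j \<in> {1..m} \<Longrightarrow> caputo_right {a - \<tau>..b} b (\<beta> j) (\<lambda>t. u * f 0 t + v * e 0 t) t =
      u * caputo_right {a - \<tau>..b} b (\<beta> j) (f 0) t + v * caputo_right {a - \<tau>..b} b (\<beta> j) (e 0) t"
proof -
  note lin = jet_on_linear[OF assms(1,2), of u v]
  have I: "integral T (\<lambda>s. K s * (u * F s + v * E s)) = u * integral T (\<lambda>s. K s * F s) + v * integral T (\<lambda>s. K s * E s)"
    if "(\<lambda>s. K s * F s) integrable_on T" "(\<lambda>s. K s * E s) integrable_on T" for K F E :: "real \<Rightarrow> real" and T
  proof -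
    have "integral T (\<lambda>s. u * (K s * F s) + v * (K s * E s)) = u * integral T (\<lambda>s. K s * F s) + v * integral T (\<lambda>s. K s * E s)"
      using Henstock_Kurzweil_Integration.integral_add[OF integrable_on_mult_right[OF that(1), of u] integrable_on_mult_right[OF that(2), of v]]
      by simp
    then show ?thesis by (simp add: algebra_simps)
  qed
  show "caputo_left {a - \<tau>..b} a (\<alpha> i) (\<lambda>t. u * f 0 t + v * e 0 t) t =
      u * caputo_left {a - \<tau>..b} a (\<alpha> i) (f 0) t + v * caputo_left {a - \<tau>..b} a (\<alpha> i) (e 0) t" if i: "i \<in> {1..n}"
    unfolding caputo_left_jet(1)[OF lin i assms(3)] caputo_left_jet(1)[OF assms(1) i assms(3)] caputo_left_jet(1)[OF assms(2) i assms(3)]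
      I[OF caputo_left_jet(2)[OF assms(1) i assms(3)] caputo_left_jet(2)[OF assms(2) i assms(3)]]
    by (simp add: algebra_simps)
  show "caputo_right {a - \<tau>..b} b (\<beta> j) (\<lambda>t. u * f 0 t + v * e 0 t) t =
      u * caputo_right {a - \<tau>..b} b (\<beta> j) (f 0) t + v * caputo_right {a - \<tau>..b} b (\<beta> j) (e 0) t" if j: "j \<in> {1..m}"
  proof -
    let ?N = "order_N (\<beta> j)"
    have r: "(- 1) ^ ?N * (u * f ?N s + v * e ?N s) = u * ((- 1) ^ ?N * f ?N s) + v * ((- 1) ^ ?N * e ?N s)" for s
      by (simp add: algebra_simps)
    show ?thesis
      unfolding caputo_right_jet(1)[OF lin j assms(3)] caputo_right_jet(1)[OF assms(1) j assms(3)] caputo_right_jet(1)[OF assms(2) j assms(3)]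
        r I[OF caputo_right_jet(2)[OF assms(1) j assms(3)] caputo_right_jet(2)[OF assms(2) j assms(3)]]
      by (simp add: algebra_simps)
  qed
qed

abbreviation Y :: "nat \<Rightarrow> real \<Rightarrow> real" where "Y p \<equiv> iter_deriv {a - \<tau>..b} p y"

lemma jet_on_Y: "jet_on k {a - \<tau>..b} Y"
  using y by (auto simp: domain_J_def intro: jet_on_iter_deriv)

lemma arguments_jet:
  assumes "jet_on k {a - \<tau>..b} e" "t \<in> {a..b}"
  shows "arguments a b \<tau> n m k \<alpha> \<beta> (e 0) t = restrict (slot_value e t t) (slots n m k)"
proof -
  have "t \<in> {a - \<tau>..b}" "t - \<tau> \<in> {a - \<tau>..b}" using assms(2) tau by auto
  then show ?thesis
    using iter_deriv_jet(1)[OF domain_order(1) assms(1), of "e 0"]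
    unfolding arguments_def by (intro restrict_ext) (auto simp: slot_value_def slots_def split: slot.split)
qed

lemma admissible_perturbation:
  assumes e: "admissible e"
  shows "(\<lambda>t. y t + \<epsilon> * e 0 t) \<in> domain_J a b \<tau> n m k \<alpha> \<beta> c \<phi>"
    and "t \<in> {a..b} \<Longrightarrow> arguments a b \<tau> n m k \<alpha> \<beta> (\<lambda>t. y t + \<epsilon> * e 0 t) t =
       restrict (\<lambda>\<sigma>. slot_value Y t t \<sigma> + \<epsilon> * slot_value e 0 t \<sigma>) (slots n m k)"
proof -
  have je: "jet_on k {a - \<tau>..b} e" using e by (simp add: admissible_def)
  (* The factor 1 puts the perturbed function in the form of a linear combination. *)
  define E where "E = (\<lambda>p t. 1 * Y p t + \<epsilon> * e p t)"
  have jE: "jet_on k {a - \<tau>..b} E" unfolding E_def by (rule jet_on_linear[OF jet_on_Y je])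
  have E0: "E 0 = (\<lambda>t. y t + \<epsilon> * e 0 t)" by (simp add: E_def)
  have cl: "caputo_left {a - \<tau>..b} a (\<alpha> i) (E 0) t = caputo_left {a - \<tau>..b} a (\<alpha> i) y t + \<epsilon> * caputo_left {a - \<tau>..b} a (\<alpha> i) (e 0) t"
    if "i \<in> {1..n}" "t \<in> {a..b}" for i t
    using caputo_linear(1)[OF jet_on_Y je that(2,1), of 1 \<epsilon>] by (simp add: E_def)
  have cr: "caputo_right {a - \<tau>..b} b (\<beta> j) (E 0) t = caputo_right {a - \<tau>..b} b (\<beta> j) y t + \<epsilon> * caputo_right {a - \<tau>..b} b (\<beta> j) (e 0) t"
    if "j \<in> {1..m}" "t \<in> {a..b}" for j t
    using caputo_linear(2)[OF jet_on_Y je that(2,1), of 1 \<epsilon>] by (simp add: E_def)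
  have "E 0 \<in> domain_J a b \<tau> n m k \<alpha> \<beta> c \<phi>"
    unfolding domain_J_def
  proof (intro CollectI conjI ballI allI impI)
    show "times_cont_differentiable_on k {a - \<tau>..b} (E 0)"
      by (rule jet_on_times_cont_differentiable[OF domain_order(1) jE]) simp
    show "continuous_on {a..b} (caputo_left {a - \<tau>..b} a (\<alpha> i) (E 0))" if "i \<in> {1..n}" for i
    proof (subst continuous_on_cong[OF refl cl[OF that]])
      show "continuous_on {a..b} (\<lambda>t. caputo_left {a - \<tau>..b} a (\<alpha> i) y t + \<epsilon> * caputo_left {a - \<tau>..b} a (\<alpha> i) (e 0) t)"
        using e y that by (intro continuous_intros) (auto simp: admissible_def domain_J_def)
    qed
    show "continuous_on {a..b} (caputo_right {a - \<tau>..b} b (\<beta> j) (E 0))" if "j \<in> {1..m}" for j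
    proof (subst continuous_on_cong[OF refl cr[OF that]])
      show "continuous_on {a..b} (\<lambda>t. caputo_right {a - \<tau>..b} b (\<beta> j) y t + \<epsilon> * caputo_right {a - \<tau>..b} b (\<beta> j) (e 0) t)"
        using e y that by (intro continuous_intros) (auto simp: admissible_def domain_J_def)
    qed
    show "iter_deriv {a - \<tau>..b} l (E 0) b = c l" if "l < k" for l
      using iter_deriv_jet(1)[OF domain_order(1) jE, of "E 0" l b] that e y domain_order by (auto simp: E_def admissible_def domain_J_def)
    show "E 0 t = \<phi> t" if "t \<in> {a - \<tau>..a}" for t
      using that e y by (auto simp: E_def admissible_def domain_J_def)
  qed
  then show "(\<lambda>t. y t + \<epsilon> * e 0 t) \<in> domain_J a b \<tau> n m k \<alpha> \<beta> c \<phi>" by (simp add: E0)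
  show "arguments a b \<tau> n m k \<alpha> \<beta> (\<lambda>t. y t + \<epsilon> * e 0 t) t =
       restrict (\<lambda>\<sigma>. slot_value Y t t \<sigma> + \<epsilon> * slot_value e 0 t \<sigma>) (slots n m k)" if t: "t \<in> {a..b}"
    using arguments_jet[OF jE t] cl[OF _ t] cr[OF _ t] unfolding E0
    by (auto simp: slot_value_def slots_def E_def fun_eq_iff restrict_def split: slot.split)
qed

lemma slot_value_continuous:
  assumes "jet_on k {a - \<tau>..b} e" "\<sigma> \<in> slots n m k" "continuous_on {a..b} s"
    and "\<And>i. i \<in> {1..n} \<Longrightarrow> continuous_on {a..b} (caputo_left {a - \<tau>..b} a (\<alpha> i) (e 0))"
    and "\<And>j. j \<in> {1..m} \<Longrightarrow> continuous_on {a..b} (caputo_right {a - \<tau>..b} b (\<beta> j) (e 0))"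
  shows "continuous_on {a..b} (\<lambda>t. slot_value e (s t) t \<sigma>)"
proof -
  have "continuous_on {a..b} (e p)" "continuous_on {a..b} (\<lambda>t. e p (t - \<tau>))" if "p \<le> k" for p
  proof -
    have "continuous_on {a - \<tau>..b} (e p)" by (rule jet_on_continuous[OF assms(1) that])
    then show "continuous_on {a..b} (e p)" "continuous_on {a..b} (\<lambda>t. e p (t - \<tau>))"
      using tau by (auto intro: continuous_on_subset intro!: continuous_on_compose2[of "{a - \<tau>..b}" "e p"] continuous_intros)
  qed
  then show ?thesis using assms(2-) by (cases \<sigma>) (auto simp: slot_value_def slots_def)
qed

lemma slot_value_range: "t \<in> {a..b} \<Longrightarrow> slot_value Y t t \<sigma> + \<epsilon> * slot_value e 0 t \<sigma> \<in> slot_range {a - \<tau>..b} \<sigma>"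
  using tau by (auto simp: slot_range_def slot_value_def)

lemma slot_value_Y_continuous: "\<sigma> \<in> slots n m k \<Longrightarrow> continuous_on {a..b} (\<lambda>t. slot_value Y t t \<sigma>)"
  using y by (intro slot_value_continuous[OF jet_on_Y]) (auto simp: domain_J_def)

lemma P_eq: "t \<in> {a..b} \<Longrightarrow> P \<sigma> t = partial {a - \<tau>..b} \<sigma> L (restrict (slot_value Y t t) (slots n m k))"
  using arguments_jet[OF jet_on_Y, of t] by (simp add: P)

lemma P_continuous:
  assumes "\<sigma> \<in> slots n m k"
  shows "continuous_on {a..b} (P \<sigma>)"
proof -
  have "continuous_on {a..b} (\<lambda>t. restrict (slot_value Y t t) (slots n m k))"
  proof (rule continuous_on_coordinatewise_then_product)
    show "continuous_on {a..b} (\<lambda>t. restrict (slot_value Y t t) (slots n m k) \<sigma>)" for \<sigma>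
      using slot_value_Y_continuous by (cases "\<sigma> \<in> slots n m k") auto
  qed
  then have "continuous_on {a..b} (\<lambda>t. partial {a - \<tau>..b} \<sigma> L (restrict (slot_value Y t t) (slots n m k)))"
  proof (rule continuous_on_compose2[rotated])
    show "continuous_on (lagrangian_domain {a - \<tau>..b} (slots n m k)) (partial {a - \<tau>..b} \<sigma> L)"
      using L assms by (simp add: has_continuous_partials_def)
    show "(\<lambda>t. restrict (slot_value Y t t) (slots n m k)) ` {a..b} \<subseteq> lagrangian_domain {a - \<tau>..b} (slots n m k)"
      using slot_value_range[where \<epsilon> = 0] by (auto simp: lagrangian_domain_def)
  qed
  then show ?thesis by (rule continuous_on_eq) (simp add: P_eq)
qed

text \<open>The first variation, slot by slot. The fractional terms are rewritten with integration by parts; the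
delayed terms are shifted, and lose the part of the integral where the variation vanishes.\<close>

lemma weak_form:
  assumes e: "admissible e"
  shows "(\<lambda>t. density t * e 0 t) integrable_on {a..b}"
    and "integral {a..b} (\<lambda>t. density t * e 0 t) + integral {a..b} (\<lambda>t. \<Sum>p\<le>k. P (SlotX p) t * e p t) +
      integral {a..b - \<tau>} (\<lambda>t. \<Sum>p\<le>k. P (SlotH p) (t + \<tau>) * e p t) = 0"
proof -
  have je: "jet_on k {a - \<tau>..b} e" using e by (simp add: admissible_def)
  have ez: "e p t = 0" if "p \<le> k" "t \<in> {a - \<tau>..a}" for p t
    by (rule jet_on_zero_initially[OF domain_order(2) ab je _ that]) (use e in \<open>auto simp: admissible_def\<close>)
  have eb: "e p b = 0" if "p < k" for p using e that by (auto simp: admissible_def)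
  have de: "(e p has_vector_derivative e (Suc p) t) (at t within {a..b})" if "p < k" "t \<in> {a..b}" for p t
    using jet_on_subset[OF je, of "{a..b}"] that tau by (auto simp: jet_on_def)
  have ce: "continuous_on {a - \<tau>..b} (e p)" if "p \<le> k" for p using jet_on_continuous[OF je that] .
  have ce': "continuous_on {a..b} (e p)" if "p \<le> k" for p
    by (rule continuous_on_subset[OF ce[OF that]]) (use tau in auto)
  have V: "((\<lambda>t. slot_value e 0 t (SlotV i) * P (SlotV i) t) has_integral integral {a..b} (\<lambda>t. gV i t * e 0 t)) {a..b}
      \<and> (\<lambda>t. gV i t * e 0 t) integrable_on {a..b}" if i: "i \<in> {1..n}" for i
  proof -
    have N: "order_N (\<alpha> i) \<le> k" "0 < \<alpha> i" "\<alpha> i < real (order_N (\<alpha> i))"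
      using \<alpha>[OF i] order_N_bounds by auto
    have "((\<lambda>t. P (SlotV i) t * (1 / Gamma (real (order_N (\<alpha> i)) - \<alpha> i) *
        integral {a..t} (\<lambda>s. (t - s) powr (real (order_N (\<alpha> i)) - \<alpha> i - 1) * e (order_N (\<alpha> i)) s)))
        has_integral integral {a..b} (\<lambda>t. gV i t * e 0 t)) {a..b} \<and> (\<lambda>t. gV i t * e 0 t) integrable_on {a..b}"
      by (intro conjI fractional_integration_by_parts[OF ab N(2,3)]) (use gV[OF i] N(1) de ce' ez ab tau in auto)
    moreover from this[THEN conjunct1] have "((\<lambda>t. slot_value e 0 t (SlotV i) * P (SlotV i) t) has_integral
        integral {a..b} (\<lambda>t. gV i t * e 0 t)) {a..b}"
      by (rule has_integral_eq[rotated]) (simp add: slot_value_def caputo_left_jet(1)[OF je i])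
    ultimately show ?thesis by blast
  qed
  have W: "((\<lambda>t. slot_value e 0 t (SlotW j) * P (SlotW j) t) has_integral integral {a..b} (\<lambda>t. gW j t * e 0 t)) {a..b}
      \<and> (\<lambda>t. gW j t * e 0 t) integrable_on {a..b}" if j: "j \<in> {1..m}" for j
  proof -
    have N: "order_N (\<beta> j) \<le> k" "0 < \<beta> j" "\<beta> j < real (order_N (\<beta> j))"
      using \<beta>[OF j] order_N_bounds by auto
    have "((\<lambda>t. P (SlotW j) t * (1 / Gamma (real (order_N (\<beta> j)) - \<beta> j) *
        integral {t..b} (\<lambda>s. (s - t) powr (real (order_N (\<beta> j)) - \<beta> j - 1) * ((- 1) ^ order_N (\<beta> j) * e (order_N (\<beta> j)) s))))
        has_integral integral {a..b} (\<lambda>t. gW j t * e 0 t)) {a..b} \<and> (\<lambda>t. gW j t * e 0 t) integrable_on {a..b}"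
      by (intro conjI fractional_integration_by_parts_right[OF ab N(2,3)]) (use gW[OF j] N(1) de ce' eb ab in auto)
    moreover from this[THEN conjunct1] have "((\<lambda>t. slot_value e 0 t (SlotW j) * P (SlotW j) t) has_integral
        integral {a..b} (\<lambda>t. gW j t * e 0 t)) {a..b}"
      by (rule has_integral_eq[rotated]) (simp add: slot_value_def caputo_right_jet(1)[OF je j])
    ultimately show ?thesis by blast
  qed
  have X: "((\<lambda>t. \<Sum>p\<le>k. slot_value e 0 t (SlotX p) * P (SlotX p) t) has_integral
      integral {a..b} (\<lambda>t. \<Sum>p\<le>k. P (SlotX p) t * e p t)) {a..b}"
  proof -
    have "(\<lambda>t. \<Sum>p\<le>k. P (SlotX p) t * e p t) integrable_on {a..b}"
      by (intro integrable_continuous_real continuous_intros P_continuous ce') (auto simp: slots_def)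
    then show ?thesis by (simp add: slot_value_def has_integral_integral mult.commute)
  qed
  have H: "((\<lambda>t. \<Sum>p\<le>k. slot_value e 0 t (SlotH p) * P (SlotH p) t) has_integral
      integral {a..b - \<tau>} (\<lambda>t. \<Sum>p\<le>k. P (SlotH p) (t + \<tau>) * e p t)) {a..b}"
  proof -
    let ?f = "\<lambda>t. \<Sum>p\<le>k. P (SlotH p) (t + \<tau>) * e p t"
    have cf: "continuous_on {a - \<tau>..b - \<tau>} ?f"
    proof (intro continuous_intros)
      fix p assume p: "p \<in> {..k}"
      show "continuous_on {a - \<tau>..b - \<tau>} (\<lambda>t. P (SlotH p) (t + \<tau>))"
        by (rule continuous_on_compose2[OF P_continuous]) (use p in \<open>auto simp: slots_def intro!: continuous_intros\<close>)
      show "continuous_on {a - \<tau>..b - \<tau>} (e p)"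
        by (rule continuous_on_subset[OF ce]) (use p tau in auto)
    qed
    have "integral {a..b} (?f \<circ> (\<lambda>x. x + - \<tau>)) = integral {a + - \<tau>..b + - \<tau>} ?f"
      by (rule integral_shift) (use cf in simp)
    also have "\<dots> = integral {a - \<tau>..a} ?f + integral {a..b - \<tau>} ?f"
      using Henstock_Kurzweil_Integration.integral_combine[of "a - \<tau>" a "b - \<tau>" ?f] integrable_continuous_real[OF cf] tau by simp
    also have "integral {a - \<tau>..a} ?f = integral {a - \<tau>..a} (\<lambda>t. 0)"
      by (rule Henstock_Kurzweil_Integration.integral_cong) (use ez in simp)
    also have "\<dots> = (0 :: real)" by simp
    finally have eq: "integral {a..b} (?f \<circ> (\<lambda>x. x + - \<tau>)) = integral {a..b - \<tau>} ?f" by (simp only: add_0_left)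
    have "continuous_on {a..b} (\<lambda>x. ?f (x + - \<tau>))"
      by (rule continuous_on_compose2[OF cf]) (auto intro!: continuous_intros)
    then have "(?f \<circ> (\<lambda>x. x + - \<tau>)) integrable_on {a..b}"
      unfolding o_def by (rule integrable_continuous_real)
    from integrable_integral[OF this] show ?thesis unfolding eq by (simp add: slot_value_def o_def mult.commute)
  qed
  have sumG: "integral {a..b} (\<lambda>t. density t * e 0 t) = (\<Sum>i\<in>{1..n}. integral {a..b} (\<lambda>t. gV i t * e 0 t)) + (\<Sum>j\<in>{1..m}. integral {a..b} (\<lambda>t. gW j t * e 0 t))"
    and intG: "(\<lambda>t. density t * e 0 t) integrable_on {a..b}"
  proof -
    have "((\<lambda>t. (\<Sum>i\<in>{1..n}. gV i t * e 0 t) + (\<Sum>j\<in>{1..m}. gW j t * e 0 t)) has_integral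
       (\<Sum>i\<in>{1..n}. integral {a..b} (\<lambda>t. gV i t * e 0 t)) + (\<Sum>j\<in>{1..m}. integral {a..b} (\<lambda>t. gW j t * e 0 t))) {a..b}"
      using V W by (intro has_integral_add has_integral_sum integrable_integral) auto
    then have "((\<lambda>t. density t * e 0 t) has_integral
       (\<Sum>i\<in>{1..n}. integral {a..b} (\<lambda>t. gV i t * e 0 t)) + (\<Sum>j\<in>{1..m}. integral {a..b} (\<lambda>t. gW j t * e 0 t))) {a..b}"
      by (simp add: density_def sum_distrib_right distrib_right)
    then show "integral {a..b} (\<lambda>t. density t * e 0 t) = (\<Sum>i\<in>{1..n}. integral {a..b} (\<lambda>t. gV i t * e 0 t)) + (\<Sum>j\<in>{1..m}. integral {a..b} (\<lambda>t. gW j t * e 0 t))"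
      "(\<lambda>t. density t * e 0 t) integrable_on {a..b}" by (auto simp: integral_unique)
  qed
  show "(\<lambda>t. density t * e 0 t) integrable_on {a..b}" by (rule intG)
  have tot: "((\<lambda>t. \<Sum>\<sigma>\<in>slots n m k. slot_value e 0 t \<sigma> * P \<sigma> t) has_integral
      0 + (\<Sum>i\<in>{1..n}. integral {a..b} (\<lambda>t. gV i t * e 0 t)) + (\<Sum>j\<in>{1..m}. integral {a..b} (\<lambda>t. gW j t * e 0 t)) +
      integral {a..b} (\<lambda>t. \<Sum>p\<le>k. P (SlotX p) t * e p t) +
      integral {a..b - \<tau>} (\<lambda>t. \<Sum>p\<le>k. P (SlotH p) (t + \<tau>) * e p t)) {a..b}"
    unfolding sum_slots using V W
    by (intro has_integral_add has_integral_sum X H) (auto simp: slot_value_def)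
  have "integral {a..b} (\<lambda>t. \<Sum>\<sigma>\<in>slots n m k. slot_value e 0 t \<sigma> * partial {a - \<tau>..b} \<sigma> L (restrict (slot_value Y t t) (slots n m k))) = 0"
  proof (rule first_variation_eq_0[OF L finite_slots])
    fix \<epsilon> :: real
    have "integral {a..b} (\<lambda>t. L (restrict (slot_value Y t t) (slots n m k))) = functional_J a b \<tau> n m k \<alpha> \<beta> L y"
      unfolding functional_J_def using arguments_jet[OF jet_on_Y]
      by (intro Henstock_Kurzweil_Integration.integral_cong) simp
    also have "\<dots> \<le> functional_J a b \<tau> n m k \<alpha> \<beta> L (\<lambda>t. y t + \<epsilon> * e 0 t)"
      by (rule min[OF admissible_perturbation(1)[OF e]])
    also have "\<dots> = integral {a..b} (\<lambda>t. L (restrict (\<lambda>\<sigma>. slot_value Y t t \<sigma> + \<epsilon> * slot_value e 0 t \<sigma>) (slots n m k)))"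
      unfolding functional_J_def using admissible_perturbation(2)[OF e]
      by (intro Henstock_Kurzweil_Integration.integral_cong) simp
    finally show "integral {a..b} (\<lambda>t. L (restrict (slot_value Y t t) (slots n m k))) \<le>
      integral {a..b} (\<lambda>t. L (restrict (\<lambda>\<sigma>. slot_value Y t t \<sigma> + \<epsilon> * slot_value e 0 t \<sigma>) (slots n m k)))" .
  next
    show "continuous_on {a..b} (\<lambda>t. slot_value e 0 t \<sigma>)" if "\<sigma> \<in> slots n m k" for \<sigma>
      by (rule slot_value_continuous[OF je that]) (use e in \<open>auto simp: admissible_def\<close>)
  qed (auto intro: slot_value_Y_continuous slot_value_range)
  also have "integral {a..b} (\<lambda>t. \<Sum>\<sigma>\<in>slots n m k. slot_value e 0 t \<sigma> * partial {a - \<tau>..b} \<sigma> L (restrict (slot_value Y t t) (slots n m k))) =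
     integral {a..b} (\<lambda>t. \<Sum>\<sigma>\<in>slots n m k. slot_value e 0 t \<sigma> * P \<sigma> t)"
    by (intro Henstock_Kurzweil_Integration.integral_cong sum.cong refl) (simp add: P_eq)
  finally show "integral {a..b} (\<lambda>t. density t * e 0 t) + integral {a..b} (\<lambda>t. \<Sum>p\<le>k. P (SlotX p) t * e p t) +
      integral {a..b - \<tau>} (\<lambda>t. \<Sum>p\<le>k. P (SlotH p) (t + \<tau>) * e p t) = 0"
    unfolding sumG using integral_unique[OF tot] by simp
qed

text \<open>A Caputo derivative of a function whose \<open>N\<close>-th derivative is continuous on the whole line and
vanishes outside \<open>[a, b]\<close> is continuous, being a convolution.\<close>

lemma admissible_test:
  assumes e: "test_jet k c' d e" and cd: "c' < d" "a \<le> c'" "d \<le> b"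
  shows "admissible (\<lambda>p t. if t \<in> {c'..d} then e p t else 0)"
proof -
  define E where "E = (\<lambda>p t. if t \<in> {c'..d} then e p t else 0)"
  have cont: "continuous_on T (E p)" if "p \<le> k" for p T
    unfolding E_def by (rule test_jet_extend_continuous[OF e cd(1) that])
  have j: "jet_on k {a - \<tau>..b} E"
    unfolding jet_on_def
  proof (intro conjI allI impI ballI cont order_refl)
    fix p t assume "p < k"
    from test_jet_extend[OF e cd(1) this, of t] show "(E p has_vector_derivative E (Suc p) t) (at t within {a - \<tau>..b})"
      unfolding E_def by (rule has_vector_derivative_at_within)
  qed
  have z: "E p s = 0" if "s \<notin> {a..b}" for p s using that cd by (auto simp: E_def)
  have z0: "E p t = 0" if "p \<le> k" "t \<le> a \<or> b \<le> t" for p t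
    using that cd e by (auto simp: E_def test_jet_def) (metis order_antisym order_trans)+
  have "admissible E" unfolding admissible_def
  proof (intro conjI ballI allI impI)
    show "continuous_on {a..b} (caputo_left {a - \<tau>..b} a (\<alpha> i) (E 0))" if i: "i \<in> {1..n}" for i
    proof (subst continuous_on_cong[OF refl caputo_left_jet(1)[OF j i]])
      show "continuous_on {a..b} (\<lambda>t. 1 / Gamma (real (order_N (\<alpha> i)) - \<alpha> i) *
        integral {a..t} (\<lambda>s. (t - s) powr (real (order_N (\<alpha> i)) - \<alpha> i - 1) * E (order_N (\<alpha> i)) s))"
        by (intro continuous_on_mult continuous_on_const continuous_on_RL_integral_left cont z)
          (use \<alpha>[OF i] order_N_bounds ab in auto)
    qed
    show "continuous_on {a..b} (caputo_right {a - \<tau>..b} b (\<beta> j') (E 0))" if i: "j' \<in> {1..m}" for j'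
    proof (subst continuous_on_cong[OF refl caputo_right_jet(1)[OF j i]])
      show "continuous_on {a..b} (\<lambda>t. 1 / Gamma (real (order_N (\<beta> j')) - \<beta> j') *
        integral {t..b} (\<lambda>s. (s - t) powr (real (order_N (\<beta> j')) - \<beta> j' - 1) * ((- 1) ^ order_N (\<beta> j') * E (order_N (\<beta> j')) s)))"
        by (intro continuous_on_mult continuous_on_const continuous_on_RL_integral_right cont)
          (use \<beta>[OF i] order_N_bounds ab z in auto)
    qed
  qed (use j z0 in auto)
  then show ?thesis by (simp add: E_def)
qed

end

section \<open>The necessary conditions\<close>

text \<open>The left-hand side of the weak equation on \<open>[c, d]\<close>. The terms of order zero are collected in \<open>F\<close>, which
is merely integrable, whereas \<open>R p\<close> for positive \<open>p\<close> is the continuous coefficient of the derivative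
of order \<open>p\<close>.\<close>

definition piece_form :: "nat \<Rightarrow> real \<Rightarrow> real \<Rightarrow> (real \<Rightarrow> real) \<Rightarrow> (nat \<Rightarrow> real \<Rightarrow> real) \<Rightarrow> (nat \<Rightarrow> real \<Rightarrow> real) \<Rightarrow> real" where
  "piece_form k c d F R e = integral {c..d} (\<lambda>t. F t * e 0 t) + integral {c..d} (\<lambda>t. \<Sum>p<k. R (Suc p) t * e (Suc p) t)"

lemma piece_form_cong:
  assumes "\<And>p t. t \<in> {c..d} \<Longrightarrow> e p t = e' p t"
  shows "piece_form k c d F R e = piece_form k c d F R e'"
  unfolding piece_form_def using assms
  by (intro arg_cong2[of _ _ _ _ "(+)"] Henstock_Kurzweil_Integration.integral_cong) auto

lemma piece_form_zero: "piece_form k c d F R (\<lambda>p t. 0) = 0"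
  by (simp add: piece_form_def)

lemma piece_form_rearrange:
  assumes "(\<lambda>t. g t * e 0 t) integrable_on {c..d}" "\<And>p. p \<le> k \<Longrightarrow> continuous_on {c..d} (R p)"
    and "\<And>p. p \<le> k \<Longrightarrow> continuous_on {c..d} (e p)"
  shows "integral {c..d} (\<lambda>t. g t * e 0 t) + integral {c..d} (\<lambda>t. \<Sum>p\<le>k. R p t * e p t) =
    piece_form k c d (\<lambda>t. g t + (if t \<in> {c..d} then R 0 t else 0)) R e"
proof -
  let ?F = "\<lambda>t. g t + (if t \<in> {c..d} then R 0 t else 0)"
  have i0: "(\<lambda>t. R 0 t * e 0 t) integrable_on {c..d}"
    using assms(2)[of 0] assms(3)[of 0] by (intro integrable_continuous_real continuous_intros) auto
  have i1: "(\<lambda>t. \<Sum>p<k. R (Suc p) t * e (Suc p) t) integrable_on {c..d}"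
    by (intro integrable_continuous_real continuous_intros assms(2,3)) auto
  have "integral {c..d} (\<lambda>t. ?F t * e 0 t) = integral {c..d} (\<lambda>t. g t * e 0 t + R 0 t * e 0 t)"
    by (rule Henstock_Kurzweil_Integration.integral_cong) (auto simp: distrib_right)
  also have "\<dots> = integral {c..d} (\<lambda>t. g t * e 0 t) + integral {c..d} (\<lambda>t. R 0 t * e 0 t)"
    by (rule Henstock_Kurzweil_Integration.integral_add[OF assms(1) i0])
  finally have 1: "integral {c..d} (\<lambda>t. ?F t * e 0 t) = integral {c..d} (\<lambda>t. g t * e 0 t) + integral {c..d} (\<lambda>t. R 0 t * e 0 t)" .
  have "integral {c..d} (\<lambda>t. \<Sum>p\<le>k. R p t * e p t) =
     integral {c..d} (\<lambda>t. R 0 t * e 0 t) + integral {c..d} (\<lambda>t. \<Sum>p<k. R (Suc p) t * e (Suc p) t)"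
    unfolding sum.atMost_shift by (rule Henstock_Kurzweil_Integration.integral_add[OF i0 i1])
  then show ?thesis unfolding piece_form_def 1 by simp
qed

lemma piece_euler_poisson:
  assumes "c < d" "0 < k" "integrable lborel F"
    and R: "\<And>p. p \<in> {1..k} \<Longrightarrow> continuous_on {c..d} (R p)"
    and ex: "\<And>p t. p \<in> {1..k} \<Longrightarrow> t \<in> {c..d} \<Longrightarrow> iter_deriv_exists {c..d} (p - 1) (R p) t"
    and weak: "\<And>e. test_jet k c d e \<Longrightarrow> piece_form k c d F R e = 0"
  shows "\<exists>C. \<forall>t\<in>{c..d}. C + integral {c..t} F = (\<Sum>p<k. (- 1) ^ p * iter_deriv {c..d} p (R (Suc p)) t)"
    and "jet_on k {c..d} e \<Longrightarrow> piece_form k c d F R e =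
      increment (\<lambda>t. \<Sum>p<k. \<Sum>q\<le>p. (- 1) ^ q * iter_deriv {c..d} q (R (Suc p)) t * e (p - q) t) c d"
proof -
  obtain k' where k: "k = Suc k'" using assms(2) by (cases k) auto
  define D where "D = (\<lambda>p q. iter_deriv {c..d} q (R (Suc p)))"
  have 1: "continuous_on {c..d} (D p 0)" if "p \<le> k'" for p using R[of "Suc p"] that by (simp add: D_def k)
  have 2: "(D p q has_vector_derivative D p (Suc q) t) (at t within {c..d})" if "p \<le> k'" "q < p" "t \<in> {c..d}" for p q t
    unfolding D_def by (rule iter_deriv_has_vector_derivative[OF _ that(3,2)]) (use ex[of "Suc p" t] that k in simp)
  have 3: "integral {c..d} (\<lambda>t. F t * e 0 t) + integral {c..d} (\<lambda>t. \<Sum>p\<le>k'. D p 0 t * e (Suc p) t) = 0"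
    if "test_jet (Suc k') c d e" for e
    using weak[of e] that by (simp add: piece_form_def k D_def lessThan_Suc_atMost)
  have "\<exists>C. (\<forall>t\<in>{c..d}. C + integral {c..t} F = (\<Sum>p\<le>k'. (- 1) ^ p * D p p t)) \<and>
    (\<forall>e. jet_on (Suc k') {c..d} e \<longrightarrow>
      integral {c..d} (\<lambda>t. F t * e 0 t) + integral {c..d} (\<lambda>t. \<Sum>p\<le>k'. D p 0 t * e (Suc p) t) =
      increment (\<lambda>t. \<Sum>p\<le>k'. \<Sum>q\<le>p. (- 1) ^ q * D p q t * e (p - q) t) c d)"
    by (rule euler_poisson[where D = D, OF assms(1,3) 1 2 3])
  then obtain C where C: "\<forall>t\<in>{c..d}. C + integral {c..t} F = (\<Sum>p\<le>k'. (- 1) ^ p * D p p t)"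
    and B: "\<forall>e. jet_on (Suc k') {c..d} e \<longrightarrow>
      integral {c..d} (\<lambda>t. F t * e 0 t) + integral {c..d} (\<lambda>t. \<Sum>p\<le>k'. D p 0 t * e (Suc p) t) =
      increment (\<lambda>t. \<Sum>p\<le>k'. \<Sum>q\<le>p. (- 1) ^ q * D p q t * e (p - q) t) c d"
    by blast
  show "\<exists>C. \<forall>t\<in>{c..d}. C + integral {c..t} F = (\<Sum>p<k. (- 1) ^ p * iter_deriv {c..d} p (R (Suc p)) t)"
    using C by (auto simp: D_def k lessThan_Suc_atMost intro!: exI[of _ C])
  show "piece_form k c d F R e =
      increment (\<lambda>t. \<Sum>p<k. \<Sum>q\<le>p. (- 1) ^ q * iter_deriv {c..d} q (R (Suc p)) t * e (p - q) t) c d"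
    if "jet_on k {c..d} e"
    using B[rule_format, of e] that by (simp add: piece_form_def k D_def lessThan_Suc_atMost)
qed

text \<open>The integrated equation, differentiated at \<open>t\<close>. Each \<open>V i\<close> and \<open>W j\<close> is the derivative at this one point
of the indefinite integral of a density, which need not be continuous.\<close>

lemma pointwise_equation:
  assumes "c < d" "t \<in> {c..d}"
    and eq: "\<And>t. t \<in> {c..d} \<Longrightarrow> C + integral {c..t} (\<lambda>t. (\<Sum>i\<in>I. gV i t) + (\<Sum>j\<in>J. gW j t) + (if t \<in> {c..d} then R 0 t else 0)) =
       (\<Sum>p<k. (- 1) ^ p * iter_deriv {c..d} p (R (Suc p)) t)"
    and "finite I" "finite J"
    and "\<And>i. i \<in> I \<Longrightarrow> integrable lborel (gV i)" "\<And>j. j \<in> J \<Longrightarrow> integrable lborel (gW j)"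
    and V: "\<And>i. i \<in> I \<Longrightarrow> ((\<lambda>x. integral {c..x} (gV i)) has_vector_derivative V i) (at t within {c..d})"
    and W: "\<And>j. j \<in> J \<Longrightarrow> ((\<lambda>x. integral {c..x} (gW j)) has_vector_derivative W j) (at t within {c..d})"
    and R0: "continuous_on {c..d} (R 0)"
    and ex: "\<And>p. p < k \<Longrightarrow> iter_deriv_exists {c..d} (Suc p) (R (Suc p)) t"
  shows "(\<Sum>i\<in>I. V i) + (\<Sum>j\<in>J. W j) + (\<Sum>p\<le>k. (- 1) ^ p * iter_deriv {c..d} p (R p) t) = 0"
proof -
  have "((\<lambda>x. integral {c..x} (R 0)) has_vector_derivative R 0 t) (at t within {c..d})"
    by (rule integral_has_vector_derivative[OF R0 assms(2)])
  then have A: "((\<lambda>x. C + ((\<Sum>i\<in>I. integral {c..x} (gV i)) + (\<Sum>j\<in>J. integral {c..x} (gW j)) + integral {c..x} (R 0)))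
     has_vector_derivative 0 + ((\<Sum>i\<in>I. V i) + (\<Sum>j\<in>J. W j) + R 0 t)) (at t within {c..d})"
    by (intro has_vector_derivative_add has_vector_derivative_const has_vector_derivative_sum V W)
  have B: "(\<Sum>p<k. (- 1) ^ p * iter_deriv {c..d} p (R (Suc p)) x) =
      C + ((\<Sum>i\<in>I. integral {c..x} (gV i)) + (\<Sum>j\<in>J. integral {c..x} (gW j)) + integral {c..x} (R 0))"
    if x: "x \<in> {c..d}" for x
  proof -
    have "((\<lambda>t. (\<Sum>i\<in>I. gV i t) + (\<Sum>j\<in>J. gW j t) + R 0 t) has_integral
      (\<Sum>i\<in>I. integral {c..x} (gV i)) + (\<Sum>j\<in>J. integral {c..x} (gW j)) + integral {c..x} (R 0)) {c..x}"
    proof (intro has_integral_add has_integral_sum integrable_integral)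
      show "R 0 integrable_on {c..x}"
        by (rule integrable_continuous_real, rule continuous_on_subset[OF R0]) (use x in auto)
    qed (use assms in \<open>auto intro: integrable_on_Icc_of_lborel\<close>)
    then have "((\<lambda>t. (\<Sum>i\<in>I. gV i t) + (\<Sum>j\<in>J. gW j t) + (if t \<in> {c..d} then R 0 t else 0)) has_integral
      (\<Sum>i\<in>I. integral {c..x} (gV i)) + (\<Sum>j\<in>J. integral {c..x} (gW j)) + integral {c..x} (R 0)) {c..x}"
      by (rule has_integral_eq[rotated]) (use x in auto)
    then show ?thesis using eq[OF x] by (simp only: integral_unique)
  qed
  have 1: "((\<lambda>x. \<Sum>p<k. (- 1) ^ p * iter_deriv {c..d} p (R (Suc p)) x) has_vector_derivative
      0 + ((\<Sum>i\<in>I. V i) + (\<Sum>j\<in>J. W j) + R 0 t)) (at t within {c..d})"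
    by (rule has_vector_derivative_transform[OF assms(2) B A])
  have "(iter_deriv {c..d} p (R (Suc p)) has_vector_derivative iter_deriv {c..d} (Suc p) (R (Suc p)) t) (at t within {c..d})"
    if "p < k" for p by (rule iter_deriv_has_vector_derivative[OF ex[OF that] assms(2)]) simp
  then have 2: "((\<lambda>x. \<Sum>p<k. (- 1) ^ p * iter_deriv {c..d} p (R (Suc p)) x) has_vector_derivative
      (\<Sum>p<k. (- 1) ^ p * iter_deriv {c..d} (Suc p) (R (Suc p)) t)) (at t within {c..d})"
    by (intro has_vector_derivative_sum has_vector_derivative_mult_right) (auto simp del: iter_deriv.simps)
  have "(\<Sum>i\<in>I. V i) + (\<Sum>j\<in>J. W j) + R 0 t = (\<Sum>p<k. (- 1) ^ p * iter_deriv {c..d} (Suc p) (R (Suc p)) t)"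
    using vector_derivative_within_closed_interval[OF assms(1,2) 1]
      vector_derivative_within_closed_interval[OF assms(1,2) 2] by simp
  then show ?thesis unfolding sum.atMost_shift by (simp add: sum_negf del: iter_deriv.simps(2))
qed

text \<open>The differentiability assumed on the two pieces, one order less than occurs in the Euler-Lagrange
equations.\<close>

locale regular_minimizer = minimizer +
  assumes k: "0 < k"
    and exX1: "\<And>p t. p \<in> {1..k} \<Longrightarrow> t \<in> {a..b - \<tau>} \<Longrightarrow> iter_deriv_exists {a..b - \<tau>} (p - 1) (P (SlotX p)) t"
    and exH: "\<And>p t. p \<in> {1..k} \<Longrightarrow> t \<in> {a..b - \<tau>} \<Longrightarrow> iter_deriv_exists {a..b - \<tau>} (p - 1) (\<lambda>t. P (SlotH p) (t + \<tau>)) t"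
    and exX2: "\<And>p t. p \<in> {1..k} \<Longrightarrow> t \<in> {b - \<tau>..b} \<Longrightarrow> iter_deriv_exists {b - \<tau>..b} (p - 1) (P (SlotX p)) t"
begin

text \<open>On the first piece the delayed slot contributes, shifted in time; the factors \<open>1\<close> display the sum as
a linear combination.\<close>

definition coeff_first :: "nat \<Rightarrow> real \<Rightarrow> real" where
  "coeff_first p = (\<lambda>t. 1 * P (SlotX p) t + 1 * P (SlotH p) (t + \<tau>))"

definition coeff_last :: "nat \<Rightarrow> real \<Rightarrow> real" where
  "coeff_last p = P (SlotX p)"

definition zeroth_first :: "real \<Rightarrow> real" where
  "zeroth_first t = density t + (if t \<in> {a..b - \<tau>} then coeff_first 0 t else 0)"

definition zeroth_last :: "real \<Rightarrow> real" where
  "zeroth_last t = density t + (if t \<in> {b - \<tau>..b} then coeff_last 0 t else 0)"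

lemma coeff_first_continuous: "p \<le> k \<Longrightarrow> continuous_on {a..b - \<tau>} (coeff_first p)"
  unfolding coeff_first_def
proof (intro continuous_intros)
  assume p: "p \<le> k"
  then have s: "SlotX p \<in> slots n m k" "SlotH p \<in> slots n m k" by (auto simp: slots_def)
  show "continuous_on {a..b - \<tau>} (P (SlotX p))"
    by (rule continuous_on_subset[OF P_continuous[OF s(1)]]) (use tau in auto)
  show "continuous_on {a..b - \<tau>} (\<lambda>t. P (SlotH p) (t + \<tau>))"
    by (rule continuous_on_compose2[OF P_continuous[OF s(2)]]) (use tau in \<open>auto intro!: continuous_intros\<close>)
qed

lemma coeff_last_continuous: "p \<le> k \<Longrightarrow> continuous_on {b - \<tau>..b} (coeff_last p)"
  unfolding coeff_last_def by (rule continuous_on_subset[OF P_continuous]) (use tau in \<open>auto simp: slots_def\<close>)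

lemma density_integrable: "integrable lborel density"
  unfolding density_def using gV gW by (intro Bochner_Integration.integrable_add Bochner_Integration.integrable_sum) auto

lemma zeroth_integrable: "integrable lborel zeroth_first" "integrable lborel zeroth_last"
  unfolding zeroth_first_def zeroth_last_def
  by (intro Bochner_Integration.integrable_add density_integrable integrable_truncate coeff_first_continuous coeff_last_continuous; simp)+

text \<open>The weak equation couples the pieces only through the common test function.\<close>

lemma weak_form_split:
  assumes e: "admissible e"
  shows "piece_form k a (b - \<tau>) zeroth_first coeff_first e + piece_form k (b - \<tau>) b zeroth_last coeff_last e = 0"
proof -
  have je: "jet_on k {a - \<tau>..b} e" using e by (simp add: admissible_def)
  have ce: "continuous_on T (e p)" if "p \<le> k" "T \<subseteq> {a..b}" for p T
    by (rule continuous_on_subset[OF jet_on_continuous[OF je that(1)]]) (use that tau in auto)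
  have cX: "continuous_on T (P (SlotX p))" if "p \<le> k" "T \<subseteq> {a..b}" for p T
    by (rule continuous_on_subset[OF P_continuous]) (use that in \<open>auto simp: slots_def\<close>)
  have cH: "continuous_on {a..b - \<tau>} (\<lambda>t. P (SlotH p) (t + \<tau>))" if "p \<le> k" for p
    by (rule continuous_on_compose2[OF P_continuous]) (use tau that in \<open>auto simp: slots_def intro!: continuous_intros\<close>)
  have sub: "{a..b - \<tau>} \<subseteq> {a..b}" "{b - \<tau>..b} \<subseteq> {a..b}" using tau by auto
  let ?X = "\<lambda>t. \<Sum>p\<le>k. P (SlotX p) t * e p t" and ?H = "\<lambda>t. \<Sum>p\<le>k. P (SlotH p) (t + \<tau>) * e p t"
  have iX: "?X integrable_on T" if "T = {a..b} \<or> T = {a..b - \<tau>}" for T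
    using that sub by (elim disjE; simp; intro integrable_continuous_real continuous_intros ce cX; simp)
  have iH: "?H integrable_on {a..b - \<tau>}"
    using sub by (intro integrable_continuous_real continuous_intros ce cH) auto
  note iG = weak_form(1)[OF e]
  have 1: "integral {a..b - \<tau>} (\<lambda>t. density t * e 0 t) + integral {b - \<tau>..b} (\<lambda>t. density t * e 0 t) = integral {a..b} (\<lambda>t. density t * e 0 t)"
    by (rule Henstock_Kurzweil_Integration.integral_combine[OF _ _ iG]) (use tau in auto)
  have 2: "integral {a..b - \<tau>} ?X + integral {b - \<tau>..b} ?X = integral {a..b} ?X"
    by (rule Henstock_Kurzweil_Integration.integral_combine) (use tau iX in auto)
  have 3: "integral {a..b - \<tau>} (\<lambda>t. \<Sum>p\<le>k. coeff_first p t * e p t) = integral {a..b - \<tau>} ?X + integral {a..b - \<tau>} ?H"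
    using Henstock_Kurzweil_Integration.integral_add[OF iX iH] by (simp add: coeff_first_def distrib_right sum.distrib)
  have P1: "integral {a..b - \<tau>} (\<lambda>t. density t * e 0 t) + integral {a..b - \<tau>} (\<lambda>t. \<Sum>p\<le>k. coeff_first p t * e p t) = piece_form k a (b - \<tau>) zeroth_first coeff_first e"
    unfolding zeroth_first_def
    by (rule piece_form_rearrange) (use integrable_on_subinterval[OF iG sub(1)] coeff_first_continuous ce[OF _ sub(1)] in auto)
  have P2: "integral {b - \<tau>..b} (\<lambda>t. density t * e 0 t) + integral {b - \<tau>..b} (\<lambda>t. \<Sum>p\<le>k. coeff_last p t * e p t) = piece_form k (b - \<tau>) b zeroth_last coeff_last e"
    unfolding zeroth_last_def
    by (rule piece_form_rearrange) (use integrable_on_subinterval[OF iG sub(2)] coeff_last_continuous ce[OF _ sub(2)] in auto)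
  show ?thesis using weak_form(2)[OF e] 1 2 3 P1 P2 by (simp add: coeff_last_def)
qed

text \<open>A test function on the first piece, extended by zero, leaves no trace on the last one.\<close>

lemma first_piece_weak:
  assumes e: "test_jet k a (b - \<tau>) e"
  shows "piece_form k a (b - \<tau>) zeroth_first coeff_first e = 0"
proof -
  let ?E = "\<lambda>p t. if t \<in> {a..b - \<tau>} then e p t else 0"
  have "piece_form k a (b - \<tau>) zeroth_first coeff_first ?E + piece_form k (b - \<tau>) b zeroth_last coeff_last ?E = 0"
    by (rule weak_form_split[OF admissible_test[OF e]]) (use tau in auto)
  moreover have "piece_form k a (b - \<tau>) zeroth_first coeff_first ?E = piece_form k a (b - \<tau>) zeroth_first coeff_first e"
    by (rule piece_form_cong) simp
  moreover have "piece_form k (b - \<tau>) b zeroth_last coeff_last ?E = piece_form k (b - \<tau>) b zeroth_last coeff_last (\<lambda>p t. 0)"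
    unfolding piece_form_def using e k
    by (intro arg_cong2[of _ _ _ _ "(+)"] Henstock_Kurzweil_Integration.integral_cong sum.cong refl) (auto simp: test_jet_def)
  ultimately show ?thesis by (simp add: piece_form_zero)
qed

lemma last_piece_weak:
  assumes e: "test_jet k (b - \<tau>) b e"
  shows "piece_form k (b - \<tau>) b zeroth_last coeff_last e = 0"
proof -
  let ?E = "\<lambda>p t. if t \<in> {b - \<tau>..b} then e p t else 0"
  have "piece_form k a (b - \<tau>) zeroth_first coeff_first ?E + piece_form k (b - \<tau>) b zeroth_last coeff_last ?E = 0"
    by (rule weak_form_split[OF admissible_test[OF e]]) (use tau in auto)
  moreover have "piece_form k (b - \<tau>) b zeroth_last coeff_last ?E = piece_form k (b - \<tau>) b zeroth_last coeff_last e"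
    by (rule piece_form_cong) simp
  moreover have "piece_form k a (b - \<tau>) zeroth_first coeff_first ?E = piece_form k a (b - \<tau>) zeroth_first coeff_first (\<lambda>p t. 0)"
    unfolding piece_form_def using e k
    by (intro arg_cong2[of _ _ _ _ "(+)"] Henstock_Kurzweil_Integration.integral_cong sum.cong refl) (auto simp: test_jet_def)
  ultimately show ?thesis by (simp add: piece_form_zero)
qed

lemma coeff_first_deriv:
  assumes "iter_deriv_exists {a..b - \<tau>} q (P (SlotX p)) t" "iter_deriv_exists {a..b - \<tau>} q (\<lambda>t. P (SlotH p) (t + \<tau>)) t"
    and "t \<in> {a..b - \<tau>}"
  shows "iter_deriv_exists {a..b - \<tau>} q (coeff_first p) t"
    and "iter_deriv {a..b - \<tau>} q (coeff_first p) t = iter_deriv {a..b - \<tau>} q (P (SlotX p)) t + iter_deriv {a..b - \<tau>} q (\<lambda>t. P (SlotH p) (t + \<tau>)) t"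
  using iter_deriv_linear[OF _ assms, of 1 1] tau by (auto simp: coeff_first_def)

lemma first_piece:
  shows "\<exists>C. \<forall>t\<in>{a..b - \<tau>}. C + integral {a..t} zeroth_first = (\<Sum>p<k. (- 1) ^ p * iter_deriv {a..b - \<tau>} p (coeff_first (Suc p)) t)"
    and "jet_on k {a..b - \<tau>} e \<Longrightarrow> piece_form k a (b - \<tau>) zeroth_first coeff_first e =
      increment (\<lambda>t. \<Sum>p<k. \<Sum>q\<le>p. (- 1) ^ q * iter_deriv {a..b - \<tau>} q (coeff_first (Suc p)) t * e (p - q) t) a (b - \<tau>)"
proof -
  have lt: "a < b - \<tau>" using tau by simp
  have R: "continuous_on {a..b - \<tau>} (coeff_first p)" if "p \<in> {1..k}" for p using coeff_first_continuous that by simp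
  have ex: "iter_deriv_exists {a..b - \<tau>} (p - 1) (coeff_first p) t" if "p \<in> {1..k}" "t \<in> {a..b - \<tau>}" for p t
    using coeff_first_deriv(1)[OF exX1 exH] that by (simp add: coeff_first_def)
  note * = piece_euler_poisson[OF lt k zeroth_integrable(1) R ex first_piece_weak]
  show "\<exists>C. \<forall>t\<in>{a..b - \<tau>}. C + integral {a..t} zeroth_first = (\<Sum>p<k. (- 1) ^ p * iter_deriv {a..b - \<tau>} p (coeff_first (Suc p)) t)"
    by (rule *(1))
  show "jet_on k {a..b - \<tau>} e \<Longrightarrow> piece_form k a (b - \<tau>) zeroth_first coeff_first e =
      increment (\<lambda>t. \<Sum>p<k. \<Sum>q\<le>p. (- 1) ^ q * iter_deriv {a..b - \<tau>} q (coeff_first (Suc p)) t * e (p - q) t) a (b - \<tau>)"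
    by (rule *(2))
qed

lemma last_piece:
  shows "\<exists>C. \<forall>t\<in>{b - \<tau>..b}. C + integral {b - \<tau>..t} zeroth_last = (\<Sum>p<k. (- 1) ^ p * iter_deriv {b - \<tau>..b} p (coeff_last (Suc p)) t)"
    and "jet_on k {b - \<tau>..b} e \<Longrightarrow> piece_form k (b - \<tau>) b zeroth_last coeff_last e =
      increment (\<lambda>t. \<Sum>p<k. \<Sum>q\<le>p. (- 1) ^ q * iter_deriv {b - \<tau>..b} q (coeff_last (Suc p)) t * e (p - q) t) (b - \<tau>) b"
proof -
  have lt: "b - \<tau> < b" using tau by simp
  have R: "continuous_on {b - \<tau>..b} (coeff_last p)" if "p \<in> {1..k}" for p using coeff_last_continuous that by simp
  have ex: "iter_deriv_exists {b - \<tau>..b} (p - 1) (coeff_last p) t" if "p \<in> {1..k}" "t \<in> {b - \<tau>..b}" for p t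
    using exX2[OF that] by (simp add: coeff_last_def)
  note * = piece_euler_poisson[OF lt k zeroth_integrable(2) R ex last_piece_weak]
  show "\<exists>C. \<forall>t\<in>{b - \<tau>..b}. C + integral {b - \<tau>..t} zeroth_last = (\<Sum>p<k. (- 1) ^ p * iter_deriv {b - \<tau>..b} p (coeff_last (Suc p)) t)"
    by (rule *(1))
  show "jet_on k {b - \<tau>..b} e \<Longrightarrow> piece_form k (b - \<tau>) b zeroth_last coeff_last e =
      increment (\<lambda>t. \<Sum>p<k. \<Sum>q\<le>p. (- 1) ^ q * iter_deriv {b - \<tau>..b} q (coeff_last (Suc p)) t * e (p - q) t) (b - \<tau>) b"
    by (rule *(2))
qed

text \<open>On the first piece the left-sided operators keep their base point \<open>a\<close>, whereas the right-sided ones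
change it from \<open>b\<close> to \<open>b - \<tau>\<close> and need the correction term.\<close>

lemma euler_lagrange_1:
  assumes t: "t \<in> {a..b - \<tau>}"
    and V: "\<And>i. i \<in> {1..n} \<Longrightarrow> RL_right_exists {a..b - \<tau>} (b - \<tau>) (\<alpha> i) (P (SlotV i)) t"
    and W: "\<And>j. j \<in> {1..m} \<Longrightarrow> RL_left_exists {a..b - \<tau>} a (\<beta> j) (P (SlotW j)) t"
    and X: "\<And>p. p \<le> k \<Longrightarrow> iter_deriv_exists {a..b - \<tau>} p (P (SlotX p)) t"
    and H: "\<And>p. p \<le> k \<Longrightarrow> iter_deriv_exists {a..b - \<tau>} p (\<lambda>t. P (SlotH p) (t + \<tau>)) t"
    and V': "\<And>i. i \<in> {1..n} \<Longrightarrow> RL_right_exists {a..b - \<tau>} (b - \<tau>) (\<alpha> i)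
       (\<lambda>t. integral {b - \<tau>..b} (\<lambda>s. RL_right {a..b} b (\<alpha> i) (P (SlotV i)) s * (s - t) powr (\<alpha> i - 1))) t"
  shows "(\<Sum>i=1..n. RL_right {a..b - \<tau>} (b - \<tau>) (\<alpha> i) (P (SlotV i)) t)
        + (\<Sum>j=1..m. RL_left {a..b - \<tau>} a (\<beta> j) (P (SlotW j)) t)
        + (\<Sum>p=0..k. (- 1) ^ p * iter_deriv {a..b - \<tau>} p (P (SlotX p)) t)
        + (\<Sum>p=0..k. (- 1) ^ p * iter_deriv {a..b - \<tau>} p (\<lambda>t. P (SlotH p) (t + \<tau>)) t)
        - (\<Sum>i=1..n. 1 / Gamma (\<alpha> i) * RL_right {a..b - \<tau>} (b - \<tau>) (\<alpha> i)
             (\<lambda>t. integral {b - \<tau>..b} (\<lambda>s. RL_right {a..b} b (\<alpha> i) (P (SlotV i)) s * (s - t) powr (\<alpha> i - 1))) t)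
        = 0"
proof -
  obtain C where C: "\<forall>t\<in>{a..b - \<tau>}. C + integral {a..t} zeroth_first = (\<Sum>p<k. (- 1) ^ p * iter_deriv {a..b - \<tau>} p (coeff_first (Suc p)) t)"
    using first_piece(1) by blast
  let ?h = "\<lambda>i t. integral {b - \<tau>..b} (\<lambda>s. RL_right {a..b} b (\<alpha> i) (P (SlotV i)) s * (s - t) powr (\<alpha> i - 1))"
  have dV: "((\<lambda>x. integral {a..x} (gV i)) has_vector_derivative
      RL_right {a..b - \<tau>} (b - \<tau>) (\<alpha> i) (P (SlotV i)) t - 1 / Gamma (\<alpha> i) * RL_right {a..b - \<tau>} (b - \<tau>) (\<alpha> i) (?h i) t)
      (at t within {a..b - \<tau>})" if i: "i \<in> {1..n}" for i
  proof -
    have g: "integrable lborel (gV i)" "\<forall>s>b. gV i s = 0"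
      and ae: "AE t in lborel. t \<in> {a..b} \<longrightarrow> P (SlotV i) t = rl_int_right (\<alpha> i) (gV i) t" using gV[OF i] by auto
    have al: "0 < \<alpha> i" "\<alpha> i \<notin> \<int>" using \<alpha>[OF i] by auto
    show ?thesis
      by (rule RL_right_shifted_imp_integral_derivative[OF _ _ al g ae P_continuous RL_right_ae_eq[OF ab al g ae] refl t V[OF i] V'[OF i]])
        (use i tau in \<open>auto simp: slots_def\<close>)
  qed
  have dW: "((\<lambda>x. integral {a..x} (gW j)) has_vector_derivative RL_left {a..b - \<tau>} a (\<beta> j) (P (SlotW j)) t) (at t within {a..b - \<tau>})"
    if j: "j \<in> {1..m}" for j
  proof (rule RL_left_imp_integral_derivative[OF _ _ _ _ _ _ t W[OF j]])
    show "AE t in lborel. t \<in> {a..b - \<tau>} \<longrightarrow> P (SlotW j) t = rl_int (\<beta> j) (gW j) t"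
      using gW[OF j] tau by (auto elim!: eventually_mono)
  qed (use gW[OF j] \<beta>[OF j] tau in auto)
  have "(\<Sum>i\<in>{1..n}. RL_right {a..b - \<tau>} (b - \<tau>) (\<alpha> i) (P (SlotV i)) t - 1 / Gamma (\<alpha> i) * RL_right {a..b - \<tau>} (b - \<tau>) (\<alpha> i) (?h i) t) +
      (\<Sum>j\<in>{1..m}. RL_left {a..b - \<tau>} a (\<beta> j) (P (SlotW j)) t) + (\<Sum>p\<le>k. (- 1) ^ p * iter_deriv {a..b - \<tau>} p (coeff_first p) t) = 0"
  proof (rule pointwise_equation[OF _ t _ _ _ _ _ dV dW coeff_first_continuous])
    show "C + integral {a..t} (\<lambda>t. (\<Sum>i\<in>{1..n}. gV i t) + (\<Sum>j\<in>{1..m}. gW j t) + (if t \<in> {a..b - \<tau>} then coeff_first 0 t else 0)) =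
       (\<Sum>p<k. (- 1) ^ p * iter_deriv {a..b - \<tau>} p (coeff_first (Suc p)) t)" if "t \<in> {a..b - \<tau>}" for t
      using C[rule_format, OF that] unfolding zeroth_first_def density_def .
    show "iter_deriv_exists {a..b - \<tau>} (Suc p) (coeff_first (Suc p)) t" if "p < k" for p
      by (rule coeff_first_deriv(1)[OF X H t]) (use that in auto)
  qed (use gV gW tau in auto)
  moreover have "(\<Sum>p\<le>k. (- 1) ^ p * iter_deriv {a..b - \<tau>} p (coeff_first p) t) =
      (\<Sum>p=0..k. (- 1) ^ p * iter_deriv {a..b - \<tau>} p (P (SlotX p)) t)
        + (\<Sum>p=0..k. (- 1) ^ p * iter_deriv {a..b - \<tau>} p (\<lambda>t. P (SlotH p) (t + \<tau>)) t)"
    unfolding atMost_atLeast0 sum.distrib[symmetric]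
    by (intro sum.cong refl) (simp add: coeff_first_deriv(2)[OF X H t] distrib_left)
  ultimately show ?thesis by (simp add: sum_subtractf)
qed

text \<open>On the last piece the roles are exchanged: the base point of the left-sided operators moves from \<open>a\<close> to
\<open>b - \<tau>\<close>.\<close>

lemma euler_lagrange_2:
  assumes t: "t \<in> {b - \<tau>..b}"
    and V: "\<And>i. i \<in> {1..n} \<Longrightarrow> RL_right_exists {b - \<tau>..b} b (\<alpha> i) (P (SlotV i)) t"
    and W: "\<And>j. j \<in> {1..m} \<Longrightarrow> RL_left_exists {b - \<tau>..b} (b - \<tau>) (\<beta> j) (P (SlotW j)) t"
    and X: "\<And>p. p \<le> k \<Longrightarrow> iter_deriv_exists {b - \<tau>..b} p (P (SlotX p)) t"
    and W': "\<And>j. j \<in> {1..m} \<Longrightarrow> RL_left_exists {b - \<tau>..b} (b - \<tau>) (\<beta> j)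
       (\<lambda>t. integral {a..b - \<tau>} (\<lambda>s. RL_left {a..b} a (\<beta> j) (P (SlotW j)) s * (t - s) powr (\<beta> j - 1))) t"
  shows "(\<Sum>i=1..n. RL_right {b - \<tau>..b} b (\<alpha> i) (P (SlotV i)) t)
        + (\<Sum>j=1..m. RL_left {b - \<tau>..b} (b - \<tau>) (\<beta> j) (P (SlotW j)) t)
        + (\<Sum>p=0..k. (- 1) ^ p * iter_deriv {b - \<tau>..b} p (P (SlotX p)) t)
        - (\<Sum>j=1..m. 1 / Gamma (\<beta> j) * RL_left {b - \<tau>..b} (b - \<tau>) (\<beta> j)
             (\<lambda>t. integral {a..b - \<tau>} (\<lambda>s. RL_left {a..b} a (\<beta> j) (P (SlotW j)) s * (t - s) powr (\<beta> j - 1))) t)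
        = 0"
proof -
  obtain C where C: "\<forall>t\<in>{b - \<tau>..b}. C + integral {b - \<tau>..t} zeroth_last = (\<Sum>p<k. (- 1) ^ p * iter_deriv {b - \<tau>..b} p (coeff_last (Suc p)) t)"
    using last_piece(1) by blast
  let ?h = "\<lambda>j t. integral {a..b - \<tau>} (\<lambda>s. RL_left {a..b} a (\<beta> j) (P (SlotW j)) s * (t - s) powr (\<beta> j - 1))"
  have dW: "((\<lambda>x. integral {b - \<tau>..x} (gW j)) has_vector_derivative
      RL_left {b - \<tau>..b} (b - \<tau>) (\<beta> j) (P (SlotW j)) t - 1 / Gamma (\<beta> j) * RL_left {b - \<tau>..b} (b - \<tau>) (\<beta> j) (?h j) t)
      (at t within {b - \<tau>..b})" if j: "j \<in> {1..m}" for j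
  proof -
    have g: "integrable lborel (gW j)" "\<forall>s<a. gW j s = 0"
      and ae: "AE t in lborel. t \<in> {a..b} \<longrightarrow> P (SlotW j) t = rl_int (\<beta> j) (gW j) t" using gW[OF j] by auto
    have be: "0 < \<beta> j" "\<beta> j \<notin> \<int>" using \<beta>[OF j] by auto
    have rho: "AE t in lborel. t \<in> {a..b} \<longrightarrow> RL_left {a..b} a (\<beta> j) (P (SlotW j)) t = gW j t"
      using RL_left_ae_eq[OF ab be g ae] by (auto elim!: eventually_mono)
    show ?thesis
      by (rule RL_left_shifted_imp_integral_derivative[OF _ _ be g ae P_continuous rho refl t W[OF j] W'[OF j]])
        (use j tau in \<open>auto simp: slots_def\<close>)
  qed
  have dV: "((\<lambda>x. integral {b - \<tau>..x} (gV i)) has_vector_derivative RL_right {b - \<tau>..b} b (\<alpha> i) (P (SlotV i)) t) (at t within {b - \<tau>..b})"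
    if i: "i \<in> {1..n}" for i
  proof (rule RL_right_imp_integral_derivative[OF _ _ _ _ _ _ t V[OF i]])
    show "AE t in lborel. t \<in> {b - \<tau>..b} \<longrightarrow> P (SlotV i) t = rl_int_right (\<alpha> i) (gV i) t"
      using gV[OF i] tau by (auto elim!: eventually_mono)
  qed (use gV[OF i] \<alpha>[OF i] tau in auto)
  have "(\<Sum>i\<in>{1..n}. RL_right {b - \<tau>..b} b (\<alpha> i) (P (SlotV i)) t) +
      (\<Sum>j\<in>{1..m}. RL_left {b - \<tau>..b} (b - \<tau>) (\<beta> j) (P (SlotW j)) t - 1 / Gamma (\<beta> j) * RL_left {b - \<tau>..b} (b - \<tau>) (\<beta> j) (?h j) t) +
      (\<Sum>p\<le>k. (- 1) ^ p * iter_deriv {b - \<tau>..b} p (coeff_last p) t) = 0"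
  proof (rule pointwise_equation[OF _ t _ _ _ _ _ dV dW coeff_last_continuous])
    show "C + integral {b - \<tau>..t} (\<lambda>t. (\<Sum>i\<in>{1..n}. gV i t) + (\<Sum>j\<in>{1..m}. gW j t) + (if t \<in> {b - \<tau>..b} then coeff_last 0 t else 0)) =
       (\<Sum>p<k. (- 1) ^ p * iter_deriv {b - \<tau>..b} p (coeff_last (Suc p)) t)" if "t \<in> {b - \<tau>..b}" for t
      using C[rule_format, OF that] unfolding zeroth_last_def density_def .
    show "iter_deriv_exists {b - \<tau>..b} (Suc p) (coeff_last (Suc p)) t" if "p < k" for p
      unfolding coeff_last_def by (rule X) (use that in simp)
  qed (use gV gW tau in auto)
  then show ?thesis by (simp add: sum_subtractf coeff_last_def atMost_atLeast0)
qed

text \<open>The variation itself is inserted in the weak equation. It is not a test function on either piece, so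
boundary terms remain, and their sum over both pieces is zero.\<close>

lemma transversality:
  assumes \<eta>: "\<And>\<epsilon>::real. (\<lambda>t. y t + \<epsilon> * \<eta> t) \<in> domain_J a b \<tau> n m k \<alpha> \<beta> c \<phi>"
    and \<eta>0: "\<And>t. t \<in> {a - \<tau>..a} \<Longrightarrow> \<eta> t = 0" and \<eta>b: "\<And>l. l < k \<Longrightarrow> iter_deriv {a - \<tau>..b} l \<eta> b = 0"
  shows "increment (\<lambda>t. \<Sum>p=1..k. \<Sum>q=0..p - 1. (- 1) ^ q *
            iter_deriv {a..b - \<tau>} q (P (SlotX p)) t * iter_deriv {a - \<tau>..b} (p - q - 1) \<eta> t) a (b - \<tau>)
        + increment (\<lambda>t. \<Sum>p=1..k. \<Sum>q=0..p - 1. (- 1) ^ q *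
            iter_deriv {a..b - \<tau>} q (\<lambda>t. P (SlotH p) (t + \<tau>)) t * iter_deriv {a - \<tau>..b} (p - q - 1) \<eta> t) a (b - \<tau>)
        + increment (\<lambda>t. \<Sum>p=1..k. \<Sum>q=0..p - 1. (- 1) ^ q *
            iter_deriv {b - \<tau>..b} q (P (SlotX p)) t * iter_deriv {a - \<tau>..b} (p - q - 1) \<eta> t) (b - \<tau>) b
        = 0"
proof -
  (* Regularity of the variation comes from that of y and of y + \<eta>, whose difference it is. *)
  define z where "z = (\<lambda>t. y t + 1 * \<eta> t)"
  have z: "z \<in> domain_J a b \<tau> n m k \<alpha> \<beta> c \<phi>" unfolding z_def by (rule \<eta>)
  define Z where "Z = (\<lambda>p. iter_deriv {a - \<tau>..b} p z)"
  have jZ: "jet_on k {a - \<tau>..b} Z" unfolding Z_def using z by (intro jet_on_iter_deriv) (simp add: domain_J_def)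
  have \<eta>_eq: "(\<lambda>t. 1 * Z 0 t + (- 1) * Y 0 t) = \<eta>" by (simp add: Z_def z_def)
  have tcd: "times_cont_differentiable_on k {a - \<tau>..b} \<eta>"
    by (rule jet_on_times_cont_differentiable[OF domain_order(1) jet_on_linear[OF jZ jet_on_Y, of 1 "- 1"]]) (simp add: Z_def z_def)
  define e where "e = (\<lambda>p. iter_deriv {a - \<tau>..b} p \<eta>)"
  have je: "jet_on k {a - \<tau>..b} e" unfolding e_def by (rule jet_on_iter_deriv[OF tcd])
  have "admissible e" unfolding admissible_def
  proof (intro conjI ballI allI impI)
    show "continuous_on {a..b} (caputo_left {a - \<tau>..b} a (\<alpha> i) (e 0))" if i: "i \<in> {1..n}" for i
    proof -
      have A: "caputo_left {a - \<tau>..b} a (\<alpha> i) (e 0) t = 1 * caputo_left {a - \<tau>..b} a (\<alpha> i) z t + (- 1) * caputo_left {a - \<tau>..b} a (\<alpha> i) y t"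
        if "t \<in> {a..b}" for t
        using caputo_linear(1)[OF jZ jet_on_Y that i, of 1 "- 1"] unfolding \<eta>_eq by (simp add: e_def Z_def)
      have B: "continuous_on {a..b} (\<lambda>t. 1 * caputo_left {a - \<tau>..b} a (\<alpha> i) z t + (- 1) * caputo_left {a - \<tau>..b} a (\<alpha> i) y t)"
        using z y i by (intro continuous_intros) (auto simp: domain_J_def)
      show ?thesis by (rule continuous_on_eq[OF B]) (rule A[symmetric])
    qed
    show "continuous_on {a..b} (caputo_right {a - \<tau>..b} b (\<beta> j) (e 0))" if j: "j \<in> {1..m}" for j
    proof -
      have A: "caputo_right {a - \<tau>..b} b (\<beta> j) (e 0) t = 1 * caputo_right {a - \<tau>..b} b (\<beta> j) z t + (- 1) * caputo_right {a - \<tau>..b} b (\<beta> j) y t"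
        if "t \<in> {a..b}" for t
        using caputo_linear(2)[OF jZ jet_on_Y that j, of 1 "- 1"] unfolding \<eta>_eq by (simp add: e_def Z_def)
      have B: "continuous_on {a..b} (\<lambda>t. 1 * caputo_right {a - \<tau>..b} b (\<beta> j) z t + (- 1) * caputo_right {a - \<tau>..b} b (\<beta> j) y t)"
        using z y j by (intro continuous_intros) (auto simp: domain_J_def)
      show ?thesis by (rule continuous_on_eq[OF B]) (rule A[symmetric])
    qed
  qed (use je \<eta>0 \<eta>b in \<open>auto simp: e_def\<close>)
  then have split: "piece_form k a (b - \<tau>) zeroth_first coeff_first e + piece_form k (b - \<tau>) b zeroth_last coeff_last e = 0" by (rule weak_form_split)
  have j1: "jet_on k {a..b - \<tau>} e" and j2: "jet_on k {b - \<tau>..b} e"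
    by (rule jet_on_subset[OF je]; use tau in auto)+
  have reindex: "(\<Sum>p=1..k. \<Sum>q=0..p - 1. (- 1) ^ q * A p q * iter_deriv {a - \<tau>..b} (p - q - 1) \<eta> t) =
      (\<Sum>p<k. \<Sum>q\<le>p. (- 1) ^ q * A (Suc p) q * e (p - q) t)" for A :: "nat \<Rightarrow> nat \<Rightarrow> real" and t
    by (simp only: One_nat_def sum.atLeast1_atMost_eq e_def) (simp add: atMost_atLeast0)
  have B1: "piece_form k a (b - \<tau>) zeroth_first coeff_first e =
      increment (\<lambda>t. \<Sum>p<k. \<Sum>q\<le>p. (- 1) ^ q * iter_deriv {a..b - \<tau>} q (P (SlotX (Suc p))) t * e (p - q) t) a (b - \<tau>) +
      increment (\<lambda>t. \<Sum>p<k. \<Sum>q\<le>p. (- 1) ^ q * iter_deriv {a..b - \<tau>} q (\<lambda>t. P (SlotH (Suc p)) (t + \<tau>)) t * e (p - q) t) a (b - \<tau>)"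
  proof -
    have D: "iter_deriv {a..b - \<tau>} q (coeff_first (Suc p)) t = iter_deriv {a..b - \<tau>} q (P (SlotX (Suc p))) t +
        iter_deriv {a..b - \<tau>} q (\<lambda>t. P (SlotH (Suc p)) (t + \<tau>)) t" if "t \<in> {a..b - \<tau>}" "p < k" "q \<le> p" for p q t
      using exX1[of "Suc p" t] exH[of "Suc p" t] that
      by (intro coeff_first_deriv(2)) (auto intro: iter_deriv_exists_antimono)
    have "(\<Sum>p<k. \<Sum>q\<le>p. (- 1) ^ q * iter_deriv {a..b - \<tau>} q (coeff_first (Suc p)) t * e (p - q) t) =
        (\<Sum>p<k. \<Sum>q\<le>p. (- 1) ^ q * iter_deriv {a..b - \<tau>} q (P (SlotX (Suc p))) t * e (p - q) t) +
        (\<Sum>p<k. \<Sum>q\<le>p. (- 1) ^ q * iter_deriv {a..b - \<tau>} q (\<lambda>t. P (SlotH (Suc p)) (t + \<tau>)) t * e (p - q) t)"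
      if "t \<in> {a..b - \<tau>}" for t
      unfolding sum.distrib[symmetric] using D[OF that] by (intro sum.cong refl) (simp add: algebra_simps)
    moreover have "a \<in> {a..b - \<tau>}" "b - \<tau> \<in> {a..b - \<tau>}" using tau by auto
    ultimately show ?thesis unfolding first_piece(2)[OF j1] by (simp add: increment_def)
  qed
  from last_piece(2)[OF j2] B1 split show ?thesis unfolding reindex by (simp add: coeff_last_def)
qed

end

lemma order_N_le:
  assumes "\<gamma> < real k" "0 < \<gamma>"
  shows "order_N \<gamma> \<le> k"
proof -
  have "\<lfloor>\<gamma>\<rfloor> < int k" using assms(1) by (simp add: floor_less_iff)
  moreover have "0 \<le> \<lfloor>\<gamma>\<rfloor>" using assms(2) by simp
  ultimately have "nat \<lfloor>\<gamma>\<rfloor> < k" by linarith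
  then show ?thesis by (simp add: order_N_def)
qed

theorem theorem3p1:
  fixes a b \<tau> :: real and n m k :: nat
    and \<alpha> \<beta> c :: "nat \<Rightarrow> real"
    and \<phi> y :: "real \<Rightarrow> real"
    and L :: "(slot \<Rightarrow> real) \<Rightarrow> real"
    and P :: "slot \<Rightarrow> real \<Rightarrow> real"
  assumes "a < b" and "0 < \<tau>" and "\<tau> < b - a" and "0 < n + m"
    and "\<forall>i\<in>{1..n}. 0 < \<alpha> i \<and> \<alpha> i \<notin> \<int>"
    and "\<forall>j\<in>{1..m}. 0 < \<beta> j \<and> \<beta> j \<notin> \<int>"
    and "real k - 1 \<le> Max (\<alpha> ` {1..n} \<union> \<beta> ` {1..m})"
    and "Max (\<alpha> ` {1..n} \<union> \<beta> ` {1..m}) < real k"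
    and "smooth_on_interval {a - \<tau>..a} \<phi>"
    and "has_continuous_first_second_partials {a - \<tau>..b} (slots n m k) L"
    and "y \<in> domain_J a b \<tau> n m k \<alpha> \<beta> c \<phi>"
    and "\<forall>z \<in> domain_J a b \<tau> n m k \<alpha> \<beta> c \<phi>.
           functional_J a b \<tau> n m k \<alpha> \<beta> L y \<le> functional_J a b \<tau> n m k \<alpha> \<beta> L z"
    and "P = (\<lambda>\<sigma> t. partial {a - \<tau>..b} \<sigma> L (arguments a b \<tau> n m k \<alpha> \<beta> y t))"
    and "\<forall>i\<in>{1..n}. P (SlotV i) \<in> RL_integral_range_right a b (\<alpha> i)"
    and "\<forall>j\<in>{1..m}. P (SlotW j) \<in> RL_integral_range_left a b (\<beta> j)"
    and "\<forall>p\<in>{1..k}.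
           (\<forall>t\<in>{a..b - \<tau>}. iter_deriv_exists {a..b - \<tau>} (p - 1) (P (SlotX p)) t) \<and>
           (\<forall>t\<in>{a..b - \<tau>}. iter_deriv_exists {a..b - \<tau>} (p - 1) (\<lambda>t. P (SlotH p) (t + \<tau>)) t) \<and>
           (\<forall>t\<in>{b - \<tau>..b}. iter_deriv_exists {b - \<tau>..b} (p - 1) (P (SlotX p)) t)"
  shows
    "(\<forall>t\<in>{a..b - \<tau>}.
        (\<forall>i\<in>{1..n}. RL_right_exists {a..b - \<tau>} (b - \<tau>) (\<alpha> i) (P (SlotV i)) t) \<and>
        (\<forall>j\<in>{1..m}. RL_left_exists {a..b - \<tau>} a (\<beta> j) (P (SlotW j)) t) \<and>
        (\<forall>p\<in>{0..k}. iter_deriv_exists {a..b - \<tau>} p (P (SlotX p)) t) \<and>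
        (\<forall>p\<in>{0..k}. iter_deriv_exists {a..b - \<tau>} p (\<lambda>t. P (SlotH p) (t + \<tau>)) t) \<and>
        (\<forall>i\<in>{1..n}. RL_right_exists {a..b - \<tau>} (b - \<tau>) (\<alpha> i)
           (\<lambda>t. integral {b - \<tau>..b} (\<lambda>s. RL_right {a..b} b (\<alpha> i) (P (SlotV i)) s * (s - t) powr (\<alpha> i - 1))) t)
        \<longrightarrow>
        (\<Sum>i=1..n. RL_right {a..b - \<tau>} (b - \<tau>) (\<alpha> i) (P (SlotV i)) t)
        + (\<Sum>j=1..m. RL_left {a..b - \<tau>} a (\<beta> j) (P (SlotW j)) t)
        + (\<Sum>p=0..k. (- 1) ^ p * iter_deriv {a..b - \<tau>} p (P (SlotX p)) t)
        + (\<Sum>p=0..k. (- 1) ^ p * iter_deriv {a..b - \<tau>} p (\<lambda>t. P (SlotH p) (t + \<tau>)) t)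
        - (\<Sum>i=1..n. 1 / Gamma (\<alpha> i) * RL_right {a..b - \<tau>} (b - \<tau>) (\<alpha> i)
             (\<lambda>t. integral {b - \<tau>..b} (\<lambda>s. RL_right {a..b} b (\<alpha> i) (P (SlotV i)) s * (s - t) powr (\<alpha> i - 1))) t)
        = 0) \<and>
     (\<forall>t\<in>{b - \<tau>..b}.
        (\<forall>i\<in>{1..n}. RL_right_exists {b - \<tau>..b} b (\<alpha> i) (P (SlotV i)) t) \<and>
        (\<forall>j\<in>{1..m}. RL_left_exists {b - \<tau>..b} (b - \<tau>) (\<beta> j) (P (SlotW j)) t) \<and>
        (\<forall>p\<in>{0..k}. iter_deriv_exists {b - \<tau>..b} p (P (SlotX p)) t) \<and>
        (\<forall>j\<in>{1..m}. RL_left_exists {b - \<tau>..b} (b - \<tau>) (\<beta> j)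
           (\<lambda>t. integral {a..b - \<tau>} (\<lambda>s. RL_left {a..b} a (\<beta> j) (P (SlotW j)) s * (t - s) powr (\<beta> j - 1))) t)
        \<longrightarrow>
        (\<Sum>i=1..n. RL_right {b - \<tau>..b} b (\<alpha> i) (P (SlotV i)) t)
        + (\<Sum>j=1..m. RL_left {b - \<tau>..b} (b - \<tau>) (\<beta> j) (P (SlotW j)) t)
        + (\<Sum>p=0..k. (- 1) ^ p * iter_deriv {b - \<tau>..b} p (P (SlotX p)) t)
        - (\<Sum>j=1..m. 1 / Gamma (\<beta> j) * RL_left {b - \<tau>..b} (b - \<tau>) (\<beta> j)
             (\<lambda>t. integral {a..b - \<tau>} (\<lambda>s. RL_left {a..b} a (\<beta> j) (P (SlotW j)) s * (t - s) powr (\<beta> j - 1))) t)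
        = 0) \<and>
     (\<forall>\<eta> :: real \<Rightarrow> real.
        (\<forall>\<epsilon>::real. (\<lambda>t. y t + \<epsilon> * \<eta> t) \<in> domain_J a b \<tau> n m k \<alpha> \<beta> c \<phi>) \<and>
        (\<forall>t\<in>{a - \<tau>..a}. \<eta> t = 0) \<and>
        (\<forall>l<k. iter_deriv {a - \<tau>..b} l \<eta> b = 0)
        \<longrightarrow>
        increment (\<lambda>t. \<Sum>p=1..k. \<Sum>q=0..p - 1. (- 1) ^ q *
            iter_deriv {a..b - \<tau>} q (P (SlotX p)) t * iter_deriv {a - \<tau>..b} (p - q - 1) \<eta> t) a (b - \<tau>)
        + increment (\<lambda>t. \<Sum>p=1..k. \<Sum>q=0..p - 1. (- 1) ^ q *
            iter_deriv {a..b - \<tau>} q (\<lambda>t. P (SlotH p) (t + \<tau>)) t * iter_deriv {a - \<tau>..b} (p - q - 1) \<eta> t) a (b - \<tau>)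
        + increment (\<lambda>t. \<Sum>p=1..k. \<Sum>q=0..p - 1. (- 1) ^ q *
            iter_deriv {b - \<tau>..b} q (P (SlotX p)) t * iter_deriv {a - \<tau>..b} (p - q - 1) \<eta> t) (b - \<tau>) b
        = 0)"
proof -
  note ab = assms(1) and tau = assms(2,3)
  have fin: "finite (\<alpha> ` {1..n} \<union> \<beta> ` {1..m})" by simp
  have lt: "\<gamma> < real k" if "\<gamma> \<in> \<alpha> ` {1..n} \<union> \<beta> ` {1..m}" for \<gamma>
    using Max_ge[OF fin that] assms(8) by linarith
  have "\<alpha> ` {1..n} \<union> \<beta> ` {1..m} \<noteq> {}" using assms(4) by auto
  then obtain \<gamma> where "\<gamma> \<in> \<alpha> ` {1..n} \<union> \<beta> ` {1..m}" by blast
  then have "0 < \<gamma>" "\<gamma> < real k" using assms(5,6) lt by auto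
  (* The largest order is positive and less than k. *)
  then have k: "0 < k" by (cases k) auto
  have \<alpha>: "0 < \<alpha> i \<and> \<alpha> i \<notin> \<int> \<and> order_N (\<alpha> i) \<le> k" if "i \<in> {1..n}" for i
    using assms(5) that lt[of "\<alpha> i"] by (auto intro!: order_N_le)
  have \<beta>: "0 < \<beta> j \<and> \<beta> j \<notin> \<int> \<and> order_N (\<beta> j) \<le> k" if "j \<in> {1..m}" for j
    using assms(6) that lt[of "\<beta> j"] by (auto intro!: order_N_le)
  have "\<forall>i\<in>{1..n}. \<exists>g. integrable lborel g \<and> (\<forall>s<a. g s = 0) \<and> (\<forall>s>b. g s = 0) \<and>
      (AE t in lborel. t \<in> {a..b} \<longrightarrow> P (SlotV i) t = rl_int_right (\<alpha> i) g t)"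
  proof
    fix i assume i: "i \<in> {1..n}"
    then have "0 < \<alpha> i" "P (SlotV i) \<in> RL_integral_range_right a b (\<alpha> i)"
      using \<alpha> assms(14) by auto
    then obtain g where "integrable lborel g" "\<forall>s<a. g s = 0" "\<forall>s>b. g s = 0"
      "AE t in lborel. t \<in> {a..b} \<longrightarrow> P (SlotV i) t = rl_int_right (\<alpha> i) g t"
      by (rule RL_integral_range_rightE)
    then show "\<exists>g. integrable lborel g \<and> (\<forall>s<a. g s = 0) \<and> (\<forall>s>b. g s = 0) \<and>
      (AE t in lborel. t \<in> {a..b} \<longrightarrow> P (SlotV i) t = rl_int_right (\<alpha> i) g t)" by blast
  qed
  from bchoice[OF this] obtain gV where gV: "\<forall>i\<in>{1..n}. integrable lborel (gV i) \<and> (\<forall>s<a. gV i s = 0) \<and>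
      (\<forall>s>b. gV i s = 0) \<and> (AE t in lborel. t \<in> {a..b} \<longrightarrow> P (SlotV i) t = rl_int_right (\<alpha> i) (gV i) t)"
    by (elim exE)
  have "\<forall>j\<in>{1..m}. \<exists>g. integrable lborel g \<and> (\<forall>s<a. g s = 0) \<and> (\<forall>s>b. g s = 0) \<and>
      (AE t in lborel. t \<in> {a..b} \<longrightarrow> P (SlotW j) t = rl_int (\<beta> j) g t)"
  proof
    fix j assume j: "j \<in> {1..m}"
    then have "0 < \<beta> j" "P (SlotW j) \<in> RL_integral_range_left a b (\<beta> j)"
      using \<beta> assms(15) by auto
    then obtain g where "integrable lborel g" "\<forall>s<a. g s = 0" "\<forall>s>b. g s = 0"
      "AE t in lborel. t \<in> {a..b} \<longrightarrow> P (SlotW j) t = rl_int (\<beta> j) g t"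
      by (rule RL_integral_range_leftE)
    then show "\<exists>g. integrable lborel g \<and> (\<forall>s<a. g s = 0) \<and> (\<forall>s>b. g s = 0) \<and>
      (AE t in lborel. t \<in> {a..b} \<longrightarrow> P (SlotW j) t = rl_int (\<beta> j) g t)" by blast
  qed
  from bchoice[OF this] obtain gW where gW: "\<forall>j\<in>{1..m}. integrable lborel (gW j) \<and> (\<forall>s<a. gW j s = 0) \<and>
      (\<forall>s>b. gW j s = 0) \<and> (AE t in lborel. t \<in> {a..b} \<longrightarrow> P (SlotW j) t = rl_int (\<beta> j) (gW j) t)"
    by (elim exE)
  interpret regular_minimizer a b \<tau> n m k \<alpha> \<beta> c \<phi> y L P gV gW
  proof unfold_locales
    show "has_continuous_partials {a - \<tau>..b} (slots n m k) L"
      using assms(10) by (simp add: has_continuous_first_second_partials_def)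
  qed (use ab tau \<alpha> \<beta> gV gW k assms(11,12,13,16) in blast)+
  show ?thesis
    using euler_lagrange_1 euler_lagrange_2 transversality
    by (intro conjI ballI allI impI; (elim conjE)?; simp only: atLeast0AtMost atMost_iff)
qed

end
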